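(* Let $0<\theta<1$. Let $E\subset A$ be an operator space embedded in a $C^*$-algebra $A$. Then any linear map $u\colon E\to\ell_2$ for which there are states $f,g$ on $A$ and a constant $K$ such that $$\forall a\in E\qquad \|ua\|\le K\, f(a^*a)^{(1-\theta)/2}\, g(aa^* )^{\theta/2}$$ is completely bounded, with $\|u\|_{cb}\le K$, as a mapping into $\ell_2$ equipped with the operator space structure of $(C,R)_\theta$.
   Context: $E$ is a closed subspace of $A$ with the operator space structure induced by $A$. For a map $u$ between operator spaces, $\|u\|_{cb}=\sup_n\|\mathrm{id}_{M_n}\otimes u\|$. The row and column spaces are $R=\overline{\mathrm{span}}\{e_{1j}\mid j\ge1\}$ and $C=\overline{\mathrm{span}}\{e_{i1}\mid i\ge1\}$ in $B(\ell_2)$, with the induced operator space structures. View $(C,R)$ as a compatible couple by means of the transposition map $e_{i1}\leftrightarrow e_{1i}$. Then $(C,R)_\theta$ is the complex interpolation space with the operator space structure determined by $M_n((C,R)_\theta)=(M_n(C),M_n(R))_\theta$ isometrically for all $n\ge1$. It is isometric to $\ell_2$ as a Banach space. Explicitly, if $(e_i(\theta))$ is an orthonormal basis of $(C,R)_\theta$, then for any finite sequence $(a_i)$ in $B(\ell_2)$, $$\Big\|\sum a_i\otimes e_i(\theta)\Big\|_{\min}=\sup\Big\{\Big(\sum\|s^\theta a_i t^{1-\theta}\|_2^2\Big)^{1/2}\ \Big|\ s,t\ge0,\ \|s\|_2\le1,\ \|t\|_2\le1\Big\},$$ where $\|\cdot\|_2$ is the Hilbert–Schmidt norm. *)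

theory Defs
  imports "HOL-Analysis.Analysis" "HOL-Library.Function_Algebras"
begin

subsection \<open>Complex vector spaces and C*-algebras\<close>

class complex_vector = ab_group_add +
  fixes scaleC :: "complex \<Rightarrow> 'a \<Rightarrow> 'a"  (infixr \<open>*\<^sub>C\<close> 75)
  assumes scaleC_add_right: "c *\<^sub>C (x + y) = c *\<^sub>C x + c *\<^sub>C y"
    and scaleC_add_left: "(c + d) *\<^sub>C x = c *\<^sub>C x + d *\<^sub>C x"
    and scaleC_scaleC: "c *\<^sub>C d *\<^sub>C x = (c * d) *\<^sub>C x"
    and scaleC_one: "1 *\<^sub>C x = x"

instantiation complex :: complex_vector
begin

definition "c *\<^sub>C (x::complex) = c * x"

instance
  by standard (simp_all add: scaleC_complex_def algebra_simps)

end

instantiation "fun" :: (type, complex_vector) complex_vector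
begin

definition "c *\<^sub>C f = (\<lambda>x. c *\<^sub>C f x)"

instance
  by standard (simp_all add: scaleC_fun_def fun_eq_iff scaleC_add_right scaleC_add_left
      scaleC_scaleC scaleC_one)

end

text \<open>No unit is assumed.\<close>

class cstar_algebra = complex_vector + real_normed_algebra + banach +
  fixes star :: "'a \<Rightarrow> 'a"
  assumes scaleC_of_real: "of_real r *\<^sub>C x = r *\<^sub>R x"
    and norm_scaleC: "norm (c *\<^sub>C x) = cmod c * norm x"
    and mult_scaleC_left: "(c *\<^sub>C x) * y = c *\<^sub>C (x * y)"
    and mult_scaleC_right: "x * (c *\<^sub>C y) = c *\<^sub>C (x * y)"
    and star_star: "star (star x) = x"
    and star_add: "star (x + y) = star x + star y"
    and star_scaleC: "star (c *\<^sub>C x) = cnj c *\<^sub>C star x"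
    and star_mult: "star (x * y) = star y * star x"
    and cstar_identity: "norm (star x * x) = (norm x)\<^sup>2"

instantiation complex :: cstar_algebra
begin

definition "star (x::complex) = cnj x"

instance
  by standard (simp_all add: scaleC_complex_def star_complex_def scaleR_conv_of_real
      norm_mult power2_eq_square)

end

definition csubspace :: "'a::complex_vector set \<Rightarrow> bool" where
  "csubspace E \<longleftrightarrow> 0 \<in> E \<and> (\<forall>x\<in>E. \<forall>y\<in>E. x + y \<in> E) \<and> (\<forall>c. \<forall>x\<in>E. c *\<^sub>C x \<in> E)"

definition clinear_on :: "'a::complex_vector set \<Rightarrow> ('a \<Rightarrow> 'b::complex_vector) \<Rightarrow> bool" where
  "clinear_on E u \<longleftrightarrow>
     (\<forall>x\<in>E. \<forall>y\<in>E. u (x + y) = u x + u y) \<and> (\<forall>c. \<forall>x\<in>E. u (c *\<^sub>C x) = c *\<^sub>C u x)"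

definition state :: "('a::cstar_algebra \<Rightarrow> complex) \<Rightarrow> bool" where
  "state f \<longleftrightarrow> clinear_on UNIV f \<and> bounded_linear f \<and>
     (\<forall>a. f (star a * a) \<in> \<real>\<^sub>\<ge>\<^sub>0) \<and> onorm f = 1"


subsection \<open>Matrices and operator space structures\<close>

text \<open>An \<open>n \<times> n\<close> matrix is a function of two indices that vanishes unless both are below \<open>n\<close>.\<close>

type_synonym 'v matrix = "nat \<Rightarrow> nat \<Rightarrow> 'v"

definition matrices :: "nat \<Rightarrow> 'v::zero set \<Rightarrow> 'v matrix set" where
  "matrices n V = {X. \<forall>i j. if i < n \<and> j < n then X i j \<in> V else X i j = 0}"

definition matrix_mult :: "nat \<Rightarrow> 'a::semiring_0 matrix \<Rightarrow> 'a matrix \<Rightarrow> 'a matrix" where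
  "matrix_mult n X Y = (\<lambda>i j. \<Sum>k<n. X i k * Y k j)"

definition matrix_star :: "'a::cstar_algebra matrix \<Rightarrow> 'a matrix" where
  "matrix_star X = (\<lambda>i j. star (X j i))"

text \<open>
  The following says that \<open>N\<close> makes the *-algebra \<open>M\<^sub>n(A)\<close> a C*-algebra. Such a norm exists
  and is unique, so it is the norm of \<open>M\<^sub>n(A)\<close> in the operator space structure of the
  C*-algebra \<open>A\<close>.
\<close>

definition cstar_matrix_norm :: "nat \<Rightarrow> ('a::cstar_algebra matrix \<Rightarrow> real) \<Rightarrow> bool" where
  "cstar_matrix_norm n N \<longleftrightarrow>
     (\<forall>X\<in>matrices n UNIV. N X = 0 \<longrightarrow> X = 0) \<and>
     (\<forall>X\<in>matrices n UNIV. \<forall>Y\<in>matrices n UNIV. N (X + Y) \<le> N X + N Y) \<and>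
     (\<forall>c. \<forall>X\<in>matrices n UNIV. N (c *\<^sub>C X) = cmod c * N X) \<and>
     (\<forall>X\<in>matrices n UNIV. \<forall>Y\<in>matrices n UNIV. N (matrix_mult n X Y) \<le> N X * N Y) \<and>
     (\<forall>X\<in>matrices n UNIV. N (matrix_mult n (matrix_star X) X) = (N X)\<^sup>2) \<and>
     (\<forall>S. (\<forall>k. S k \<in> matrices n UNIV) \<and>
          (\<forall>e>0. \<exists>m. \<forall>k\<ge>m. \<forall>l\<ge>m. N (S k - S l) < e) \<longrightarrow>
          (\<exists>L\<in>matrices n UNIV. (\<lambda>k. N (S k - L)) \<longlonglongrightarrow> 0))"

text \<open>
  \<open>N n\<close> and \<open>N' n\<close> are the norms on \<open>n \<times> n\<close> matrices over the source and the target.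
  The source is the subspace \<open>E\<close> with the norms restricted to matrices over \<open>E\<close>.
\<close>

definition cb_norm ::
  "'a::zero set \<Rightarrow> (nat \<Rightarrow> 'a matrix \<Rightarrow> real) \<Rightarrow> (nat \<Rightarrow> 'b matrix \<Rightarrow> real) \<Rightarrow> ('a \<Rightarrow> 'b) \<Rightarrow> ereal" where
  "cb_norm E N N' u =
     (SUP n\<in>{1..}. SUP X\<in>{X \<in> matrices n E. N n X \<le> 1}. ereal (N' n (\<lambda>i j. u (X i j))))"

definition completely_bounded ::
  "'a::zero set \<Rightarrow> (nat \<Rightarrow> 'a matrix \<Rightarrow> real) \<Rightarrow> (nat \<Rightarrow> 'b matrix \<Rightarrow> real) \<Rightarrow> ('a \<Rightarrow> 'b) \<Rightarrow> bool" where
  "completely_bounded E N N' u \<longleftrightarrow> cb_norm E N N' u < \<infinity>"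


subsection \<open>The row and column spaces\<close>

definition ell2 :: "(nat \<Rightarrow> complex) set" where
  "ell2 = {x. summable (\<lambda>i. (cmod (x i))\<^sup>2)}"

definition ell2_norm :: "(nat \<Rightarrow> complex) \<Rightarrow> real" where
  "ell2_norm x = sqrt (\<Sum>i. (cmod (x i))\<^sup>2)"

type_synonym ell2_operator = "(nat \<Rightarrow> complex) \<Rightarrow> (nat \<Rightarrow> complex)"

text \<open>The norm of \<open>M\<^sub>n(B(\<ell>\<^sub>2)) = B(\<ell>\<^sub>2\<^sup>n)\<close>.\<close>

definition operator_matrix_norm :: "nat \<Rightarrow> ell2_operator matrix \<Rightarrow> real" where
  "operator_matrix_norm n T =
     Sup {sqrt (\<Sum>i<n. (ell2_norm (\<Sum>j<n. T i j (h j)))\<^sup>2) | h.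
            (\<forall>j<n. h j \<in> ell2) \<and> (\<Sum>j<n. (ell2_norm (h j))\<^sup>2) \<le> 1}"

definition matrix_unit :: "nat \<Rightarrow> nat \<Rightarrow> ell2_operator" where
  "matrix_unit i j h = (\<lambda>k. if k = i then h j else 0)"

text \<open>
  Indices start at 0. The operators \<open>\<Sum>\<^sub>i x\<^sub>i e\<^sub>i\<^sub>0\<close> and \<open>\<Sum>\<^sub>i x\<^sub>i e\<^sub>0\<^sub>i\<close> have norm \<open>\<parallel>x\<parallel>\<^sub>2\<close>, so
  as \<open>x\<close> ranges over \<open>\<ell>\<^sub>2\<close> they run through the closed spans \<open>C\<close> and \<open>R\<close>, each exactly once.
  Both spaces are thereby identified with \<open>\<ell>\<^sub>2\<close>, and elements of \<open>C\<close> and \<open>R\<close> corresponding to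
  the same \<open>x\<close> are exchanged by transposition.
\<close>

definition column_operator :: "(nat \<Rightarrow> complex) \<Rightarrow> ell2_operator" where
  "column_operator x h = (\<lambda>k. \<Sum>i. x i * matrix_unit i 0 h k)"

definition row_operator :: "(nat \<Rightarrow> complex) \<Rightarrow> ell2_operator" where
  "row_operator x h = (\<lambda>k. \<Sum>i. x i * matrix_unit 0 i h k)"

lemma column_operator_eq: "column_operator x h = (\<lambda>k. x k * h 0)"
proof
  fix k
  have "(\<Sum>i. x i * matrix_unit i 0 h k) = (\<Sum>i\<in>{k}. x i * matrix_unit i 0 h k)"
    by (rule suminf_finite) (auto simp: matrix_unit_def)
  then show "column_operator x h k = x k * h 0"
    by (simp add: column_operator_def matrix_unit_def)
qed

lemma row_operator_eq: "row_operator x h = (\<lambda>k. if k = 0 then \<Sum>i. x i * h i else 0)"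
  by (auto simp: row_operator_def matrix_unit_def)

definition column_norm :: "nat \<Rightarrow> (nat \<Rightarrow> complex) matrix \<Rightarrow> real" where
  "column_norm n X = operator_matrix_norm n (\<lambda>i j. column_operator (X i j))"

definition row_norm :: "nat \<Rightarrow> (nat \<Rightarrow> complex) matrix \<Rightarrow> real" where
  "row_norm n X = operator_matrix_norm n (\<lambda>i j. row_operator (X i j))"


subsection \<open>Complex interpolation\<close>

text \<open>
  A compatible couple is given by two subspaces \<open>X\<^sub>0\<close>, \<open>X\<^sub>1\<close> of a common complex vector space
  with norms \<open>p\<^sub>0\<close>, \<open>p\<^sub>1\<close>. All limits below are with respect to explicitly given norms.
\<close>

definition sum_space :: "'v::complex_vector set \<Rightarrow> 'v set \<Rightarrow> 'v set" where
  "sum_space X\<^sub>0 X\<^sub>1 = {a + b | a b. a \<in> X\<^sub>0 \<and> b \<in> X\<^sub>1}"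

definition sum_norm ::
  "'v::complex_vector set \<Rightarrow> ('v \<Rightarrow> real) \<Rightarrow> 'v set \<Rightarrow> ('v \<Rightarrow> real) \<Rightarrow> 'v \<Rightarrow> real" where
  "sum_norm X\<^sub>0 p\<^sub>0 X\<^sub>1 p\<^sub>1 x = Inf {p\<^sub>0 a + p\<^sub>1 b | a b. a \<in> X\<^sub>0 \<and> b \<in> X\<^sub>1 \<and> x = a + b}"

definition norm_continuous_on ::
  "('v::minus \<Rightarrow> real) \<Rightarrow> 's::topological_space set \<Rightarrow> ('s \<Rightarrow> 'v) \<Rightarrow> bool" where
  "norm_continuous_on p S F \<longleftrightarrow> (\<forall>z\<in>S. ((\<lambda>w. p (F w - F z)) \<longlongrightarrow> 0) (at z within S))"

definition norm_holomorphic_on ::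
  "'v::complex_vector set \<Rightarrow> ('v \<Rightarrow> real) \<Rightarrow> complex set \<Rightarrow> (complex \<Rightarrow> 'v) \<Rightarrow> bool" where
  "norm_holomorphic_on V p S F \<longleftrightarrow>
     (\<forall>z\<in>S. \<exists>D\<in>V. ((\<lambda>w. p (inverse (w - z) *\<^sub>C (F w - F z) - D)) \<longlongrightarrow> 0) (at z within S))"

definition calderon_functions ::
  "'v::complex_vector set \<Rightarrow> ('v \<Rightarrow> real) \<Rightarrow> 'v set \<Rightarrow> ('v \<Rightarrow> real) \<Rightarrow> (complex \<Rightarrow> 'v) set" where
  "calderon_functions X\<^sub>0 p\<^sub>0 X\<^sub>1 p\<^sub>1 =
     {F. (\<forall>z\<in>{z. 0 \<le> Re z \<and> Re z \<le> 1}. F z \<in> sum_space X\<^sub>0 X\<^sub>1) \<and>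
         (\<exists>B. \<forall>z\<in>{z. 0 \<le> Re z \<and> Re z \<le> 1}. sum_norm X\<^sub>0 p\<^sub>0 X\<^sub>1 p\<^sub>1 (F z) \<le> B) \<and>
         norm_continuous_on (sum_norm X\<^sub>0 p\<^sub>0 X\<^sub>1 p\<^sub>1) {z. 0 \<le> Re z \<and> Re z \<le> 1} F \<and>
         norm_holomorphic_on (sum_space X\<^sub>0 X\<^sub>1) (sum_norm X\<^sub>0 p\<^sub>0 X\<^sub>1 p\<^sub>1)
           {z. 0 < Re z \<and> Re z < 1} F \<and>
         (\<forall>t. F (Complex 0 t) \<in> X\<^sub>0) \<and> (\<exists>B. \<forall>t. p\<^sub>0 (F (Complex 0 t)) \<le> B) \<and>
         norm_continuous_on p\<^sub>0 UNIV (\<lambda>t. F (Complex 0 t)) \<and>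
         (\<forall>t. F (Complex 1 t) \<in> X\<^sub>1) \<and> (\<exists>B. \<forall>t. p\<^sub>1 (F (Complex 1 t)) \<le> B) \<and>
         norm_continuous_on p\<^sub>1 UNIV (\<lambda>t. F (Complex 1 t))}"

definition calderon_norm ::
  "('v \<Rightarrow> real) \<Rightarrow> ('v \<Rightarrow> real) \<Rightarrow> (complex \<Rightarrow> 'v) \<Rightarrow> real" where
  "calderon_norm p\<^sub>0 p\<^sub>1 F = max (SUP t. p\<^sub>0 (F (Complex 0 t))) (SUP t. p\<^sub>1 (F (Complex 1 t)))"

definition interpolation_norm ::
  "real \<Rightarrow> 'v::complex_vector set \<Rightarrow> ('v \<Rightarrow> real) \<Rightarrow> 'v set \<Rightarrow> ('v \<Rightarrow> real) \<Rightarrow> 'v \<Rightarrow> real" where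
  "interpolation_norm \<theta> X\<^sub>0 p\<^sub>0 X\<^sub>1 p\<^sub>1 x =
     Inf {calderon_norm p\<^sub>0 p\<^sub>1 F | F. F \<in> calderon_functions X\<^sub>0 p\<^sub>0 X\<^sub>1 p\<^sub>1 \<and> F (of_real \<theta>) = x}"

text \<open>
  The norm of \<open>M\<^sub>n((C,R)\<^sub>\<theta>) = (M\<^sub>n(C), M\<^sub>n(R))\<^sub>\<theta>\<close>. Both spaces of the couple are \<open>M\<^sub>n(\<ell>\<^sub>2)\<close> as
  sets, so the constant functions show that the infimum is over a nonempty set.
\<close>

definition CR_norm :: "real \<Rightarrow> nat \<Rightarrow> (nat \<Rightarrow> complex) matrix \<Rightarrow> real" where
  "CR_norm \<theta> n =
     interpolation_norm \<theta> (matrices n ell2) (column_norm n) (matrices n ell2) (row_norm n)"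

end

theory Submission
  imports Defs
begin

text \<open>
  For a matrix \<open>U\<close> over \<open>\<ell>\<^sub>2\<close> let \<open>\<Phi>(a,b) = \<Sum>\<^sub>m tr (a\<^sup>\<theta> U\<^sub>m b\<^bsup>1-\<theta>\<^esup> U\<^sub>m\<^sup>*)\<close>, where \<open>a\<close>, \<open>b\<close> are densities (positive
  \<open>n \<times> n\<close> matrices of trace 1) and \<open>U\<^sub>m\<close> are the coordinates of \<open>U\<close>. If \<open>U = (u(x\<^sub>i\<^sub>j))\<close> with \<open>x\<close> in the
  unit ball of \<open>M\<^sub>n(E)\<close>, the hypothesis on \<open>u\<close> and Young's inequality give \<open>\<Phi> \<le> K\<^sup>2\<close>.

  Conversely, if \<open>\<Phi> \<le> M\<close> and the maximum \<open>M\<close> is attained at \<open>(a,b)\<close>, the equality case of the Hoelder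
  inequality, applied to each variable separately, gives \<open>\<Sum>\<^sub>m U\<^sub>m\<^sup>* a\<^sup>\<theta> U\<^sub>m = M b\<^sup>\<theta>\<close> and
  \<open>\<Sum>\<^sub>m U\<^sub>m b\<^bsup>1-\<theta>\<^esup> U\<^sub>m\<^sup>* = M a\<^bsup>1-\<theta>\<^esup>\<close>. Hence the analytic function
  \<open>F(z) = a\<^bsup>(\<theta>-z)/2\<^esup> U b\<^bsup>(z-\<theta>)/2\<^esup>\<close>, for which \<open>F(\<theta>) = U\<close>, has norm \<open>M\<^bsup>1/2\<^esup>\<close> in \<open>M\<^sub>n(C)\<close> on the
  line \<open>Re z = 0\<close> and in \<open>M\<^sub>n(R)\<close> on the line \<open>Re z = 1\<close>, so that the interpolation norm of \<open>U\<close> is at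
  most \<open>M\<^bsup>1/2\<^esup>\<close>. Adding \<open>\<epsilon> tr (a\<^sup>\<theta>) tr (b\<^bsup>1-\<theta>\<^esup>)\<close> to \<open>\<Phi>\<close> makes the extremal densities invertible.
\<close>

subsection \<open>Complete C*-norms dominate the given norm\<close>

text \<open>The norm of \<open>M_n(A)\<close> is known only through its axioms, so it has to be tied
  to the norm of A. A copy of A at a diagonal position of \<open>M_n(A)\<close> carries a complete
  C*-norm, and such a norm dominates the given one. This bounds the sums of
  \<open>x_ij^* x_ij\<close> along a column and of \<open>x_ij x_ij^*\<close> along a row, on which
  the two states are evaluated. The target norm is an infimum over functions on the strip, so an
  upper bound calls for one good function; a bound on weighted sums does not provide it by itself,
  and the extremal densities do. Fractional powers of matrices never appear: a density is encoded by
  a unitary and a list of eigenvalues, and U is compressed to the eigenbases. Unitaries and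
  eigenvalue lists form compact sets, so the maximum exists.\<close>

lemma scaleC_zero_right [simp]: "c *\<^sub>C (0::'a::complex_vector) = 0"
  using scaleC_add_right [of c 0 "0::'a"] by simp

lemma scaleC_zero_left [simp]: "0 *\<^sub>C (x::'a::complex_vector) = 0"
  using scaleC_add_left [of 0 0 x] by simp

lemma scaleC_minus_right [simp]: "c *\<^sub>C (- (x::'a::complex_vector)) = - (c *\<^sub>C x)"
  using scaleC_add_right [of c x "- x"] by (simp add: eq_neg_iff_add_eq_0 add.commute)

lemma scaleC_minus_left [simp]: "(- c) *\<^sub>C (x::'a::complex_vector) = - (c *\<^sub>C x)"
  using scaleC_add_left [of "- c" c x] by (simp add: eq_neg_iff_add_eq_0)

lemma scaleC_diff_right: "c *\<^sub>C ((x::'a::complex_vector) - y) = c *\<^sub>C x - c *\<^sub>C y"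
  using scaleC_add_right [of c x "- y"] by simp

lemma scaleC_diff_left: "(c - d) *\<^sub>C (x::'a::complex_vector) = c *\<^sub>C x - d *\<^sub>C x"
  using scaleC_add_left [of c "- d" x] by simp

lemma scaleC_sum_right: "c *\<^sub>C (\<Sum>i\<in>I. (x i::'a::complex_vector)) = (\<Sum>i\<in>I. c *\<^sub>C x i)"
  by (induction I rule: infinite_finite_induct) (simp_all add: scaleC_add_right)

lemma scaleC_sum_left: "(\<Sum>i\<in>I. c i) *\<^sub>C (x::'a::complex_vector) = (\<Sum>i\<in>I. c i *\<^sub>C x)"
  by (induction I rule: infinite_finite_induct) (simp_all add: scaleC_add_left)

declare scaleC_one [simp]

lemma scaleC_two: "2 *\<^sub>C (x::'a::complex_vector) = x + x"
  using scaleC_add_left [of 1 1 x] by simp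

lemma scaleC_half: "(1/2) *\<^sub>C (x + x) = (x::'a::complex_vector)"
  by (simp add: scaleC_add_right scaleC_add_left [symmetric])

lemma star_zero [simp]: "star (0::'a::cstar_algebra) = 0"
  using star_add [of 0 "0::'a"] by simp

lemma star_minus: "star (- (x::'a::cstar_algebra)) = - star x"
  using star_add [of x "- x"] by (simp add: eq_neg_iff_add_eq_0 add.commute)

lemma star_diff: "star ((x::'a::cstar_algebra) - y) = star x - star y"
  using star_add [of x "- y"] by (simp add: star_minus)

lemma star_sum: "star (\<Sum>i\<in>I. (x i::'a::cstar_algebra)) = (\<Sum>i\<in>I. star (x i))"
  by (induction I rule: infinite_finite_induct) (simp_all add: star_add)

text \<open>An abstract second norm on the same algebra. It will be the norm that
  \<open>M_n(A)\<close> induces on a diagonal corner, for which the axioms of a complete C*-norm are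
  all the information there is.\<close>

locale complete_cstar_norm =
  fixes p :: "'a::cstar_algebra \<Rightarrow> real"
  assumes eq_0D: "p x = 0 \<Longrightarrow> x = 0"
    and triangle: "p (x + y) \<le> p x + p y"
    and homogeneous: "p (c *\<^sub>C x) = cmod c * p x"
    and submult: "p (x * y) \<le> p x * p y"
    and cstar: "p (star x * x) = (p x)\<^sup>2"
    and complete: "(\<And>e. e > 0 \<Longrightarrow> \<exists>m. \<forall>k\<ge>m. \<forall>l\<ge>m. p (S k - S l) < e) \<Longrightarrow>
      \<exists>L. (\<lambda>k. p (S k - L)) \<longlonglongrightarrow> 0"
begin

lemma zero [simp]: "p 0 = 0"
  using homogeneous [of 0 0] by simp

lemma minus: "p (- x) = p x"
  using homogeneous [of "-1" x] by simp

lemma minus_commute: "p (x - y) = p (y - x)"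
  using minus [of "x - y"] by simp

lemma nonneg: "0 \<le> p x"
  using triangle [of x "- x"] by (simp add: minus)

lemma triangle_diff: "p (x - z) \<le> p (x - y) + p (y - z)"
  using triangle [of "x - y" "y - z"] by simp

lemma star: "p (star x) = p x"
proof -
  have le: "p y \<le> p (star y)" for y
  proof (cases "p y = 0")
    case True then show ?thesis by (simp add: nonneg)
  next
    case False
    have "p y * p y \<le> p (star y) * p y"
      using submult [of "star y" y] by (simp add: cstar power2_eq_square)
    with False show ?thesis using nonneg [of y] by simp
  qed
  from le [of x] le [of "star x"] show ?thesis by (simp add: star_star)
qed

lemma eqI_limit:
  assumes "\<And>k. p (x - y) \<le> s k" and "s \<longlonglongrightarrow> 0"
  shows "x = y"
proof -
  have "p (x - y) \<le> 0"
    using LIMSEQ_le_const [OF assms(2)] assms(1) by blast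
  then show ?thesis using nonneg [of "x - y"] eq_0D [of "x - y"] by simp
qed

lemma geometric_convergence:
  assumes "0 \<le> r" "r < 1" and step: "\<And>k. p (S (Suc k) - S k) \<le> r ^ k"
  shows "\<exists>L. (\<lambda>k. p (S k - L)) \<longlonglongrightarrow> 0"
proof (rule complete)
  have dist: "p (S (k + d) - S k) \<le> r ^ k * (\<Sum>i<d. r ^ i)" for k d
  proof (induction d)
    case (Suc d)
    have "p (S (k + Suc d) - S k) \<le> p (S (Suc (k + d)) - S (k + d)) + p (S (k + d) - S k)"
      using triangle_diff [of "S (k + Suc d)" "S k" "S (k + d)"] by simp
    also have "\<dots> \<le> r ^ (k + d) + r ^ k * (\<Sum>i<d. r ^ i)"
      using step [of "k + d"] Suc by simp
    also have "\<dots> = r ^ k * (\<Sum>i<Suc d. r ^ i)" by (simp add: algebra_simps power_add)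
    finally show ?case .
  qed simp
  have geo: "(\<Sum>i<d. r ^ i) \<le> 1 / (1 - r)" for d
    using assms(1,2) by (simp add: sum_gp_strict divide_right_mono)
  have bound: "p (S l - S k) \<le> r ^ k / (1 - r)" if "k \<le> l" for k l
    using dist [of k "l - k"] mult_left_mono [OF geo [of "l - k"], of "r ^ k"] assms(1) that
    by simp
  fix e :: real
  assume "e > 0"
  then have "e * (1 - r) / 2 > 0" using assms(2) by simp
  then obtain m where m: "r ^ m < e * (1 - r) / 2"
    using real_arch_pow_inv assms(2) by blast
  have "p (S k - S l) < e" if "k \<ge> m" "l \<ge> m" for k l
  proof -
    have "r ^ m / (1 - r) < e / 2" using m assms(2) by (simp add: field_simps)
    then show ?thesis
      using triangle_diff [of "S k" "S l" "S m"] bound [OF that(1)] bound [OF that(2)]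
        minus_commute [of "S m" "S l"] by linarith
  qed
  then show "\<exists>m. \<forall>k\<ge>m. \<forall>l\<ge>m. p (S k - S l) < e" by blast
qed

text \<open>The element \<open>1 - e\<close> of the unitization is \<open>(1 - b\<^sup>2)\<^sup>1\<^sup>/\<^sup>2\<close>.\<close>

lemma self_adjoint_cosine:
  assumes "star b = b" and "p b < 1"
  obtains e where "star e = e" and "b * e = e * b" and "e + e = b * b + e * e"
proof -
  \<comment> \<open>Fixed-point iteration from 0 for \<open>e + e = b * b + e * e\<close>. The limit
    is the power series of 1 - sqrt (1 - x) at x = b^2; it has no constant term, so it makes sense
    in an algebra without unit.\<close>
  define E where "E = rec_nat 0 (\<lambda>_ e. (1/2) *\<^sub>C (b * b + e * e))"
  have E_0 [simp]: "E 0 = 0" and E_Suc: "E (Suc k) = (1/2) *\<^sub>C (b * b + E k * E k)" for k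
    by (simp_all add: E_def)
  \<comment> \<open>The smaller fixed point of the scalar recursion for \<open>p b\<close>, hence a
    bound for all iterates. On the ball of radius r < 1 the iteration contracts with factor
    r.\<close>
  define r where "r = 1 - sqrt (1 - (p b)\<^sup>2)"
  have pb: "(p b)\<^sup>2 < 1" using assms(2) nonneg [of b] by (simp add: abs_square_less_1)
  have r: "0 \<le> r" "r < 1" using pb by (simp_all add: r_def)
  have r_eq: "((p b)\<^sup>2 + r * r) / 2 = r"
  proof -
    define q where "q = sqrt (1 - (p b)\<^sup>2)"
    have "q * q = 1 - (p b)\<^sup>2" using pb by (simp add: q_def)
    then show ?thesis unfolding r_def q_def [symmetric] by (simp add: field_simps)
  qed
  have E_le: "p (E k) \<le> r" for k
  proof (induction k)
    case (Suc k)
    have "p (E (Suc k)) \<le> (p (b * b) + p (E k * E k)) / 2"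
      using triangle [of "b * b" "E k * E k"] by (simp add: E_Suc homogeneous)
    also have "\<dots> \<le> ((p b)\<^sup>2 + r * r) / 2"
      using submult [of b b] submult [of "E k" "E k"] mult_mono [OF Suc Suc] r nonneg [of "E k"]
      by (simp add: power2_eq_square)
    finally show ?case by (simp add: r_eq)
  qed (simp add: r)
  have sq_diff: "p (x * x - y * y) \<le> 2 * r * p (x - y)" if "p x \<le> r" "p y \<le> r" for x y
  proof -
    have "p (x * x - y * y) = p (x * (x - y) + (x - y) * y)" by (simp add: algebra_simps)
    then have "p (x * x - y * y) \<le> p x * p (x - y) + p (x - y) * p y"
      using triangle [of "x * (x - y)" "(x - y) * y"] submult [of x "x - y"] submult [of "x - y" y]
      by linarith
    also have "\<dots> \<le> r * p (x - y) + p (x - y) * r"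
      using that nonneg [of "x - y"] by (intro add_mono mult_right_mono mult_left_mono)
    finally show ?thesis by simp
  qed
  have "p (E (Suc k) - E k) \<le> r ^ k" for k
  proof (induction k)
    case 0
    show ?case using E_le [of 1] r by simp
  next
    case (Suc k)
    have "E (Suc (Suc k)) - E (Suc k) = (1/2) *\<^sub>C (E (Suc k) * E (Suc k) - E k * E k)"
      by (subst (1 2) E_Suc) (simp add: scaleC_diff_right [symmetric])
    then have "p (E (Suc (Suc k)) - E (Suc k)) \<le> r * p (E (Suc k) - E k)"
      using sq_diff [OF E_le [of "Suc k"] E_le [of k]] by (simp add: homogeneous)
    also have "\<dots> \<le> r * r ^ k" using Suc r by (intro mult_left_mono)
    finally show ?case by simp
  qed
  then obtain L where L: "(\<lambda>k. p (E k - L)) \<longlonglongrightarrow> 0"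
    using geometric_convergence [OF r] by blast
  have E_star: "star (E k) = E k" for k
    by (induction k) (simp_all add: E_Suc star_scaleC star_add star_mult assms(1))
  have E_comm: "b * E k = E k * b" for k
  proof (induction k)
    case (Suc k)
    have "b * (E k * E k) = (E k * E k) * b"
      using Suc mult.assoc [of b "E k" "E k"] mult.assoc [of "E k" b "E k"] by (simp add: mult.assoc)
    then show ?case
      by (simp add: E_Suc mult_scaleC_left mult_scaleC_right algebra_simps)
  qed simp
  have "star L = L"
  proof (rule eqI_limit)
    show "p (star L - L) \<le> p (E k - L) + p (E k - L)" for k
      using triangle_diff [of "star L" L "E k"] star [of "L - E k"] minus_commute [of L "E k"]
      by (simp add: star_diff E_star)
    show "(\<lambda>k. p (E k - L) + p (E k - L)) \<longlonglongrightarrow> 0" using tendsto_add [OF L L] by simp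
  qed
  moreover have "b * L = L * b"
  proof (rule eqI_limit)
    show "p (b * L - L * b) \<le> p b * p (E k - L) + p (E k - L) * p b" for k
    proof -
      have "b * L - L * b = - (b * (E k - L)) + (E k - L) * b"
        using E_comm [of k] by (simp add: algebra_simps)
      then show ?thesis
        using triangle [of "- (b * (E k - L))" "(E k - L) * b"] submult [of b "E k - L"]
          submult [of "E k - L" b] by (simp add: minus mult.commute)
    qed
    show "(\<lambda>k. p b * p (E k - L) + p (E k - L) * p b) \<longlonglongrightarrow> 0"
      using tendsto_add [OF tendsto_mult_left [OF L, of "p b"] tendsto_mult_right [OF L, of "p b"]]
      by simp
  qed
  moreover have "L + L = b * b + L * L"
  proof (rule eqI_limit)
    show "p (L + L - (b * b + L * L)) \<le>
        2 * p (E (Suc k) - L) + (r * p (E k - L) + p (E k - L) * p L)" for k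
    proof -
      have "E (Suc k) + E (Suc k) = 2 *\<^sub>C E (Suc k)" by (rule scaleC_two [symmetric])
      also have "\<dots> = b * b + E k * E k" by (simp add: E_Suc scaleC_scaleC)
      finally have "L + L - (b * b + L * L) = - (2 *\<^sub>C (E (Suc k) - L)) +
          (E k * (E k - L) + (E k - L) * L)"
        by (simp add: scaleC_two algebra_simps)
      moreover have "p (E k * (E k - L)) \<le> r * p (E k - L)"
        using submult [of "E k" "E k - L"] mult_right_mono [OF E_le [of k] nonneg [of "E k - L"]]
        by linarith
      moreover have "p ((E k - L) * L) \<le> p (E k - L) * p L" by (rule submult)
      ultimately show ?thesis
        using triangle [of "- (2 *\<^sub>C (E (Suc k) - L))" "E k * (E k - L) + (E k - L) * L"]
          triangle [of "E k * (E k - L)" "(E k - L) * L"]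
        by (simp add: minus homogeneous)
    qed
    have "(\<lambda>k. p (E (Suc k) - L)) \<longlonglongrightarrow> 0" using L by (rule LIMSEQ_Suc)
    then have "(\<lambda>k. 2 * p (E (Suc k) - L) + (r * p (E k - L) + p (E k - L) * p L))
        \<longlonglongrightarrow> 2 * 0 + (r * 0 + 0 * p L)"
      by (intro tendsto_intros L)
    then show "(\<lambda>k. 2 * p (E (Suc k) - L) + (r * p (E k - L) + p (E k - L) * p L)) \<longlonglongrightarrow> 0"
      by simp
  qed
  ultimately show ?thesis by (rule that)
qed

lemma norm_le_one:
  assumes "star b = b" and "p b < 1"
  shows "norm b \<le> 1"
proof -
  obtain e where e: "star e = e" "b * e = e * b" "e + e = b * b + e * e"
    using self_adjoint_cosine [OF assms] .
  \<comment> \<open>\<open>b\<close> is the real part of the unitary \<open>b + i (1 - e)\<close> of the unitization.\<close>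
  define z w where "z = b * b" and "w = b - e * b"
  have eb: "e * b = b * e" "e * (b * x) = b * (e * x)" for x
    using e(2) mult.assoc [of e b x] mult.assoc [of b e x] by simp_all
  have "b * (b * (e + e)) = b * (b * (b * b + e * e))" by (simp only: e(3))
  then have "b * b * b * b + (b - e * b) * (b - b * e) = b * b"
    by (simp add: algebra_simps eb)
  moreover have w: "star w = b - e * b" "w = b - b * e"
    using assms(1) e(1,2) by (simp_all add: w_def star_diff star_mult)
  moreover have z: "star z = b * b" "z = b * b"
    using assms(1) by (simp_all add: z_def star_mult)
  ultimately have *: "star z * z + star w * w = b * b"
    unfolding w(1) z(1) unfolding w(2) z(2) by (simp only: mult.assoc)
  have zw: "star z * w = star w * z"
    unfolding w(1) z(1) unfolding w(2) z(2) by (simp add: algebra_simps eb)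
  \<comment> \<open>For c = \<i> and c = - \<i>, \<open>z + c *\<^sub>C w\<close> is the product of
    the formal unitary b + c (1 - e) with b. The product lies in the algebra, and by the C*-identity
    its norm is that of b.\<close>
  have unit: "norm (z + c *\<^sub>C w) = norm b" if "cnj c * c = 1" "cnj c = - c" for c
  proof -
    have "star (z + c *\<^sub>C w) * (z + c *\<^sub>C w) =
        star z * z + (cnj c * c) *\<^sub>C (star w * w) + c *\<^sub>C (star z * w) + cnj c *\<^sub>C (star w * z)"
      by (simp add: star_add star_scaleC mult_scaleC_left mult_scaleC_right scaleC_add_right
          scaleC_scaleC algebra_simps)
    also have "\<dots> = star b * b"
      using * zw that assms(1) by simp
    finally have "(norm (z + c *\<^sub>C w))\<^sup>2 = (norm b)\<^sup>2" by (metis cstar_identity)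
    then show ?thesis by simp
  qed
  \<comment> \<open>The mean of the two products is z = b^2, hence the norm of b dominates its own
    square.\<close>
  have "2 * norm z = norm ((z + \<i> *\<^sub>C w) + (z + (- \<i>) *\<^sub>C w))"
    using norm_scaleC [of 2 z] by (simp add: scaleC_two)
  also have "\<dots> \<le> 2 * norm b"
    using norm_triangle_ineq [of "z + \<i> *\<^sub>C w" "z + (- \<i>) *\<^sub>C w"] unit [of \<i>] unit [of "- \<i>"] by simp
  finally have "(norm b)\<^sup>2 \<le> norm b"
    using cstar_identity [of b] assms(1) by (simp add: z_def)
  then show ?thesis by (cases "b = 0") (simp_all add: power2_eq_square)
qed

text \<open>Scaling extends \<open>norm_le_one\<close> to all self-adjoint elements. Both norms
  satisfy the C*-identity, so the estimate for \<open>star a * a\<close> passes to a.\<close>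

lemma norm_le: "norm a \<le> p a"
proof -
  have sa: "norm b \<le> p b" if "star b = b" for b
  proof (rule dense_ge)
    fix r assume "p b < r"
    then have r: "0 < r" using nonneg [of b] by linarith
    have "norm (of_real (1/r) *\<^sub>C b) \<le> 1"
    proof (rule norm_le_one)
      show "star (of_real (1/r) *\<^sub>C b) = of_real (1/r) *\<^sub>C b"
        using that by (simp add: star_scaleC)
      show "p (of_real (1/r) *\<^sub>C b) < 1"
        using \<open>p b < r\<close> r by (simp only: homogeneous norm_of_real) simp
    qed
    then show "norm b \<le> r" using r by (simp only: norm_scaleC norm_of_real) (simp add: field_simps)
  qed
  have "(norm a)\<^sup>2 \<le> (p a)\<^sup>2"
    using sa [of "star a * a"] by (simp add: star_mult star_star cstar cstar_identity)
  then show ?thesis using nonneg [of a] by (rule power2_le_imp_le)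
qed

end

subsection \<open>Scalar matrices acting on matrices over a vector space\<close>

text \<open>\<open>matrix_mult\<close> multiplies entries of one ring, whereas scalar matrices must
  also act on matrices over a mere vector space, such as \<open>ell2\<close>.\<close>

definition lmul :: "nat \<Rightarrow> complex matrix \<Rightarrow> 'v::complex_vector matrix \<Rightarrow> 'v matrix" where
  "lmul n v X = (\<lambda>i j. \<Sum>k<n. v i k *\<^sub>C X k j)"

definition rmul :: "nat \<Rightarrow> 'v::complex_vector matrix \<Rightarrow> complex matrix \<Rightarrow> 'v matrix" where
  "rmul n X w = (\<lambda>i j. \<Sum>k<n. w k j *\<^sub>C X i k)"

definition diagonal :: "nat \<Rightarrow> (nat \<Rightarrow> complex) \<Rightarrow> complex matrix" where
  "diagonal n d = (\<lambda>i j. if i = j \<and> i < n then d i else 0)"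

definition unitary :: "nat \<Rightarrow> complex matrix \<Rightarrow> bool" where
  "unitary n v \<longleftrightarrow> v \<in> matrices n UNIV \<and>
     matrix_mult n (matrix_star v) v = diagonal n (\<lambda>_. 1) \<and>
     matrix_mult n v (matrix_star v) = diagonal n (\<lambda>_. 1)"

lemma matrices_iff:
  "X \<in> matrices n V \<longleftrightarrow> (\<forall>i<n. \<forall>j<n. X i j \<in> V) \<and> (\<forall>i j. n \<le> i \<or> n \<le> j \<longrightarrow> X i j = 0)"
  by (fastforce simp: matrices_def not_less)

lemma matrices_outside: "X \<in> matrices n V \<Longrightarrow> n \<le> i \<or> n \<le> j \<Longrightarrow> X i j = 0"
  unfolding matrices_iff by blast

lemma matrices_mono: "X \<in> matrices n V \<Longrightarrow> V \<subseteq> W \<Longrightarrow> X \<in> matrices n W"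
  by (auto simp: matrices_iff)

lemma matrix_eqI:
  "X \<in> matrices n V \<Longrightarrow> Y \<in> matrices n W \<Longrightarrow> (\<And>i j. i < n \<Longrightarrow> j < n \<Longrightarrow> X i j = Y i j) \<Longrightarrow> X = Y"
  unfolding fun_eq_iff by (metis matrices_outside not_less)

lemma csubspace_UNIV [simp]: "csubspace UNIV"
  by (simp add: csubspace_def)

lemma csubspace_sum:
  assumes "csubspace V" and "\<And>i. i \<in> I \<Longrightarrow> x i \<in> V"
  shows "(\<Sum>i\<in>I. x i) \<in> V"
  using assms(2) by (induction I rule: infinite_finite_induct)
    (use assms(1) in \<open>auto simp: csubspace_def\<close>)

lemma csubspace_diff:
  assumes "csubspace V" "x \<in> V" "y \<in> V"
  shows "x - y \<in> V"
proof -
  have "x + (- 1) *\<^sub>C y \<in> V" using assms unfolding csubspace_def by blast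
  then show ?thesis by simp
qed

lemma csubspace_matrices:
  assumes "csubspace V"
  shows "csubspace (matrices n V)"
  using assms by (auto simp: csubspace_def matrices_iff scaleC_fun_def zero_fun_def plus_fun_def)

lemma matrices_lmul:
  assumes "csubspace V" "v \<in> matrices n UNIV" "X \<in> matrices n V"
  shows "lmul n v X \<in> matrices n V"
  unfolding matrices_iff lmul_def
proof safe
  fix i j assume "i < n" "j < n"
  then show "(\<Sum>k<n. v i k *\<^sub>C X k j) \<in> V"
    using assms by (intro csubspace_sum) (auto simp: csubspace_def matrices_iff)
qed (auto simp: matrices_outside [OF assms(2)] matrices_outside [OF assms(3)])

lemma matrices_rmul:
  assumes "csubspace V" "w \<in> matrices n UNIV" "X \<in> matrices n V"
  shows "rmul n X w \<in> matrices n V"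
  unfolding matrices_iff rmul_def
proof safe
  fix i j assume "i < n" "j < n"
  then show "(\<Sum>k<n. w k j *\<^sub>C X i k) \<in> V"
    using assms by (intro csubspace_sum) (auto simp: csubspace_def matrices_iff)
qed (auto simp: matrices_outside [OF assms(2)] matrices_outside [OF assms(3)])

lemma matrices_matrix_mult:
  "X \<in> matrices n UNIV \<Longrightarrow> Y \<in> matrices n UNIV \<Longrightarrow> matrix_mult n X Y \<in> matrices n UNIV"
  by (auto simp: matrices_iff matrix_mult_def)

lemma matrices_matrix_star: "X \<in> matrices n UNIV \<Longrightarrow> matrix_star X \<in> matrices n UNIV"
  by (auto simp: matrices_iff matrix_star_def)

lemma matrices_diagonal [simp]: "diagonal n d \<in> matrices n UNIV"
  by (auto simp: matrices_iff diagonal_def)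

lemma matrix_star_star [simp]: "matrix_star (matrix_star X) = X"
  by (simp add: matrix_star_def star_star)

lemma lmul_lmul: "lmul n v (lmul n w X) = lmul n (matrix_mult n v w) X"
proof (intro ext)
  fix i j
  have "lmul n v (lmul n w X) i j = (\<Sum>k<n. \<Sum>l<n. (v i k * w k l) *\<^sub>C X l j)"
    by (simp add: lmul_def scaleC_sum_right scaleC_scaleC)
  also have "\<dots> = (\<Sum>l<n. \<Sum>k<n. (v i k * w k l) *\<^sub>C X l j)" by (rule sum.swap)
  finally show "lmul n v (lmul n w X) i j = lmul n (matrix_mult n v w) X i j"
    by (simp add: lmul_def matrix_mult_def scaleC_sum_left)
qed

lemma rmul_rmul: "rmul n (rmul n X v) w = rmul n X (matrix_mult n v w)"
proof (intro ext)
  fix i j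
  have "rmul n (rmul n X v) w i j = (\<Sum>k<n. \<Sum>l<n. (v l k * w k j) *\<^sub>C X i l)"
    by (simp add: rmul_def scaleC_sum_right scaleC_scaleC mult.commute)
  also have "\<dots> = (\<Sum>l<n. \<Sum>k<n. (v l k * w k j) *\<^sub>C X i l)" by (rule sum.swap)
  finally show "rmul n (rmul n X v) w i j = rmul n X (matrix_mult n v w) i j"
    by (simp add: rmul_def matrix_mult_def scaleC_sum_left)
qed

lemma lmul_rmul: "lmul n v (rmul n X w) = rmul n (lmul n v X) w"
proof (intro ext)
  fix i j
  have "lmul n v (rmul n X w) i j = (\<Sum>k<n. \<Sum>l<n. (v i k * w l j) *\<^sub>C X k l)"
    by (simp add: lmul_def rmul_def scaleC_sum_right scaleC_scaleC)
  also have "\<dots> = (\<Sum>l<n. \<Sum>k<n. (v i k * w l j) *\<^sub>C X k l)" by (rule sum.swap)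
  finally show "lmul n v (rmul n X w) i j = rmul n (lmul n v X) w i j"
    by (simp add: lmul_def rmul_def scaleC_sum_right scaleC_scaleC mult.commute)
qed

lemma sum_diagonal_scaleC:
  "(\<Sum>k<n. diagonal n d i k *\<^sub>C x k) = (if i < n then d i *\<^sub>C (x i::'v::complex_vector) else 0)"
  "(\<Sum>k<n. diagonal n d k i *\<^sub>C x k) = (if i < n then d i *\<^sub>C (x i::'v::complex_vector) else 0)"
proof -
  have "diagonal n d i k *\<^sub>C x k = (if k = i then if i < n then d i *\<^sub>C x i else 0 else 0)"
    and "diagonal n d k i *\<^sub>C x k = (if k = i then if i < n then d i *\<^sub>C x i else 0 else 0)" for k
    by (auto simp: diagonal_def)
  then show "(\<Sum>k<n. diagonal n d i k *\<^sub>C x k) = (if i < n then d i *\<^sub>C x i else 0)"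
    and "(\<Sum>k<n. diagonal n d k i *\<^sub>C x k) = (if i < n then d i *\<^sub>C x i else 0)"
    by simp_all
qed

lemma lmul_diagonal: "lmul n (diagonal n d) X i j = (if i < n then d i *\<^sub>C X i j else 0)"
  by (simp add: lmul_def sum_diagonal_scaleC)

lemma rmul_diagonal: "rmul n X (diagonal n d) i j = (if j < n then d j *\<^sub>C X i j else 0)"
  by (simp add: rmul_def sum_diagonal_scaleC)

lemma lmul_one:
  assumes "X \<in> matrices n V"
  shows "lmul n (diagonal n (\<lambda>_. 1)) X = X"
  using matrices_outside [OF assms] by (auto simp: fun_eq_iff lmul_diagonal not_less)

lemma rmul_one:
  assumes "X \<in> matrices n V"
  shows "rmul n X (diagonal n (\<lambda>_. 1)) = X"
  using matrices_outside [OF assms] by (auto simp: fun_eq_iff rmul_diagonal not_less)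

lemma matrix_mult_complex: "matrix_mult n v (w::complex matrix) = lmul n v w"
  by (simp add: matrix_mult_def lmul_def scaleC_complex_def)

lemma matrix_star_lmul:
  "matrix_star (lmul n v (X::'a::cstar_algebra matrix)) = rmul n (matrix_star X) (matrix_star v)"
  by (simp add: matrix_star_def lmul_def rmul_def star_sum star_scaleC star_complex_def)

lemma matrix_star_rmul:
  "matrix_star (rmul n (X::'a::cstar_algebra matrix) v) = lmul n (matrix_star v) (matrix_star X)"
  by (simp add: matrix_star_def lmul_def rmul_def star_sum star_scaleC star_complex_def)

lemma matrix_mult_rmul_left:
  "matrix_mult n (rmul n X v) Y = matrix_mult n X (lmul n v (Y::'a::cstar_algebra matrix))"
proof (intro ext)
  fix i j
  have "matrix_mult n (rmul n X v) Y i j = (\<Sum>k<n. \<Sum>l<n. v l k *\<^sub>C (X i l * Y k j))"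
    by (simp add: matrix_mult_def rmul_def sum_distrib_right mult_scaleC_left)
  also have "\<dots> = (\<Sum>l<n. \<Sum>k<n. v l k *\<^sub>C (X i l * Y k j))" by (rule sum.swap)
  finally show "matrix_mult n (rmul n X v) Y i j = matrix_mult n X (lmul n v Y) i j"
    by (simp add: matrix_mult_def lmul_def sum_distrib_left mult_scaleC_right)
qed

lemma matrix_star_diagonal: "matrix_star (diagonal n d) = diagonal n (\<lambda>i. cnj (d i))"
  by (auto simp: matrix_star_def diagonal_def star_complex_def fun_eq_iff)

lemma matrix_mult_diagonal:
  "matrix_mult n (diagonal n c) (diagonal n d) = diagonal n (\<lambda>i. c i * d i)"
  unfolding matrix_mult_complex
  by (auto simp: fun_eq_iff lmul_diagonal) (auto simp: diagonal_def scaleC_complex_def)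

lemma unitary_diagonal: "(\<And>i. i < n \<Longrightarrow> cnj (d i) * d i = 1) \<Longrightarrow> unitary n (diagonal n d)"
  unfolding unitary_def matrix_star_diagonal matrix_mult_diagonal
  by (auto simp: fun_eq_iff mult.commute) (auto simp: diagonal_def mult.commute)

lemma unitary_star: "unitary n v \<Longrightarrow> unitary n (matrix_star v)"
  by (simp add: unitary_def matrices_matrix_star)

lemma unitary_matrices: "unitary n v \<Longrightarrow> v \<in> matrices n UNIV"
  by (simp add: unitary_def)

lemma unitary_mult:
  assumes v: "unitary n v" and w: "unitary n w"
  shows "unitary n (matrix_mult n v w)"
proof -
  have star: "matrix_star (matrix_mult n v w) = rmul n (matrix_star w) (matrix_star v)"
    by (simp add: matrix_mult_complex matrix_star_lmul)
  have "matrix_mult n (matrix_star w) (lmul n (matrix_mult n (matrix_star v) v) w) =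
      diagonal n (\<lambda>_. 1)"
    using v w by (simp add: unitary_def lmul_one [OF unitary_matrices [OF w]])
  then have 1: "matrix_mult n (rmul n (matrix_star w) (matrix_star v)) (matrix_mult n v w) =
      diagonal n (\<lambda>_. 1)"
    by (simp add: matrix_mult_rmul_left) (simp add: matrix_mult_complex lmul_lmul)
  have "lmul n v (lmul n (matrix_mult n w (matrix_star w)) (matrix_star v)) = diagonal n (\<lambda>_. 1)"
    using v w by (simp add: unitary_def lmul_one [OF matrices_matrix_star [OF unitary_matrices [OF v]]])
      (simp add: matrix_mult_complex)
  moreover have "rmul n (matrix_star w) (matrix_star v) = lmul n (matrix_star w) (matrix_star v)"
    by (simp add: rmul_def lmul_def scaleC_complex_def mult.commute)
  ultimately have "matrix_mult n (matrix_mult n v w) (rmul n (matrix_star w) (matrix_star v)) =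
      diagonal n (\<lambda>_. 1)"
    by (simp add: matrix_mult_complex lmul_lmul)
  with 1 star show ?thesis
    using v w by (simp add: unitary_def matrices_matrix_mult)
qed

lemma lmul_unitary_cancel:
  assumes "unitary n v" "X \<in> matrices n V"
  shows "lmul n v (lmul n (matrix_star v) X) = X" "lmul n (matrix_star v) (lmul n v X) = X"
  using assms by (simp_all add: lmul_lmul unitary_def lmul_one [OF assms(2)])

lemma rmul_unitary_cancel:
  assumes "unitary n v" "X \<in> matrices n V"
  shows "rmul n (rmul n X v) (matrix_star v) = X" "rmul n (rmul n X (matrix_star v)) v = X"
  using assms by (simp_all add: rmul_rmul unitary_def rmul_one [OF assms(2)])


subsection \<open>Columns of a matrix over a C*-algebra\<close>

definition corner :: "nat \<Rightarrow> 'a::zero \<Rightarrow> 'a matrix" where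
  "corner j a = (\<lambda>i k. if i = j \<and> k = j then a else 0)"

locale cstar_matrices =
  fixes n :: nat and N :: "'a::cstar_algebra matrix \<Rightarrow> real"
  assumes cstar_matrix_norm: "cstar_matrix_norm n N"
begin

abbreviation M :: "'a matrix set" where "M \<equiv> matrices n UNIV"

lemma M_add: "X \<in> M \<Longrightarrow> Y \<in> M \<Longrightarrow> X + Y \<in> M"
  and M_scaleC: "X \<in> M \<Longrightarrow> c *\<^sub>C X \<in> M"
  and M_diff: "X \<in> M \<Longrightarrow> Y \<in> M \<Longrightarrow> X - Y \<in> M"
  and M_zero: "0 \<in> M"
  using csubspace_matrices [of UNIV n] csubspace_diff [of M]
  unfolding csubspace_def by blast+

lemma N_eq_0D: "X \<in> M \<Longrightarrow> N X = 0 \<Longrightarrow> X = 0"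
  and N_triangle: "X \<in> M \<Longrightarrow> Y \<in> M \<Longrightarrow> N (X + Y) \<le> N X + N Y"
  and N_homogeneous: "X \<in> M \<Longrightarrow> N (c *\<^sub>C X) = cmod c * N X"
  and N_submult: "X \<in> M \<Longrightarrow> Y \<in> M \<Longrightarrow> N (matrix_mult n X Y) \<le> N X * N Y"
  and N_cstar: "X \<in> M \<Longrightarrow> N (matrix_mult n (matrix_star X) X) = (N X)\<^sup>2"
  and N_complete: "(\<And>k. S k \<in> M) \<Longrightarrow> (\<And>e. e > 0 \<Longrightarrow> \<exists>m. \<forall>k\<ge>m. \<forall>l\<ge>m. N (S k - S l) < e) \<Longrightarrow>
      \<exists>L\<in>M. (\<lambda>k. N (S k - L)) \<longlonglongrightarrow> 0"
  using cstar_matrix_norm unfolding cstar_matrix_norm_def by blast+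

lemma N_minus: "X \<in> M \<Longrightarrow> N (- X) = N X"
  using N_homogeneous [of X "- 1"] by simp

lemma N_zero [simp]: "N 0 = 0"
  using N_homogeneous [OF M_zero, of 0] by simp

lemma N_nonneg:
  assumes "X \<in> M" shows "0 \<le> N X"
proof -
  have "N (X + - X) \<le> N X + N (- X)"
    using assms M_scaleC [OF assms, of "- 1"] by (intro N_triangle) simp_all
  then show ?thesis using N_minus [OF assms] by simp
qed

lemma N_star:
  assumes "X \<in> M" shows "N (matrix_star X) = N X"
proof -
  have le: "N Y \<le> N (matrix_star Y)" if "Y \<in> M" for Y
  proof (cases "N Y = 0")
    case True then show ?thesis using N_nonneg [OF matrices_matrix_star [OF that]] by simp
  next
    case False
    have "N Y * N Y \<le> N (matrix_star Y) * N Y"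
      using N_submult [OF matrices_matrix_star [OF that] that] N_cstar [OF that]
      by (simp add: power2_eq_square)
    with False show ?thesis using N_nonneg [OF that] by simp
  qed
  from le [OF assms] le [OF matrices_matrix_star [OF assms]] show ?thesis by simp
qed

text \<open>The C*-identity only sees \<open>X^* X\<close>, from which the unitary cancels.\<close>

lemma N_lmul_unitary:
  assumes v: "unitary n v" and X: "X \<in> M"
  shows "N (lmul n v X) = N X"
proof -
  have "matrix_mult n (matrix_star (lmul n v X)) (lmul n v X) = matrix_mult n (matrix_star X) X"
    using v by (simp add: matrix_star_lmul matrix_mult_rmul_left lmul_lmul unitary_def lmul_one [OF X])
  then have "(N (lmul n v X))\<^sup>2 = (N X)\<^sup>2"
    using N_cstar X matrices_lmul [OF _ unitary_matrices [OF v] X] by (metis csubspace_UNIV)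
  then show ?thesis
    using N_nonneg [OF X] N_nonneg [OF matrices_lmul [OF _ unitary_matrices [OF v] X]] by simp
qed

lemma N_rmul_unitary:
  assumes v: "unitary n v" and X: "X \<in> M"
  shows "N (rmul n X v) = N X"
proof -
  have XvM: "rmul n X v \<in> M" using matrices_rmul [OF _ unitary_matrices [OF v] X] by simp
  have "N (rmul n X v) = N (lmul n (matrix_star v) (matrix_star X))"
    by (simp add: N_star [OF XvM, symmetric] matrix_star_rmul)
  then show ?thesis
    using N_lmul_unitary [OF unitary_star [OF v] matrices_matrix_star [OF X]] N_star [OF X] by simp
qed

text \<open>Scalar unitaries act isometrically for N. The mean of a matrix and its product with this
  unitary is a single row or column, so cutting out a column becomes an average of
  isometries.\<close>

definition reflection :: "nat \<Rightarrow> complex matrix" where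
  "reflection j = diagonal n (\<lambda>i. if i = j then 1 else - 1)"

lemma unitary_reflection: "unitary n (reflection j)"
  unfolding reflection_def by (rule unitary_diagonal) simp

lemma corner_M: "j < n \<Longrightarrow> corner j a \<in> M"
  by (auto simp: corner_def matrices_iff)

text \<open>Products and adjoints in the corner are those of A, so the algebraic axioms are
  inherited. The real issue is completeness: the corner has to be closed in
  \<open>M_n(A)\<close>.\<close>

lemma corner_norm:
  assumes j: "j < n"
  shows "complete_cstar_norm (\<lambda>a. N (corner j a))"
proof
  note cM = corner_M [OF j]
  have diff: "corner j x - corner j y = corner j (x - y)" for x y :: 'a
    by (auto simp: corner_def fun_eq_iff)
  have add: "corner j (x + y) = corner j x + corner j y" for x y :: 'a
    by (auto simp: corner_def fun_eq_iff)
  have scale: "corner j (c *\<^sub>C x) = c *\<^sub>C corner j x" for c and x :: 'a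
    by (auto simp: corner_def fun_eq_iff scaleC_fun_def)
  have mult: "corner j (x * y) = matrix_mult n (corner j x) (corner j y)" for x y :: 'a
  proof (intro ext)
    fix i l
    have "corner j x i k * corner j y k l = (if k = j then corner j (x * y) i l else 0)" for k
      by (auto simp: corner_def)
    then show "corner j (x * y) i l = matrix_mult n (corner j x) (corner j y) i l"
      using j by (simp add: matrix_mult_def)
  qed
  have star: "corner j (star x) = matrix_star (corner j x)" for x :: 'a
    by (auto simp: corner_def matrix_star_def fun_eq_iff)
  fix x y :: 'a and c
  show "x = 0" if "N (corner j x) = 0"
    using N_eq_0D [OF cM that] by (simp add: corner_def fun_eq_iff) metis
  show "N (corner j (x + y)) \<le> N (corner j x) + N (corner j y)"
    by (simp add: add N_triangle cM)
  show "N (corner j (c *\<^sub>C x)) = cmod c * N (corner j x)"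
    by (simp add: scale N_homogeneous cM)
  show "N (corner j (x * y)) \<le> N (corner j x) * N (corner j y)"
    by (simp add: mult N_submult cM)
  show "N (corner j (star x * x)) = (N (corner j x))\<^sup>2"
    by (simp add: mult star N_cstar cM)
  fix S :: "nat \<Rightarrow> 'a"
  assume "\<And>e. e > 0 \<Longrightarrow> \<exists>m. \<forall>k\<ge>m. \<forall>l\<ge>m. N (corner j (S k - S l)) < e"
  then obtain L where L: "L \<in> M" "(\<lambda>k. N (corner j (S k) - L)) \<longlonglongrightarrow> 0"
    using N_complete [of "\<lambda>k. corner j (S k)"] cM diff by auto
  \<comment> \<open>A matrix that is as far from each \<open>corner j (S k)\<close> as L is another
    limit of this sequence, so it coincides with L.\<close>
  have unique: "L = L'" if "L' \<in> M" "\<And>k. N (corner j (S k) - L') = N (corner j (S k) - L)" for L'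
  proof -
    have "N (L - L') \<le> N (corner j (S k) - L) + N (corner j (S k) - L)" for k
    proof -
      have "N ((corner j (S k) - L') + - (corner j (S k) - L))
          \<le> N (corner j (S k) - L') + N (- (corner j (S k) - L))"
        using L that cM M_diff M_scaleC [of _ "- 1"] by (intro N_triangle) (auto simp del: minus_diff_eq)
      then show ?thesis using that N_minus [OF M_diff [OF cM L(1)]] by simp
    qed
    then have "N (L - L') \<le> 0"
      using LIMSEQ_le_const [OF tendsto_add [OF L(2) L(2)]] by force
    then have "L - L' = 0"
      using L that by (intro N_eq_0D antisym N_nonneg M_diff)
    then show ?thesis by simp
  qed
  \<comment> \<open>The limit commutes with the reflections that fix the corner, so it lies in the corner.\<close>
  have L_row: "L = lmul n (reflection j) L"
  proof (rule unique)
    show "lmul n (reflection j) L \<in> M"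
      using matrices_lmul [OF _ unitary_matrices [OF unitary_reflection] L(1)] by simp
    fix k
    have "corner j (S k) - lmul n (reflection j) L = lmul n (reflection j) (corner j (S k) - L)"
      using matrices_outside [OF L(1)]
      by (auto simp: fun_eq_iff reflection_def lmul_diagonal corner_def j)
    then show "N (corner j (S k) - lmul n (reflection j) L) = N (corner j (S k) - L)"
      using N_lmul_unitary [OF unitary_reflection M_diff [OF cM L(1)]] by simp
  qed
  have row: "L i l = - L i l" if "i < n" "i \<noteq> j" for i l
    using fun_cong [OF fun_cong [OF L_row, of i], of l] that
    by (simp add: reflection_def lmul_diagonal)
  have L_col: "L = rmul n L (reflection j)"
  proof (rule unique)
    show "rmul n L (reflection j) \<in> M"
      using matrices_rmul [OF _ unitary_matrices [OF unitary_reflection] L(1)] by simp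
    fix k
    have "corner j (S k) - rmul n L (reflection j) = rmul n (corner j (S k) - L) (reflection j)"
      using matrices_outside [OF L(1)]
      by (auto simp: fun_eq_iff reflection_def rmul_diagonal corner_def j)
    then show "N (corner j (S k) - rmul n L (reflection j)) = N (corner j (S k) - L)"
      using N_rmul_unitary [OF unitary_reflection M_diff [OF cM L(1)]] by simp
  qed
  have col: "L i l = - L i l" if "l < n" "l \<noteq> j" for i l
    using fun_cong [OF fun_cong [OF L_col, of i], of l] that
    by (simp add: reflection_def rmul_diagonal)
  have neg: "z = 0" if "z = - z" for z :: 'a
  proof -
    have "z + z = 0" using that by (metis add.right_inverse)
    then have "2 *\<^sub>C z = 0" by (simp only: scaleC_two)
    then have "norm z = 0" using norm_scaleC [of 2 z] by simp
    then show ?thesis by simp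
  qed
  define l where "l = L j j"
  have "L = corner j l"
  proof (rule matrix_eqI [OF L(1) cM])
    show "L i k = corner j l i k" if "i < n" "k < n" for i k
      using neg [OF row [OF that(1), of k]] neg [OF col [OF that(2), of i]]
      by (auto simp: corner_def l_def)
  qed
  then show "\<exists>L. (\<lambda>k. N (corner j (S k - L))) \<longlonglongrightarrow> 0"
    using L(2) by (auto simp: diff)
qed

text \<open>Deleting all columns but the j-th averages Y with its reflected copy and so does not
  increase N. For the remaining matrix Z the product \<open>Z^* Z\<close> is supported at the place
  (j,j), where the complete C*-norm of the corner dominates the norm of A.\<close>

lemma norm_column_le:
  assumes Y: "Y \<in> M" and j: "j < n"
  shows "norm (\<Sum>i<n. star (Y i j) * Y i j) \<le> (N Y)\<^sup>2"
proof -
  interpret corner: complete_cstar_norm "\<lambda>a. N (corner j a)" by (rule corner_norm [OF j])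
  define Z where "Z = (\<lambda>i l. if l = j then Y i l else 0)"
  have Z: "Z \<in> M" using Y by (auto simp: Z_def matrices_iff)
  have YrM: "rmul n Y (reflection j) \<in> M"
    using matrices_rmul [OF _ unitary_matrices [OF unitary_reflection] Y] by simp
  have "Z = (1/2) *\<^sub>C (Y + rmul n Y (reflection j))"
    using matrices_outside [OF Y] j
    by (auto simp: scaleC_half Z_def fun_eq_iff scaleC_fun_def reflection_def rmul_diagonal)
  then have "N Z \<le> N Y"
    using N_triangle [OF Y YrM] N_rmul_unitary [OF unitary_reflection Y]
    by (simp add: N_homogeneous M_add Y YrM)
  have "corner j (\<Sum>i<n. star (Y i j) * Y i j) = matrix_mult n (matrix_star Z) Z"
    using j by (auto simp: corner_def matrix_mult_def matrix_star_def Z_def fun_eq_iff)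
  then have "norm (\<Sum>i<n. star (Y i j) * Y i j) \<le> (N Z)\<^sup>2"
    using corner.norm_le [of "\<Sum>i<n. star (Y i j) * Y i j"] N_cstar [OF Z] by simp
  also have "\<dots> \<le> (N Y)\<^sup>2" using \<open>N Z \<le> N Y\<close> N_nonneg [OF Z] by (rule power_mono)
  finally show ?thesis .
qed

lemma norm_row_le:
  assumes Y: "Y \<in> M" and i: "i < n"
  shows "norm (\<Sum>j<n. Y i j * star (Y i j)) \<le> (N Y)\<^sup>2"
  using norm_column_le [OF matrices_matrix_star [OF Y] i]
  by (simp add: N_star [OF Y]) (simp add: matrix_star_def star_star)

end

section \<open>Contractivity, additivity and positivity of states\<close>

lemma state_le_norm:
  assumes "state f"
  shows "cmod (f a) \<le> norm a"
  using assms onorm [of f a] by (simp add: state_def)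

lemma state_sum:
  assumes "state f"
  shows "f (\<Sum>i\<in>I. x i) = (\<Sum>i\<in>I. f (x i))"
  using assms linear_sum [of f x I] by (simp add: state_def bounded_linear.linear)

lemma state_nonneg:
  assumes "state f"
  shows "0 \<le> Re (f (star a * a))"
  using assms by (simp add: state_def complex_nonneg_Reals_iff)

subsection \<open>Compactness and the spectral theorem\<close>

text \<open>The matrix \<open>v^* X w\<close> describes X in the bases given by the columns of v and
  w. It turns densities with these eigenbases into diagonal ones, so that powers are taken of
  eigenvalues only.\<close>

definition compress ::
  "nat \<Rightarrow> complex matrix \<Rightarrow> 'v::complex_vector matrix \<Rightarrow> complex matrix \<Rightarrow> 'v matrix" where
  "compress n v X w = rmul n (lmul n (matrix_star v) X) w"

lemma compress_eq: "compress n v X w i j = (\<Sum>l<n. \<Sum>k<n. (cnj (v k i) * w l j) *\<^sub>C X k l)"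
  by (simp add: compress_def rmul_def lmul_def matrix_star_def star_complex_def scaleC_sum_right
      scaleC_scaleC mult.commute)

lemma matrix_star_mult:
  "matrix_star (matrix_mult n X (Y::'a::cstar_algebra matrix)) =
    matrix_mult n (matrix_star Y) (matrix_star X)"
  by (simp add: matrix_star_def matrix_mult_def star_sum star_mult)

lemma compress_compress:
  "compress n r (compress n v X w) s = compress n (matrix_mult n v r) X (matrix_mult n w s)"
  by (simp add: compress_def matrix_star_mult lmul_rmul rmul_rmul lmul_lmul)

lemma compress_matrices:
  assumes "csubspace V" "v \<in> matrices n UNIV" "w \<in> matrices n UNIV" "X \<in> matrices n V"
  shows "compress n v X w \<in> matrices n V"
  unfolding compress_def using assms by (intro matrices_rmul matrices_lmul matrices_matrix_star)

lemma unitary_one: "unitary n (diagonal n (\<lambda>_. 1))"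
  by (rule unitary_diagonal) simp

lemma unitary_columns:
  assumes "unitary n v" "i < n" "j < n"
  shows "(\<Sum>k<n. cnj (v k i) * v k j) = (if i = j then 1 else 0)"
    and "(\<Sum>k<n. v i k * cnj (v j k)) = (if i = j then 1 else 0)"
proof -
  from assms(1) have "matrix_mult n (matrix_star v) v i j = diagonal n (\<lambda>_. 1) i j"
    and "matrix_mult n v (matrix_star v) i j = diagonal n (\<lambda>_. 1) i j"
    by (simp_all add: unitary_def)
  then show "(\<Sum>k<n. cnj (v k i) * v k j) = (if i = j then 1 else 0)"
    and "(\<Sum>k<n. v i k * cnj (v j k)) = (if i = j then 1 else 0)"
    using assms(2) by (simp_all add: matrix_mult_def matrix_star_def star_complex_def diagonal_def)
qed

lemma unitaryI:
  assumes "v \<in> matrices n UNIV"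
    and "\<And>i j. i < n \<Longrightarrow> j < n \<Longrightarrow> (\<Sum>k<n. cnj (v k i) * v k j) = (if i = j then 1 else 0)"
    and "\<And>i j. i < n \<Longrightarrow> j < n \<Longrightarrow> (\<Sum>k<n. v i k * cnj (v j k)) = (if i = j then 1 else 0)"
  shows "unitary n v"
  unfolding unitary_def
proof (intro conjI)
  note star = matrices_matrix_star [OF assms(1)]
  show "matrix_mult n (matrix_star v) v = diagonal n (\<lambda>_. 1)"
    by (rule matrix_eqI [OF matrices_matrix_mult [OF star assms(1)] matrices_diagonal])
      (use assms(2) in \<open>auto simp: matrix_mult_def matrix_star_def star_complex_def diagonal_def\<close>)
  show "matrix_mult n v (matrix_star v) = diagonal n (\<lambda>_. 1)"
    by (rule matrix_eqI [OF matrices_matrix_mult [OF assms(1) star] matrices_diagonal])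
      (use assms(3) in \<open>auto simp: matrix_mult_def matrix_star_def star_complex_def diagonal_def\<close>)
qed (rule assms(1))

lemma compact_Pi:
  fixes A :: "'i \<Rightarrow> 'b::topological_space set"
  assumes "\<And>i. compact (A i)"
  shows "compact {x. \<forall>i. x i \<in> A i}"
proof -
  have "compactin (product_topology (\<lambda>i. euclidean) UNIV) (PiE UNIV A)"
    using assms by (simp add: compactin_PiE)
  moreover have "PiE UNIV A = {x. \<forall>i. x i \<in> A i}" by (auto simp: PiE_iff)
  ultimately show ?thesis by (simp add: euclidean_product_topology)
qed

lemma continuous_on_entry: "continuous_on S (\<lambda>v::'i \<Rightarrow> 'j \<Rightarrow> 'b::topological_space. v i j)"
  by (rule continuous_on_product_then_coordinatewise
      [OF continuous_on_product_then_coordinatewise [OF continuous_on_id]])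

lemma norm_unitary_entry_le:
  assumes "unitary n v"
  shows "cmod (v i j) \<le> 1"
proof (cases "i < n \<and> j < n")
  case True
  have "complex_of_real (\<Sum>k<n. (cmod (v k j))\<^sup>2) = (\<Sum>k<n. cnj (v k j) * v k j)"
    by (simp add: of_real_sum complex_norm_square mult.commute del: of_real_power)
  then have "complex_of_real (\<Sum>k<n. (cmod (v k j))\<^sup>2) = complex_of_real 1"
    using unitary_columns(1) [OF assms, of j j] True by simp
  then have "(\<Sum>k<n. (cmod (v k j))\<^sup>2) = 1" by (simp only: of_real_eq_iff)
  moreover have "(cmod (v i j))\<^sup>2 \<le> (\<Sum>k<n. (cmod (v k j))\<^sup>2)"
    using True by (intro member_le_sum) auto
  ultimately show ?thesis by (simp add: power_le_one_iff abs_square_le_1)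
next
  case False
  then show ?thesis using matrices_outside [OF unitary_matrices [OF assms]] by (simp add: not_less)
qed

text \<open>Entries of a unitary lie in the unit disc and vanish outside the n by n block, so the
  set lies in a product of compact sets. The unitarity equations are closed conditions in the
  product topology.\<close>

lemma compact_unitary: "compact {v. unitary n v}"
proof -
  let ?B = "{v. \<forall>i. v i \<in> {x. \<forall>j. x j \<in> (if i < n \<and> j < n then cball 0 1 else {0::complex})}}"
  let ?C = "{v::complex matrix.
    (\<forall>i j. matrix_mult n (matrix_star v) v i j = diagonal n (\<lambda>_. 1) i j) \<and>
    (\<forall>i j. matrix_mult n v (matrix_star v) i j = diagonal n (\<lambda>_. 1) i j)}"
  have "compact ?B" by (intro compact_Pi) auto
  moreover have "closed ?C"
    unfolding matrix_mult_def matrix_star_def star_complex_def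
    by (intro closed_Collect_conj closed_Collect_all closed_Collect_eq continuous_intros
        continuous_on_entry)
  moreover have "{v. unitary n v} = ?B \<inter> ?C"
    using norm_unitary_entry_le by (auto simp: unitary_def fun_eq_iff matrices_iff not_less split: if_splits)
  ultimately show ?thesis by (simp add: compact_Int_closed)
qed

section \<open>Plane rotations and diagonalization of Hermitian matrices\<close>

lemma sum_two:
  assumes "i < n" "j < n" "i \<noteq> j" "\<And>k. k < n \<Longrightarrow> k \<noteq> i \<Longrightarrow> k \<noteq> j \<Longrightarrow> x k = 0"
  shows "(\<Sum>k<n::nat. x k) = x i + (x j::'b::comm_monoid_add)"
proof -
  have "(\<Sum>k<n. x k) = (\<Sum>k\<in>{i, j}. x k)"
    using assms by (intro sum.mono_neutral_right) auto
  then show ?thesis using assms(3) by simp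
qed

text \<open>On the coordinates i, j this is the matrix with rows (a, - cnj b) and (b, a), an element
  of SU(2) when a is real and a^2 + |b|^2 = 1.\<close>

definition rotation :: "nat \<Rightarrow> nat \<Rightarrow> nat \<Rightarrow> complex \<Rightarrow> complex \<Rightarrow> complex matrix" where
  "rotation n i j a b = (\<lambda>k l.
     if k = i \<and> l = i \<or> k = j \<and> l = j then a
     else if k = j \<and> l = i then b else if k = i \<and> l = j then - cnj b
     else if k = l \<and> k < n then 1 else 0)"

lemma sum_rotation:
  assumes "i < n" "j < n" "i \<noteq> j"
  shows "l < n \<Longrightarrow> (\<Sum>k<n. rotation n i j a b k l * x k) =
      (if l = i then a * x i + b * x j else if l = j then - cnj b * x i + a * x j else x l)"
    and "k < n \<Longrightarrow> (\<Sum>l<n. rotation n i j a b k l * x l) =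
      (if k = i then a * x i - cnj b * x j else if k = j then b * x i + a * x j else x k)"
proof -
  have single: "(\<Sum>k<n. y k) = y l" if "l < n" "\<And>k. k < n \<Longrightarrow> k \<noteq> l \<Longrightarrow> y k = 0"
    for y :: "nat \<Rightarrow> complex" and l
    using that by (subst sum.remove [of _ l]) (auto intro: sum.neutral)
  show "(\<Sum>k<n. rotation n i j a b k l * x k) =
      (if l = i then a * x i + b * x j else if l = j then - cnj b * x i + a * x j else x l)"
    if "l < n"
  proof (cases "l = i \<or> l = j")
    case True
    then show ?thesis using assms
      by (subst sum_two [of i n j]) (auto simp: rotation_def)
  next
    case False
    then show ?thesis using assms that by (subst single [of l]) (auto simp: rotation_def)
  qed
  show "(\<Sum>l<n. rotation n i j a b k l * x l) =
      (if k = i then a * x i - cnj b * x j else if k = j then b * x i + a * x j else x k)"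
    if "k < n"
  proof (cases "k = i \<or> k = j")
    case True
    then show ?thesis using assms
      by (subst sum_two [of i n j]) (auto simp: rotation_def)
  next
    case False
    then show ?thesis using assms that by (subst single [of k]) (auto simp: rotation_def)
  qed
qed

lemma unitary_rotation:
  assumes ij: "i < n" "j < n" "i \<noteq> j" and "cnj a = a" "a * a + b * cnj b = 1"
  shows "unitary n (rotation n i j a b)"
proof (rule unitaryI)
  show "rotation n i j a b \<in> matrices n UNIV"
    using ij by (auto simp: matrices_iff rotation_def)
  fix k l assume kl: "k < n" "l < n"
  have ab: "b * cnj b = 1 - a * a" "cnj b * b = 1 - a * a"
    using assms(5) by (simp_all add: algebra_simps)
  let ?r = "rotation n i j a b"
  have val: "?r i i = a" "?r j i = b" "?r i j = - cnj b" "?r j j = a"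
    using ij by (simp_all add: rotation_def)
  have id: "?r m l' = (if m = l' then 1 else 0)" "?r l' m = (if m = l' then 1 else 0)"
    if "m \<noteq> i" "m \<noteq> j" "m < n" for m l'
    using that by (auto simp: rotation_def)
  have "(\<Sum>m<n. cnj (?r m k) * ?r m l) = (\<Sum>m<n. ?r m l * cnj (?r m k))"
    by (simp add: mult.commute)
  also have "\<dots> = (if k = l then 1 else 0)"
    unfolding sum_rotation(1) [OF ij kl(2)]
    using ij kl by (cases "k = i"; cases "k = j"; cases "l = i"; cases "l = j") (auto simp: val id assms(4) ab mult.commute)
  finally show "(\<Sum>m<n. cnj (?r m k) * ?r m l) = (if k = l then 1 else 0)" .
  show "(\<Sum>m<n. ?r k m * cnj (?r l m)) = (if k = l then 1 else 0)"
    unfolding sum_rotation(2) [OF ij kl(1)]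
    using ij kl by (cases "k = i"; cases "k = j"; cases "l = i"; cases "l = j") (auto simp: val id assms(4) ab mult.commute)
qed

lemma compress_hermitian:
  assumes "matrix_star Y = Y"
  shows "matrix_star (compress n w Y w) = compress n w (Y::complex matrix) w"
  by (simp add: compress_def matrix_star_rmul matrix_star_lmul assms lmul_rmul)

text \<open>A maximizer of the functional \<open>\<Sum>\<^sub>l l (w\<^sup>*Yw)\<^sub>l\<^sub>l\<close>, whose weights are distinct, diagonalizes \<open>Y\<close>,
  since otherwise some rotation in a coordinate plane increases it.\<close>

lemma hermitian_diagonalization:
  fixes Y :: "complex matrix"
  assumes Y: "Y \<in> matrices n UNIV" and herm: "matrix_star Y = Y"
  obtains w where "unitary n w"
    and "\<And>i j. i < n \<Longrightarrow> j < n \<Longrightarrow> i \<noteq> j \<Longrightarrow> compress n w Y w i j = 0"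
proof -
  define \<phi> where "\<phi> w = (\<Sum>l<n. real l * Re (compress n w Y w l l))" for w :: "complex matrix"
  have "continuous_on {w. unitary n w} \<phi>"
    unfolding \<phi>_def compress_eq scaleC_complex_def
    by (intro continuous_intros continuous_on_entry)
  with compact_unitary unitary_one obtain w
    where w: "unitary n w" and max: "\<And>r. unitary n r \<Longrightarrow> \<phi> r \<le> \<phi> w"
    using continuous_attains_sup [of "{w. unitary n w}" \<phi>] by blast
  define D where "D = compress n w Y w"
  have D_herm: "D j i = cnj (D i j)" for i j
    using fun_cong [OF fun_cong [OF compress_hermitian [OF herm, of n w], of j], of i]
    by (simp add: D_def matrix_star_def star_complex_def)
  have zero: "D i j = 0" if ij: "i < j" "j < n" for i j
  proof (rule ccontr)
    assume "D i j \<noteq> 0"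
    define d where "d = cmod (D i j)"
    have d: "d > 0" using \<open>D i j \<noteq> 0\<close> by (simp add: d_def)
    \<comment> \<open>The phase that makes the off-diagonal entry positive, so that the first-order
      change under a rotation is real and proportional to d.\<close>
    define \<omega> where "\<omega> = cnj (D i j) / of_real d"
    have \<omega>: "\<omega> * D i j = of_real d" "cnj \<omega> * D j i = of_real d" "\<omega> * cnj \<omega> = 1"
      using d by (simp_all add: \<omega>_def D_herm [of j i] d_def complex_norm_square [symmetric]
          power2_eq_square mult.commute divide_simps)
    \<comment> \<open>Here s is the tangent of the rotation angle. The rotation raises the diagonal
      entry i by c^2 times the displayed quantity and lowers the entry j by the same amount. Since i
      < j, a negative value would increase \<phi>.\<close>
    have ineq: "0 \<le> s * s * (Re (D j j) - Re (D i i)) + 2 * s * d" for s :: real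
    proof -
      define c where "c = 1 / sqrt (1 + s * s)"
      have pos: "0 < 1 + s * s" by (simp add: add_pos_nonneg)
      have c: "c * c * (1 + s * s) = 1" "c * c > 0" using pos by (simp_all add: c_def)
      define r where "r = rotation n i j (of_real c) (of_real (c * s) * \<omega>)"
      have r: "unitary n r"
        unfolding r_def
      proof (rule unitary_rotation)
        have "of_real c * of_real c + (of_real (c * s) * \<omega>) * cnj (of_real (c * s) * \<omega>) =
            of_real c * of_real c + of_real (c * s) * of_real (c * s) * (\<omega> * cnj \<omega>)"
          by (simp add: algebra_simps)
        also have "\<dots> = of_real (c * c * (1 + s * s))" by (simp add: \<omega>(3) algebra_simps)
        also have "\<dots> = 1" using c(1) by simp
        finally show "of_real c * of_real c +
            (of_real (c * s) * \<omega>) * cnj (of_real (c * s) * \<omega>) = 1" .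
      qed (use ij in auto)
      have entry: "compress n r D r l l = (\<Sum>m<n. r m l * (\<Sum>k<n. cnj (r k l) * D k m))" for l
        by (simp add: compress_eq scaleC_complex_def sum_distrib_left mult.assoc mult.left_commute)
      \<comment> \<open>Hermitian symmetry moves the conjugation from the entries of r to the whole
        inner sum, which \<open>sum_rotation\<close> can then evaluate.\<close>
      have entry': "compress n r D r l l = (\<Sum>m<n. r m l * cnj (\<Sum>k<n. r k l * D m k))" for l
        by (simp add: entry D_herm [symmetric])
      have i: "Re (compress n r D r i i) = c * c * (Re (D i i) + s * s * Re (D j j) + 2 * s * d)"
      proof -
        have "compress n r D r i i = of_real (c * c) *
            (cnj (D i i) + of_real (s * s) * (\<omega> * cnj \<omega>) * cnj (D j j)
             + of_real s * cnj (\<omega> * D i j) + of_real s * cnj (cnj \<omega> * D j i))"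
          using ij unfolding entry' unfolding r_def by (simp add: sum_rotation) (simp add: algebra_simps)
        then show ?thesis by (simp only: \<omega>) (simp add: algebra_simps)
      qed
      have j: "Re (compress n r D r j j) = c * c * (s * s * Re (D i i) + Re (D j j) - 2 * s * d)"
      proof -
        have "compress n r D r j j = of_real (c * c) *
            (of_real (s * s) * (\<omega> * cnj \<omega>) * cnj (D i i) + cnj (D j j)
             - of_real s * cnj (\<omega> * D i j) - of_real s * cnj (cnj \<omega> * D j i))"
          using ij unfolding entry' unfolding r_def by (simp add: sum_rotation) (simp add: algebra_simps)
        then show ?thesis by (simp only: \<omega>) (simp add: algebra_simps)
      qed
      have other: "compress n r D r l l = cnj (D l l)" if "l < n" "l \<noteq> i" "l \<noteq> j" for l
        using ij that unfolding entry' unfolding r_def by (simp add: sum_rotation)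
      have "(\<Sum>l<n. real l * Re (compress n r D r l l)) \<le> (\<Sum>l<n. real l * Re (D l l))"
        using max [OF unitary_mult [OF w r]] by (simp add: \<phi>_def D_def compress_compress)
      then have "0 \<le> (\<Sum>l<n. real l * Re (D l l) - real l * Re (compress n r D r l l))"
        by (simp add: sum_subtractf)
      also have "\<dots> = (real i * Re (D i i) - real i * Re (compress n r D r i i)) +
          (real j * Re (D j j) - real j * Re (compress n r D r j j))"
        using ij other by (intro sum_two) auto
      also have "\<dots> = (real j - real i) * (c * c) *
          (s * s * (Re (D j j) - Re (D i i)) + 2 * s * d)"
      proof -
        have "Re (D i i) = c * c * (1 + s * s) * Re (D i i)"
          "Re (D j j) = c * c * (1 + s * s) * Re (D j j)"
          by (simp_all only: c mult_1)
        then have "Re (D i i) - Re (compress n r D r i i) =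
            - (c * c * (s * s * (Re (D j j) - Re (D i i)) + 2 * s * d))"
          "Re (D j j) - Re (compress n r D r j j) =
            c * c * (s * s * (Re (D j j) - Re (D i i)) + 2 * s * d)"
          unfolding i j by (simp_all add: algebra_simps)
        then show ?thesis
          by (simp only: right_diff_distrib [symmetric]) (simp add: algebra_simps)
      qed
      finally have "0 \<le> ((real j - real i) * (c * c)) * (s * s * (Re (D j j) - Re (D i i)) + 2 * s * d)" .
      moreover have "0 < (real j - real i) * (c * c)" using c(2) ij by (intro mult_pos_pos [OF _ c(2)]) simp
      ultimately show ?thesis by (simp only: zero_le_mult_iff) auto
    qed
    define \<delta> where "\<delta> = Re (D j j) - Re (D i i)"
    \<comment> \<open>At s = - t the linear term wins: division by t leaves 2 d \<le> t \<delta>,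
      and this t keeps the right side at most d.\<close>
    define t where "t = d / (\<bar>\<delta>\<bar> + 1)"
    have t: "t > 0" using d by (simp add: t_def)
    have "0 \<le> t * (t * \<delta> - 2 * d)"
      using ineq [of "- t"] by (simp add: \<delta>_def algebra_simps)
    then have "2 * d \<le> t * \<delta>" using t by (simp add: zero_le_mult_iff)
    also have "\<dots> \<le> t * (\<bar>\<delta>\<bar> + 1)" using t by (intro mult_left_mono) auto
    also have "\<dots> = d" by (simp add: t_def)
    finally show False using d by simp
  qed
  show thesis
  proof (rule that [OF w])
    show "compress n w Y w i j = 0" if "i < n" "j < n" "i \<noteq> j" for i j
    proof (cases "i < j")
      case True
      then show ?thesis using zero that by (simp add: D_def)
    next
      case False
      then have "D j i = 0" using zero that by simp
      then show ?thesis using D_herm [of i j] by (simp add: D_def)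
    qed
  qed
qed

subsection \<open>The Hilbert space of square summable sequences\<close>

definition ell2_inner :: "(nat \<Rightarrow> complex) \<Rightarrow> (nat \<Rightarrow> complex) \<Rightarrow> complex" where
  "ell2_inner x y = (\<Sum>k. x k * cnj (y k))"

lemma ell2_abs_summable:
  assumes "x \<in> ell2" "y \<in> ell2"
  shows "summable (\<lambda>k. cmod (x k) * cmod (y k))"
proof (rule summable_comparison_test')
  show "summable (\<lambda>k. (cmod (x k))\<^sup>2 + (cmod (y k))\<^sup>2)"
    using assms by (intro summable_add) (auto simp: ell2_def)
  fix k
  have "2 * (cmod (x k) * cmod (y k)) \<le> (cmod (x k))\<^sup>2 + (cmod (y k))\<^sup>2"
    using sum_squares_bound [of "cmod (x k)" "cmod (y k)"] by simp
  moreover have nonneg: "0 \<le> cmod (x k) * cmod (y k)" by simp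
  ultimately have "cmod (x k) * cmod (y k) \<le> (cmod (x k))\<^sup>2 + (cmod (y k))\<^sup>2"
    by linarith
  with nonneg show "norm (cmod (x k) * cmod (y k)) \<le> (cmod (x k))\<^sup>2 + (cmod (y k))\<^sup>2"
    by (simp only: real_norm_def abs_of_nonneg)
qed

lemma ell2_inner_summable:
  assumes "x \<in> ell2" "y \<in> ell2"
  shows "summable (\<lambda>k. x k * cnj (y k))"
  by (rule summable_norm_cancel) (use ell2_abs_summable [OF assms] in \<open>simp add: norm_mult\<close>)

lemma csubspace_ell2: "csubspace ell2"
  unfolding csubspace_def
proof (intro conjI ballI allI)
  show "0 \<in> ell2" by (simp add: ell2_def zero_fun_def)
  fix x assume x: "x \<in> ell2"
  show "c *\<^sub>C x \<in> ell2" for c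
    using x by (simp add: ell2_def scaleC_fun_def scaleC_complex_def norm_mult power_mult_distrib
        summable_mult)
  fix y assume y: "y \<in> ell2"
  have "summable (\<lambda>k. (cmod (x k + y k))\<^sup>2)"
  proof (rule summable_comparison_test')
    show "summable (\<lambda>k. (cmod (x k))\<^sup>2 + (cmod (y k))\<^sup>2 + 2 * (cmod (x k) * cmod (y k)))"
      using x y ell2_abs_summable [OF x y]
      by (intro summable_add summable_mult) (auto simp: ell2_def)
    fix k
    have "(cmod (x k + y k))\<^sup>2 \<le> (cmod (x k) + cmod (y k))\<^sup>2"
      by (intro power_mono norm_triangle_ineq) simp
    then show "norm ((cmod (x k + y k))\<^sup>2) \<le>
        (cmod (x k))\<^sup>2 + (cmod (y k))\<^sup>2 + 2 * (cmod (x k) * cmod (y k))"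
      by (simp add: power2_sum)
  qed
  then show "x + y \<in> ell2" by (simp add: ell2_def plus_fun_def)
qed

lemma ell2_scaleC: "x \<in> ell2 \<Longrightarrow> c *\<^sub>C x \<in> ell2"
  and ell2_add: "x \<in> ell2 \<Longrightarrow> y \<in> ell2 \<Longrightarrow> x + y \<in> ell2"
  and ell2_zero: "0 \<in> ell2"
  using csubspace_ell2 by (auto simp: csubspace_def)

lemma ell2_sum: "(\<And>i. i \<in> I \<Longrightarrow> x i \<in> ell2) \<Longrightarrow> (\<Sum>i\<in>I. x i) \<in> ell2"
  by (rule csubspace_sum [OF csubspace_ell2])

lemma ell2_combination: "(\<And>i. i \<in> I \<Longrightarrow> x i \<in> ell2) \<Longrightarrow> (\<Sum>i\<in>I. a i *\<^sub>C x i) \<in> ell2"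
  by (intro ell2_sum ell2_scaleC)

lemma ell2_cnj: "x \<in> ell2 \<Longrightarrow> (\<lambda>k. cnj (x k)) \<in> ell2"
  by (simp add: ell2_def)

lemma ell2_norm_cnj: "ell2_norm (\<lambda>k. cnj (x k)) = ell2_norm x"
  by (simp add: ell2_norm_def)

lemma ell2_norm_nonneg: "x \<in> ell2 \<Longrightarrow> 0 \<le> ell2_norm x"
  by (simp add: ell2_norm_def ell2_def suminf_nonneg)

lemma ell2_norm_sq: "x \<in> ell2 \<Longrightarrow> (ell2_norm x)\<^sup>2 = (\<Sum>k. (cmod (x k))\<^sup>2)"
  by (simp add: ell2_norm_def ell2_def suminf_nonneg)

lemma ell2_inner_self:
  assumes "x \<in> ell2"
  shows "ell2_inner x x = of_real ((ell2_norm x)\<^sup>2)"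
proof -
  have "(\<Sum>k. x k * cnj (x k)) = (\<Sum>k. complex_of_real ((cmod (x k))\<^sup>2))"
    by (simp only: complex_norm_square)
  also have "\<dots> = of_real (\<Sum>k. (cmod (x k))\<^sup>2)"
    using assms by (intro suminf_of_real [symmetric]) (simp add: ell2_def)
  finally show ?thesis by (simp only: ell2_inner_def ell2_norm_sq [OF assms])
qed

lemma ell2_inner_cnj: "x \<in> ell2 \<Longrightarrow> y \<in> ell2 \<Longrightarrow> cnj (ell2_inner x y) = ell2_inner y x"
proof -
  assume "x \<in> ell2" "y \<in> ell2"
  then have "(\<lambda>k. cnj (x k * cnj (y k))) sums cnj (ell2_inner x y)"
    unfolding ell2_inner_def sums_cnj by (intro summable_sums ell2_inner_summable)
  then show ?thesis
    unfolding ell2_inner_def by (intro sums_unique) (simp add: mult.commute)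
qed

lemma sum_fun_apply: "(\<Sum>i\<in>I. f i) k = (\<Sum>i\<in>I. f i k :: 'b::comm_monoid_add)"
  by (induction I rule: infinite_finite_induct) simp_all

lemma ell2_inner_sum_left:
  assumes "\<And>i. i \<in> I \<Longrightarrow> x i \<in> ell2" "y \<in> ell2"
  shows "ell2_inner (\<Sum>i\<in>I. a i *\<^sub>C x i) y = (\<Sum>i\<in>I. a i * ell2_inner (x i) y)"
proof -
  have "(\<Sum>k. (\<Sum>i\<in>I. a i *\<^sub>C x i) k * cnj (y k)) = (\<Sum>k. \<Sum>i\<in>I. a i * (x i k * cnj (y k)))"
    by (simp add: sum_fun_apply scaleC_fun_def scaleC_complex_def sum_distrib_right mult.assoc)
  also have "\<dots> = (\<Sum>i\<in>I. \<Sum>k. a i * (x i k * cnj (y k)))"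
    using assms by (intro suminf_sum summable_mult ell2_inner_summable)
  also have "\<dots> = (\<Sum>i\<in>I. a i * (\<Sum>k. x i k * cnj (y k)))"
    using assms by (intro sum.cong refl suminf_mult ell2_inner_summable)
  finally show ?thesis by (simp add: ell2_inner_def)
qed

lemma ell2_inner_sum:
  assumes "\<And>i. i \<in> I \<Longrightarrow> x i \<in> ell2" "\<And>j. j \<in> J \<Longrightarrow> y j \<in> ell2"
  shows "ell2_inner (\<Sum>i\<in>I. a i *\<^sub>C x i) (\<Sum>j\<in>J. b j *\<^sub>C y j) =
    (\<Sum>i\<in>I. \<Sum>j\<in>J. a i * cnj (b j) * ell2_inner (x i) (y j))"
proof -
  have "ell2_inner (x i) (\<Sum>j\<in>J. b j *\<^sub>C y j) = (\<Sum>j\<in>J. cnj (b j) * ell2_inner (x i) (y j))"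
    if "i \<in> I" for i
  proof -
    have "ell2_inner (x i) (\<Sum>j\<in>J. b j *\<^sub>C y j) = cnj (ell2_inner (\<Sum>j\<in>J. b j *\<^sub>C y j) (x i))"
      using assms that by (intro ell2_inner_cnj [symmetric] ell2_combination)
    also have "\<dots> = (\<Sum>j\<in>J. cnj (b j) * cnj (ell2_inner (y j) (x i)))"
      using assms that by (simp add: ell2_inner_sum_left)
    also have "\<dots> = (\<Sum>j\<in>J. cnj (b j) * ell2_inner (x i) (y j))"
      using assms that by (intro sum.cong refl) (simp add: ell2_inner_cnj)
    finally show ?thesis .
  qed
  moreover have "ell2_inner (\<Sum>i\<in>I. a i *\<^sub>C x i) (\<Sum>j\<in>J. b j *\<^sub>C y j) =
      (\<Sum>i\<in>I. a i * ell2_inner (x i) (\<Sum>j\<in>J. b j *\<^sub>C y j))"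
    using assms by (intro ell2_inner_sum_left ell2_combination)
  ultimately show ?thesis by (simp add: sum_distrib_left mult.assoc)
qed

lemma ell2_norm_combination:
  assumes "\<And>i. i \<in> I \<Longrightarrow> x i \<in> ell2"
  shows "complex_of_real ((ell2_norm (\<Sum>i\<in>I. a i *\<^sub>C x i))\<^sup>2) =
    (\<Sum>i\<in>I. \<Sum>j\<in>I. a i * cnj (a j) * ell2_inner (x i) (x j))"
  using assms by (simp only: ell2_inner_self [symmetric] ell2_combination ell2_inner_sum)

lemma ell2_norm_scaleC: "x \<in> ell2 \<Longrightarrow> ell2_norm (c *\<^sub>C x) = cmod c * ell2_norm x"
proof -
  assume x: "x \<in> ell2"
  have "(ell2_norm (c *\<^sub>C x))\<^sup>2 = (\<Sum>k. (cmod c)\<^sup>2 * (cmod (x k))\<^sup>2)"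
    unfolding ell2_norm_sq [OF ell2_scaleC [OF x]]
    by (simp add: scaleC_fun_def scaleC_complex_def norm_mult power_mult_distrib)
  also have "\<dots> = (cmod c)\<^sup>2 * (ell2_norm x)\<^sup>2"
    using x by (simp add: ell2_norm_sq suminf_mult ell2_def)
  finally have "(ell2_norm (c *\<^sub>C x))\<^sup>2 = (cmod c * ell2_norm x)\<^sup>2"
    by (simp add: power_mult_distrib)
  then show ?thesis using x by (simp add: ell2_norm_nonneg ell2_scaleC)
qed

lemma ell2_cauchy_schwarz:
  assumes "x \<in> ell2" "y \<in> ell2"
  shows "(\<Sum>k. cmod (x k) * cmod (y k)) \<le> ell2_norm x * ell2_norm y"
    and "cmod (ell2_inner x y) \<le> ell2_norm x * ell2_norm y"
proof -
  show le: "(\<Sum>k. cmod (x k) * cmod (y k)) \<le> ell2_norm x * ell2_norm y"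
  proof (rule suminf_le_const [OF ell2_abs_summable [OF assms]])
    fix m
    have fin: "L2_set (\<lambda>k. cmod (z k)) {..<m} \<le> ell2_norm z" if "z \<in> ell2" for z
      using that unfolding L2_set_def ell2_norm_def ell2_def
      by (intro real_sqrt_le_mono sum_le_suminf) auto
    have "(\<Sum>k<m. cmod (x k) * cmod (y k)) \<le>
        L2_set (\<lambda>k. cmod (x k)) {..<m} * L2_set (\<lambda>k. cmod (y k)) {..<m}"
      using L2_set_mult_ineq [of "\<lambda>k. cmod (x k)" "\<lambda>k. cmod (y k)" "{..<m}"] by simp
    also have "\<dots> \<le> ell2_norm x * ell2_norm y"
      using assms by (intro mult_mono fin ell2_norm_nonneg L2_set_nonneg)
    finally show "(\<Sum>k<m. cmod (x k) * cmod (y k)) \<le> ell2_norm x * ell2_norm y" .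
  qed
  have "cmod (ell2_inner x y) \<le> (\<Sum>k. cmod (x k * cnj (y k)))"
    unfolding ell2_inner_def
    by (rule summable_norm) (use ell2_abs_summable [OF assms] in \<open>simp add: norm_mult\<close>)
  with le show "cmod (ell2_inner x y) \<le> ell2_norm x * ell2_norm y" by (simp add: norm_mult)
qed

lemma ell2_norm_triangle:
  assumes "x \<in> ell2" "y \<in> ell2"
  shows "ell2_norm (x + y) \<le> ell2_norm x + ell2_norm y"
proof (rule power2_le_imp_le)
  \<comment> \<open>Indexing the two summands by the booleans makes the sum a finite combination, so
    \<open>ell2_norm_combination\<close> expands its square.\<close>
  have "ell2_norm (x + y) = ell2_norm (\<Sum>b\<in>UNIV. 1 *\<^sub>C (if b then x else y))"
    by (simp add: UNIV_bool add.commute)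
  also have "complex_of_real (\<dots>\<^sup>2) = ell2_inner x x + ell2_inner y y + (ell2_inner x y + ell2_inner y x)"
    using assms by (subst ell2_norm_combination) (auto simp: UNIV_bool)
  finally have "(ell2_norm (x + y))\<^sup>2 = Re \<dots>" by (metis Re_complex_of_real)
  also have "\<dots> = (ell2_norm x)\<^sup>2 + (ell2_norm y)\<^sup>2 + (Re (ell2_inner x y) + Re (ell2_inner y x))"
    using assms by (simp add: ell2_inner_self)
  also have "\<dots> \<le> (ell2_norm x)\<^sup>2 + (ell2_norm y)\<^sup>2 + (ell2_norm x * ell2_norm y + ell2_norm y * ell2_norm x)"
    using ell2_cauchy_schwarz(2) [OF assms] ell2_cauchy_schwarz(2) [OF assms(2,1)]
      complex_Re_le_cmod [of "ell2_inner x y"] complex_Re_le_cmod [of "ell2_inner y x"] by linarith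
  finally show "(ell2_norm (x + y))\<^sup>2 \<le> (ell2_norm x + ell2_norm y)\<^sup>2"
    by (simp add: power2_sum)
qed (use assms in \<open>simp add: ell2_norm_nonneg\<close>)

lemma ell2_norm_zero [simp]: "ell2_norm 0 = 0"
  by (simp add: ell2_norm_def zero_fun_def)

lemma ell2_norm_sum_le:
  assumes "\<And>i. i \<in> I \<Longrightarrow> x i \<in> ell2"
  shows "ell2_norm (\<Sum>i\<in>I. x i) \<le> (\<Sum>i\<in>I. ell2_norm (x i))"
  using assms
proof (induction I rule: infinite_finite_induct)
  case (insert i I)
  have "ell2_norm (x i + (\<Sum>i\<in>I. x i)) \<le> ell2_norm (x i) + ell2_norm (\<Sum>i\<in>I. x i)"
    using insert.prems by (intro ell2_norm_triangle ell2_sum) auto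
  also have "\<dots> \<le> ell2_norm (x i) + (\<Sum>i\<in>I. ell2_norm (x i))"
    using insert.IH insert.prems by simp
  finally show ?case by (simp only: sum.insert [OF insert.hyps])
qed simp_all


subsection \<open>The extremal problem\<close>

text \<open>Apply the weighted inequality of means to sqrt x and sqrt y and square. The square of a
  convex combination falls short of the combination of the squares by exactly the gap term, which
  later identifies the equality case.\<close>

lemma young_gap:
  fixes x y \<theta> :: real
  assumes "0 < \<theta>" "\<theta> < 1" "0 \<le> x" "0 \<le> y"
  shows "x powr (1 - \<theta>) * y powr \<theta> + \<theta> * (1 - \<theta>) * (sqrt x - sqrt y)\<^sup>2 \<le> (1 - \<theta>) * x + \<theta> * y"
proof -
  have young: "a powr (1 - \<theta>) * b powr \<theta> \<le> (1 - \<theta>) * a + \<theta> * b" if "0 \<le> a" "0 \<le> b" for a b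
    using Youngs_inequality_0 [of "1 - \<theta>" \<theta> a b] assms(1,2) that
    by (cases "a = 0"; cases "b = 0") simp_all
  have sq: "(sqrt z powr p)\<^sup>2 = z powr p" if "0 \<le> z" for z p :: real
  proof -
    have "(sqrt z powr p)\<^sup>2 = sqrt z powr p * sqrt z powr p" by (rule power2_eq_square)
    also have "\<dots> = (sqrt z * sqrt z) powr p" by (rule powr_mult [symmetric])
    finally show ?thesis using that by simp
  qed
  have "x powr (1 - \<theta>) * y powr \<theta> = (sqrt x powr (1 - \<theta>) * sqrt y powr \<theta>)\<^sup>2"
    using assms by (simp add: power_mult_distrib sq)
  also have "\<dots> \<le> ((1 - \<theta>) * sqrt x + \<theta> * sqrt y)\<^sup>2"
    using assms by (intro power_mono young) auto
  also have "\<dots> = (1 - \<theta>) * x + \<theta> * y - \<theta> * (1 - \<theta>) * (sqrt x - sqrt y)\<^sup>2"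
  proof -
    have "(sqrt x)\<^sup>2 = x" "(sqrt y)\<^sup>2 = y" using assms by simp_all
    then have "(1 - \<theta>) * x + \<theta> * y = (1 - \<theta>) * (sqrt x)\<^sup>2 + \<theta> * (sqrt y)\<^sup>2" by simp
    then show ?thesis by algebra
  qed
  finally show ?thesis by simp
qed

text \<open>The eigenvalue lists of densities. The value 0 beyond n makes the set compact in the
  product topology.\<close>

definition weights :: "nat \<Rightarrow> (nat \<Rightarrow> real) set" where
  "weights n = {\<alpha>. (\<forall>i<n. 0 \<le> \<alpha> i) \<and> (\<forall>i\<ge>n. \<alpha> i = 0) \<and> (\<Sum>i<n. \<alpha> i) = 1}"

lemma weights_nonneg: "\<alpha> \<in> weights n \<Longrightarrow> 0 \<le> \<alpha> i"
  by (cases "i < n") (auto simp: weights_def)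

lemma weights_le_one:
  assumes "\<alpha> \<in> weights n" shows "\<alpha> i \<le> 1"
proof (cases "i < n")
  case True
  then have "\<alpha> i \<le> (\<Sum>i<n. \<alpha> i)" using weights_nonneg [OF assms] by (intro member_le_sum) auto
  then show ?thesis using assms by (simp add: weights_def)
qed (use assms in \<open>simp add: weights_def\<close>)

lemma weights_powr_sum_pos:
  assumes "\<alpha> \<in> weights n"
  shows "0 < (\<Sum>i<n. \<alpha> i powr p)"
proof -
  have "\<not> (\<forall>i\<in>{..<n}. \<alpha> i = 0)"
    using assms sum.neutral [of "{..<n}" \<alpha>] unfolding weights_def by force
  then obtain i where "i < n" "\<alpha> i \<noteq> 0" by auto
  then show ?thesis by (intro sum_pos2 [of _ i]) auto
qed

lemma compact_weights: "compact (weights n)"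
proof -
  have "compact {\<alpha>::nat \<Rightarrow> real. \<forall>i. \<alpha> i \<in> (if i < n then {0..1} else {0})}"
    by (intro compact_Pi) auto
  moreover have "closed {\<alpha>::nat \<Rightarrow> real. (\<Sum>i<n. \<alpha> i) = 1}"
    by (intro closed_Collect_eq continuous_intros
        continuous_on_product_then_coordinatewise [OF continuous_on_id])
  moreover have "weights n =
      {\<alpha>. \<forall>i. \<alpha> i \<in> (if i < n then {0..1} else {0})} \<inter> {\<alpha>. (\<Sum>i<n. \<alpha> i) = 1}"
  proof (intro set_eqI iffI)
    fix \<alpha> assume \<alpha>: "\<alpha> \<in> weights n"
    show "\<alpha> \<in> {\<alpha>. \<forall>i. \<alpha> i \<in> (if i < n then {0..1} else {0})} \<inter> {\<alpha>. (\<Sum>i<n. \<alpha> i) = 1}"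
      using weights_le_one [OF \<alpha>] weights_nonneg [OF \<alpha>] \<alpha> by (auto simp: weights_def)
  next
    fix \<alpha> :: "nat \<Rightarrow> real"
    assume "\<alpha> \<in> {\<alpha>. \<forall>i. \<alpha> i \<in> (if i < n then {0..1} else {0})} \<inter> {\<alpha>. (\<Sum>i<n. \<alpha> i) = 1}"
    then have entry: "\<And>i. \<alpha> i \<in> (if i < n then {0..1} else {0})" and sum: "(\<Sum>i<n. \<alpha> i) = 1"
      by auto
    have "0 \<le> \<alpha> i" if "i < n" for i using entry [of i] that by simp
    moreover have "\<alpha> i = 0" if "n \<le> i" for i using entry [of i] that by simp
    ultimately show "\<alpha> \<in> weights n" using sum by (simp add: weights_def)
  qed
  ultimately show ?thesis by (simp add: compact_Int_closed)
qed

text \<open>The equality case of \<open>tr (b\<^sup>1\<^sup>-\<^sup>\<theta> Y) \<le> \<parallel>Y\<parallel>\<^sub>1\<^sub>/\<^sub>\<theta>\<close> for densities \<open>b\<close>: equality forces \<open>Y\<close> to be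
  a multiple of \<open>b\<^sup>\<theta>\<close>.\<close>

lemma trace_maximizer:
  fixes Y :: "complex matrix" and \<beta> :: "nat \<Rightarrow> real"
  assumes \<theta>: "0 < \<theta>" "\<theta> < 1"
    and Y: "Y \<in> matrices n UNIV" "matrix_star Y = Y"
    and pos: "\<And>w l. unitary n w \<Longrightarrow> l < n \<Longrightarrow> 0 < Re (compress n w Y w l l)"
    and \<beta>: "\<beta> \<in> weights n" and M: "M = (\<Sum>l<n. \<beta> l powr (1 - \<theta>) * Re (Y l l))"
    and max: "\<And>w \<gamma>. unitary n w \<Longrightarrow> \<gamma> \<in> weights n \<Longrightarrow>
      (\<Sum>l<n. \<gamma> l powr (1 - \<theta>) * Re (compress n w Y w l l)) \<le> M"
  shows "\<forall>l<n. 0 < \<beta> l" and "Y = diagonal n (\<lambda>l. of_real (M * \<beta> l powr \<theta>))"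
proof -
  obtain w where w: "unitary n w"
    and off: "\<And>i j. i < n \<Longrightarrow> j < n \<Longrightarrow> i \<noteq> j \<Longrightarrow> compress n w Y w i j = 0"
    using hermitian_diagonalization [OF Y] by blast
  note wM = unitary_matrices [OF w]
  define y where "y l = Re (compress n w Y w l l)" for l
  have y: "0 < y l" if "l < n" for l unfolding y_def by (rule pos [OF w that])
  have real: "compress n w Y w l l = of_real (y l)" for l
    using fun_cong [OF fun_cong [OF compress_hermitian [OF Y(2), of n w], of l], of l]
    by (simp add: matrix_star_def star_complex_def y_def complex_eq_iff)
  have "compress n w Y w = diagonal n (\<lambda>l. of_real (y l))"
    using compress_matrices [OF _ wM wM Y(1)]
    by (intro matrix_eqI [OF _ matrices_diagonal]) (auto simp: diagonal_def off real)
  moreover have "Y = rmul n (lmul n w (compress n w Y w)) (matrix_star w)"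
    using lmul_unitary_cancel(1) [OF w Y(1)] rmul_unitary_cancel(1) [OF w Y(1)]
    by (simp add: compress_def lmul_rmul)
  ultimately have "Y = rmul n (lmul n w (diagonal n (\<lambda>l. of_real (y l)))) (matrix_star w)"
    by simp
  also have "lmul n w (diagonal n (\<lambda>l. of_real (y l))) = rmul n w (diagonal n (\<lambda>l. of_real (y l)))"
    by (simp add: lmul_def rmul_def scaleC_complex_def mult.commute)
  finally have Y_eq: "Y = rmul n (rmul n w (diagonal n (\<lambda>l. of_real (y l)))) (matrix_star w)" .
  have Y_entry: "Y i j = (\<Sum>m<n. of_real (y m) * (w i m * cnj (w j m)))" for i j
    by (subst Y_eq, unfold rmul_def sum_diagonal_scaleC)
      (simp add: matrix_star_def star_complex_def scaleC_complex_def mult_ac)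
  \<comment> \<open>A doubly stochastic matrix, since w is unitary. It relates the diagonal of Y to
    the eigenvalues of Y.\<close>
  define q where "q l m = (cmod (w l m))\<^sup>2" for l m
  have row: "(\<Sum>m<n. q l m) = 1" if "l < n" for l
  proof -
    have "complex_of_real (\<Sum>m<n. q l m) = (\<Sum>m<n. w l m * cnj (w l m))"
      by (simp add: q_def of_real_sum complex_norm_square del: of_real_power)
    then have "complex_of_real (\<Sum>m<n. q l m) = complex_of_real 1"
      using unitary_columns(2) [OF w that that] by simp
    then show ?thesis by (simp only: of_real_eq_iff)
  qed
  have col: "(\<Sum>l<n. q l m) = 1" if "m < n" for m
  proof -
    have "complex_of_real (\<Sum>l<n. q l m) = (\<Sum>l<n. cnj (w l m) * w l m)"
      by (simp add: q_def of_real_sum complex_norm_square mult.commute del: of_real_power)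
    then have "complex_of_real (\<Sum>l<n. q l m) = complex_of_real 1"
      using unitary_columns(1) [OF w that that] by simp
    then show ?thesis by (simp only: of_real_eq_iff)
  qed
  have Y_diag: "Re (Y l l) = (\<Sum>m<n. y m * q l m)" for l
    unfolding Y_entry by (simp add: q_def complex_norm_square [symmetric] del: of_real_power)
  obtain l0 where "l0 < n" using \<beta> by (cases n) (auto simp: weights_def)
  define S where "S = (\<Sum>m<n. y m powr (1/\<theta>))"
  have S: "0 < S" unfolding S_def using \<open>l0 < n\<close> y by (intro sum_pos2 [of _ l0]) force+
  have "S powr \<theta> \<le> M"
  proof -
    \<comment> \<open>For these weights, placed in the eigenbasis of Y, Hoelder's inequality is an
      equality. Hence M is at least the norm of the eigenvalue list with exponent
      1/\<theta>.\<close>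
    define \<gamma> where "\<gamma> l = (if l < n then y l powr (1/\<theta>) / S else 0)" for l
    have "\<gamma> \<in> weights n"
      using S by (auto simp: weights_def \<gamma>_def sum_divide_distrib [symmetric] S_def [symmetric])
    have "(\<Sum>l<n. \<gamma> l powr (1 - \<theta>) * y l) = (\<Sum>l<n. y l powr (1/\<theta>) / S powr (1 - \<theta>))"
    proof (intro sum.cong refl)
      fix l assume l: "l \<in> {..<n}"
      have "\<gamma> l powr (1 - \<theta>) * y l = (y l powr (1/\<theta>)) powr (1 - \<theta>) * y l powr 1 / S powr (1 - \<theta>)"
        using l y [of l] S by (simp add: \<gamma>_def powr_divide)
      also have "(y l powr (1/\<theta>)) powr (1 - \<theta>) * y l powr 1 = y l powr (1/\<theta>)"
        unfolding powr_powr powr_add [symmetric] using \<theta> by (simp add: field_simps)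
      finally show "\<gamma> l powr (1 - \<theta>) * y l = y l powr (1/\<theta>) / S powr (1 - \<theta>)" .
    qed
    also have "\<dots> = S powr 1 / S powr (1 - \<theta>)"
      using S by (simp add: sum_divide_distrib [symmetric] S_def [symmetric])
    also have "\<dots> = S powr \<theta>" unfolding powr_diff [symmetric] by simp
    finally show ?thesis using max [OF w \<open>\<gamma> \<in> weights n\<close>] by (simp add: y_def)
  qed
  then have M_pos: "0 < M" using S by (smt (verit) powr_gt_zero)
  \<comment> \<open>The eigenvalues of (Y/M)^(1/\<theta>), the only candidate for b. The bound
    S^\<theta> \<le> M says that its trace is at most 1.\<close>
  define \<eta> where "\<eta> m = (y m / M) powr (1/\<theta>)" for m
  have \<eta>_nonneg: "0 \<le> \<eta> m" for m by (simp add: \<eta>_def)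
  have \<eta>_powr: "M * \<eta> m powr \<theta> = y m" "0 < \<eta> m" if "m < n" for m
    using \<theta> M_pos y [OF that] by (simp_all add: \<eta>_def powr_powr)
  have \<eta>_sum: "(\<Sum>m<n. \<eta> m) \<le> 1"
  proof -
    have "(\<Sum>m<n. \<eta> m) = (\<Sum>m<n. y m powr (1/\<theta>) / M powr (1/\<theta>))"
      using M_pos y by (intro sum.cong refl) (simp add: \<eta>_def powr_divide less_imp_le)
    also have "\<dots> = S / M powr (1/\<theta>)" by (simp add: S_def sum_divide_distrib)
    also have "S = (S powr \<theta>) powr (1/\<theta>)" using \<theta> S by (simp add: powr_powr)
    also have "\<dots> / M powr (1/\<theta>) \<le> 1"
      using \<open>S powr \<theta> \<le> M\<close> \<theta> M_pos by (simp add: powr_mono2)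
    finally show ?thesis .
  qed
  define gap where "gap l m = \<theta> * (1 - \<theta>) * (sqrt (\<beta> l) - sqrt (\<eta> m))\<^sup>2" for l m
  have gap_nonneg: "0 \<le> gap l m" for l m using \<theta> by (simp add: gap_def)
  \<comment> \<open>Young's inequality averaged against q. The row and column sums of q bound the
    right side by (1 - \<theta>) + \<theta> = 1, while the left side without gaps equals 1 because M
    is the value at \<beta>. So each gap with positive weight q vanishes.\<close>
  have "(\<Sum>l<n. \<Sum>m<n. q l m * (\<beta> l powr (1 - \<theta>) * \<eta> m powr \<theta> + gap l m))
      \<le> (\<Sum>l<n. \<Sum>m<n. q l m * ((1 - \<theta>) * \<beta> l + \<theta> * \<eta> m))"
    unfolding gap_def using young_gap [OF \<theta> weights_nonneg [OF \<beta>] \<eta>_nonneg]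
    by (intro sum_mono mult_left_mono) (auto simp: q_def)
  also have "\<dots> = (\<Sum>l<n. \<Sum>m<n. q l m * ((1 - \<theta>) * \<beta> l)) + (\<Sum>m<n. \<Sum>l<n. q l m * (\<theta> * \<eta> m))"
    unfolding distrib_left sum.distrib by (intro arg_cong2 [where f = "(+)"] refl sum.swap)
  also have "\<dots> = (\<Sum>l<n. (1 - \<theta>) * \<beta> l) + (\<Sum>m<n. \<theta> * \<eta> m)"
    by (simp add: sum_distrib_right [symmetric] row col)
  also have "\<dots> \<le> 1"
    using \<beta> \<theta> mult_left_mono [OF \<eta>_sum, of \<theta>]
    by (simp add: sum_distrib_left [symmetric] weights_def)
  finally have le: "(\<Sum>l<n. \<Sum>m<n. q l m * (\<beta> l powr (1 - \<theta>) * \<eta> m powr \<theta>)) +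
      (\<Sum>l<n. \<Sum>m<n. q l m * gap l m) \<le> 1"
    by (simp add: distrib_left sum.distrib)
  have "M * (\<Sum>l<n. \<Sum>m<n. q l m * (\<beta> l powr (1 - \<theta>) * \<eta> m powr \<theta>)) =
      (\<Sum>l<n. \<Sum>m<n. \<beta> l powr (1 - \<theta>) * ((M * \<eta> m powr \<theta>) * q l m))"
    by (simp add: sum_distrib_left mult_ac)
  also have "\<dots> = (\<Sum>l<n. \<Sum>m<n. \<beta> l powr (1 - \<theta>) * (y m * q l m))"
    by (intro sum.cong refl) (simp add: \<eta>_powr(1))
  also have "\<dots> = M"
    by (simp add: M Y_diag sum_distrib_left)
  finally have "(\<Sum>l<n. \<Sum>m<n. q l m * (\<beta> l powr (1 - \<theta>) * \<eta> m powr \<theta>)) = 1"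
    using M_pos by simp
  with le have "(\<Sum>l<n. \<Sum>m<n. q l m * gap l m) \<le> 0" by simp
  moreover have "0 \<le> (\<Sum>m<n. q l m * gap l m)" for l
    by (intro sum_nonneg mult_nonneg_nonneg gap_nonneg) (simp add: q_def)
  ultimately have zero: "q l m * gap l m = 0" if "l < n" "m < n" for l m
  proof -
    have "(\<Sum>m<n. q l m * gap l m) = 0"
      using sum_nonneg_0 [of "{..<n}" "\<lambda>l. \<Sum>m<n. q l m * gap l m" l]
        \<open>(\<Sum>l<n. \<Sum>m<n. q l m * gap l m) \<le> 0\<close> \<open>\<And>l. 0 \<le> (\<Sum>m<n. q l m * gap l m)\<close> that
      by (simp add: antisym sum_nonneg)
    then show ?thesis
      using sum_nonneg_0 [of "{..<n}" "\<lambda>m. q l m * gap l m" m] that gap_nonneg by (simp add: q_def)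
  qed
  \<comment> \<open>Each eigenvector m of Y is thus supported on coordinates l with \<beta> l =
    \<eta> m, that is, the diagonal matrix of \<beta> is (Y/M)^(1/\<theta>).\<close>
  have \<beta>_eq: "\<beta> l = \<eta> m" if "l < n" "m < n" "w l m \<noteq> 0" for l m
    using zero [OF that(1,2)] that(3) \<theta> by (simp add: q_def gap_def)
  show "\<forall>l<n. 0 < \<beta> l"
  proof safe
    fix l assume l: "l < n"
    have "\<exists>m<n. q l m \<noteq> 0"
    proof (rule ccontr)
      assume "\<not> (\<exists>m<n. q l m \<noteq> 0)"
      then have "(\<Sum>m<n. q l m) = 0" by (intro sum.neutral) auto
      with row [OF l] show False by simp
    qed
    then obtain m where "m < n" "w l m \<noteq> 0" by (auto simp: q_def)
    then show "0 < \<beta> l" using \<beta>_eq [OF l] \<eta>_powr(2) by simp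
  qed
  show "Y = diagonal n (\<lambda>l. of_real (M * \<beta> l powr \<theta>))"
  proof (rule matrix_eqI [OF Y(1) matrices_diagonal])
    fix i j assume ij: "i < n" "j < n"
    have "Y i j = (\<Sum>m<n. of_real (M * \<beta> i powr \<theta>) * (w i m * cnj (w j m)))"
      unfolding Y_entry
    proof (intro sum.cong refl)
      fix m assume "m \<in> {..<n}"
      then show "of_real (y m) * (w i m * cnj (w j m)) =
          of_real (M * \<beta> i powr \<theta>) * (w i m * cnj (w j m))"
        using \<beta>_eq [OF ij(1), of m] \<eta>_powr(1) [of m] by (cases "w i m = 0") auto
    qed
    also have "\<dots> = of_real (M * \<beta> i powr \<theta>) * (\<Sum>m<n. w i m * cnj (w j m))"
      by (simp only: sum_distrib_left)
    also have "\<dots> = diagonal n (\<lambda>l. of_real (M * \<beta> l powr \<theta>)) i j"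
      using unitary_columns(2) [OF w ij] ij by (simp add: diagonal_def)
    finally show "Y i j = diagonal n (\<lambda>l. of_real (M * \<beta> l powr \<theta>)) i j" .
  qed
qed

text \<open>With the other density fixed, the functional is the pairing of
  \<open>b^(1-\<theta>)\<close> with a Hermitian matrix Y, positive definite because of the shift s.
  By \<open>trace_maximizer\<close>, Y is M times the \<theta>-power of the extremal density;
  evaluating its quadratic form at d and discarding the contribution of s gives the
  inequality.\<close>

lemma extremal_columns:
  fixes x :: "nat \<Rightarrow> nat \<Rightarrow> nat \<Rightarrow> complex" and c \<beta> :: "nat \<Rightarrow> real"
  assumes \<theta>: "0 < \<theta>" "\<theta> < 1"
    and x: "\<And>k l. k < n \<Longrightarrow> l < n \<Longrightarrow> x k l \<in> ell2"
    and c: "\<And>k. 0 \<le> c k" and s: "0 < s"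
    and \<beta>: "\<beta> \<in> weights n"
    and M: "M = (\<Sum>l<n. \<beta> l powr (1 - \<theta>) * ((\<Sum>k<n. c k * (ell2_norm (x k l))\<^sup>2) + s))"
    and max: "\<And>w \<gamma>. unitary n w \<Longrightarrow> \<gamma> \<in> weights n \<Longrightarrow>
      (\<Sum>l<n. \<gamma> l powr (1 - \<theta>) *
        ((\<Sum>k<n. c k * (ell2_norm (\<Sum>j<n. w j l *\<^sub>C x k j))\<^sup>2) + s)) \<le> M"
  shows "\<forall>l<n. 0 < \<beta> l"
    and "(\<Sum>k<n. c k * (ell2_norm (\<Sum>l<n. d l *\<^sub>C x k l))\<^sup>2) \<le>
      M * (\<Sum>l<n. \<beta> l powr \<theta> * (cmod (d l))\<^sup>2)"
proof -
  \<comment> \<open>A weighted Gram matrix plus s times the identity. The indices in the inner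
    product are reversed because \<open>ell2_inner\<close> is linear in its first argument.\<close>
  define Y where "Y = (\<lambda>i j. if i < n \<and> j < n
    then (\<Sum>k<n. of_real (c k) * ell2_inner (x k j) (x k i)) + (if i = j then of_real s else 0)
    else 0)"
  have Y: "Y \<in> matrices n UNIV" by (simp add: matrices_iff Y_def)
  have herm: "matrix_star Y = Y"
    by (auto simp: matrix_star_def star_complex_def Y_def fun_eq_iff ell2_inner_cnj x)
  have quad: "(\<Sum>i<n. \<Sum>j<n. cnj (d i) * d j * Y i j) =
      of_real ((\<Sum>k<n. c k * (ell2_norm (\<Sum>j<n. d j *\<^sub>C x k j))\<^sup>2) + s * (\<Sum>i<n. (cmod (d i))\<^sup>2))"
    for d
  proof -
    have "(\<Sum>i<n. \<Sum>j<n. cnj (d i) * d j * Y i j) =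
        (\<Sum>i<n. \<Sum>j<n. \<Sum>k<n. of_real (c k) * (d j * cnj (d i) * ell2_inner (x k j) (x k i))) +
        (\<Sum>i<n. \<Sum>j<n. if i = j then of_real s * (cnj (d i) * d i) else 0)"
      unfolding sum.distrib [symmetric]
      by (intro sum.cong refl) (simp add: Y_def distrib_left sum_distrib_left mult_ac)
    also have "(\<Sum>i<n. \<Sum>j<n. \<Sum>k<n. of_real (c k) * (d j * cnj (d i) * ell2_inner (x k j) (x k i))) =
        (\<Sum>k<n. \<Sum>j<n. \<Sum>i<n. of_real (c k) * (d j * cnj (d i) * ell2_inner (x k j) (x k i)))"
    proof -
      have "(\<Sum>i<n. \<Sum>j<n. \<Sum>k<n. g i j k) = (\<Sum>k<n. \<Sum>j<n. \<Sum>i<n. g i j k)"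
        for g :: "nat \<Rightarrow> nat \<Rightarrow> nat \<Rightarrow> complex"
      proof -
        have "(\<Sum>i<n. \<Sum>j<n. \<Sum>k<n. g i j k) = (\<Sum>i<n. \<Sum>k<n. \<Sum>j<n. g i j k)"
          by (intro sum.cong refl sum.swap)
        also have "\<dots> = (\<Sum>k<n. \<Sum>i<n. \<Sum>j<n. g i j k)" by (rule sum.swap)
        also have "\<dots> = (\<Sum>k<n. \<Sum>j<n. \<Sum>i<n. g i j k)"
          by (intro sum.cong refl sum.swap)
        finally show ?thesis .
      qed
      then show ?thesis .
    qed
    also have "\<dots> = (\<Sum>k<n. of_real (c k) * of_real ((ell2_norm (\<Sum>j<n. d j *\<^sub>C x k j))\<^sup>2))"
    proof (intro sum.cong refl)
      fix k assume "k \<in> {..<n}"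
      then have "complex_of_real ((ell2_norm (\<Sum>j<n. d j *\<^sub>C x k j))\<^sup>2) =
          (\<Sum>j<n. \<Sum>i<n. d j * cnj (d i) * ell2_inner (x k j) (x k i))"
        by (intro ell2_norm_combination x) auto
      then show "(\<Sum>j<n. \<Sum>i<n. of_real (c k) * (d j * cnj (d i) * ell2_inner (x k j) (x k i))) =
          of_real (c k) * of_real ((ell2_norm (\<Sum>j<n. d j *\<^sub>C x k j))\<^sup>2)"
        by (simp only: sum_distrib_left)
    qed
    also have "(\<Sum>i<n. \<Sum>j<n. if i = j then of_real s * (cnj (d i) * d i) else 0) =
        of_real s * (\<Sum>i<n. complex_of_real ((cmod (d i))\<^sup>2))"
      by (simp add: complex_norm_square sum_distrib_left mult.commute del: of_real_power)
    finally show ?thesis by simp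
  qed
  have unit: "(\<Sum>i<n. (cmod (w i l))\<^sup>2) = 1" if "unitary n w" "l < n" for w l
  proof -
    have "complex_of_real (\<Sum>i<n. (cmod (w i l))\<^sup>2) = (\<Sum>i<n. cnj (w i l) * w i l)"
      by (simp add: of_real_sum complex_norm_square mult.commute del: of_real_power)
    then have "complex_of_real (\<Sum>i<n. (cmod (w i l))\<^sup>2) = complex_of_real 1"
      using unitary_columns(1) [OF that(1,2,2)] by simp
    then show ?thesis by (simp only: of_real_eq_iff)
  qed
  have compress: "Re (compress n w Y w l l) =
      (\<Sum>k<n. c k * (ell2_norm (\<Sum>j<n. w j l *\<^sub>C x k j))\<^sup>2) + s" if "unitary n w" "l < n" for w l
  proof -
    have "compress n w Y w l l = (\<Sum>i<n. \<Sum>j<n. cnj (w i l) * w j l * Y i j)"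
      unfolding compress_eq scaleC_complex_def by (rule sum.swap)
    then show ?thesis unfolding quad unit [OF that] by simp
  qed
  have diag: "Re (Y l l) = (\<Sum>k<n. c k * (ell2_norm (x k l))\<^sup>2) + s" if "l < n" for l
    using that by (simp add: Y_def ell2_inner_self x)
  have Y_max: "(\<Sum>l<n. \<gamma> l powr (1 - \<theta>) * Re (compress n w Y w l l)) \<le> M"
    if "unitary n w" "\<gamma> \<in> weights n" for w \<gamma>
    using max [OF that] by (simp add: compress [OF that(1)])
  have Y_M: "M = (\<Sum>l<n. \<beta> l powr (1 - \<theta>) * Re (Y l l))" by (simp add: M diag)
  have Y_pos: "0 < Re (compress n w Y w l l)" if "unitary n w" "l < n" for w l
    unfolding compress [OF that] using c s by (intro add_nonneg_pos sum_nonneg) auto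
  note extremal = trace_maximizer [OF \<theta> Y herm Y_pos \<beta> Y_M Y_max]
  show "\<forall>l<n. 0 < \<beta> l" by (rule extremal(1))
  have "(\<Sum>i<n. \<Sum>j<n. cnj (d i) * d j * Y i j) =
      (\<Sum>i<n. cnj (d i) * (\<Sum>j<n. diagonal n (\<lambda>l. of_real (M * \<beta> l powr \<theta>)) i j *\<^sub>C d j))"
    by (subst extremal(2)) (auto simp: sum_distrib_left scaleC_complex_def mult_ac)
  also have "\<dots> = (\<Sum>i<n. of_real (M * \<beta> i powr \<theta> * (cmod (d i))\<^sup>2))"
    unfolding sum_diagonal_scaleC
    by (intro sum.cong refl)
      (simp add: scaleC_complex_def complex_norm_square mult_ac del: of_real_power)
  finally have "complex_of_real ((\<Sum>k<n. c k * (ell2_norm (\<Sum>j<n. d j *\<^sub>C x k j))\<^sup>2) +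
      s * (\<Sum>i<n. (cmod (d i))\<^sup>2)) = of_real (\<Sum>i<n. M * \<beta> i powr \<theta> * (cmod (d i))\<^sup>2)"
    unfolding quad of_real_sum .
  then have "(\<Sum>k<n. c k * (ell2_norm (\<Sum>j<n. d j *\<^sub>C x k j))\<^sup>2) +
      s * (\<Sum>i<n. (cmod (d i))\<^sup>2) = M * (\<Sum>i<n. \<beta> i powr \<theta> * (cmod (d i))\<^sup>2)"
    by (simp only: of_real_eq_iff sum_distrib_left mult.assoc)
  moreover have "0 \<le> s * (\<Sum>i<n. (cmod (d i))\<^sup>2)"
    using s by (intro mult_nonneg_nonneg sum_nonneg) auto
  ultimately show "(\<Sum>k<n. c k * (ell2_norm (\<Sum>l<n. d l *\<^sub>C x k l))\<^sup>2) \<le>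
      M * (\<Sum>l<n. \<beta> l powr \<theta> * (cmod (d l))\<^sup>2)"
    by linarith
qed

section \<open>Existence of extremal densities\<close>

lemma compress_right_one:
  assumes "csubspace V" "v \<in> matrices n UNIV" "X \<in> matrices n V"
  shows "compress n v X (diagonal n (\<lambda>_. 1)) = lmul n (matrix_star v) X"
  unfolding compress_def
  by (rule rmul_one [OF matrices_lmul [OF assms(1) matrices_matrix_star [OF assms(2)] assms(3)]])

lemma compress_left_one:
  assumes "X \<in> matrices n V"
  shows "compress n (diagonal n (\<lambda>_. 1)) X w = rmul n X w"
  by (simp add: compress_def matrix_star_diagonal lmul_one [OF assms])

text \<open>The perturbation \<open>\<epsilon>\<close> makes the extremal densities invertible.\<close>

lemma extremal_densities:
  fixes U :: "(nat \<Rightarrow> complex) matrix"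
  assumes \<theta>: "0 < \<theta>" "\<theta> < 1" and n: "1 \<le> n" and U: "U \<in> matrices n ell2" and \<epsilon>: "0 < \<epsilon>"
    and bound: "\<And>v w \<alpha> \<beta>. unitary n v \<Longrightarrow> unitary n w \<Longrightarrow> \<alpha> \<in> weights n \<Longrightarrow> \<beta> \<in> weights n \<Longrightarrow>
      (\<Sum>k<n. \<Sum>l<n. \<alpha> k powr \<theta> * \<beta> l powr (1 - \<theta>) * (ell2_norm (compress n v U w k l))\<^sup>2) \<le> \<kappa>"
  obtains v w \<alpha> \<beta> M where "unitary n v" "unitary n w"
    and "\<And>k. k < n \<Longrightarrow> 0 < \<alpha> k" "\<And>l. l < n \<Longrightarrow> 0 < \<beta> l"
    and "0 \<le> M" "M \<le> \<kappa> + \<epsilon> * (real n)\<^sup>2"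
    and "\<And>d. (\<Sum>k<n. \<alpha> k powr \<theta> * (ell2_norm (\<Sum>l<n. d l *\<^sub>C compress n v U w k l))\<^sup>2) \<le>
      M * (\<Sum>l<n. \<beta> l powr \<theta> * (cmod (d l))\<^sup>2)"
    and "\<And>d. (\<Sum>l<n. \<beta> l powr (1 - \<theta>) * (ell2_norm (\<Sum>k<n. d k *\<^sub>C compress n v U w k l))\<^sup>2) \<le>
      M * (\<Sum>k<n. \<alpha> k powr (1 - \<theta>) * (cmod (d k))\<^sup>2)"
proof -
  define \<Phi> where "\<Phi> v w \<alpha> \<beta> = (\<Sum>k<n. \<Sum>l<n. \<alpha> k powr \<theta> * \<beta> l powr (1 - \<theta>) *
      ((ell2_norm (compress n v U w k l))\<^sup>2 + \<epsilon>))" for v w and \<alpha> \<beta> :: "nat \<Rightarrow> real"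
  define T where "T = {v. unitary n v} \<times> {w. unitary n w} \<times> weights n \<times> weights n"
  have Uent: "U i j \<in> ell2" for i j
    using U matrices_outside [OF U, of i j] ell2_zero
    by (cases "i < n \<and> j < n") (auto simp: matrices_iff not_less)
  \<comment> \<open>Written as a polynomial in the entries of v, w and their conjugates, the squared
    norm is visibly continuous.\<close>
  have norm_compress: "(ell2_norm (compress n v U w i j))\<^sup>2 =
      Re (\<Sum>(l,k)\<in>{..<n}\<times>{..<n}. \<Sum>(l',k')\<in>{..<n}\<times>{..<n}.
        (cnj (v k i) * w l j) * cnj (cnj (v k' i) * w l' j) * ell2_inner (U k l) (U k' l'))"
    for v w i j
  proof -
    have "compress n v U w i j =
        (\<Sum>p\<in>{..<n}\<times>{..<n}. (cnj (v (snd p) i) * w (fst p) j) *\<^sub>C U (snd p) (fst p))"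
      unfolding compress_eq sum.cartesian_product by (simp add: case_prod_unfold)
    then have "complex_of_real ((ell2_norm (compress n v U w i j))\<^sup>2) =
        (\<Sum>p\<in>{..<n}\<times>{..<n}. \<Sum>q\<in>{..<n}\<times>{..<n}.
          (cnj (v (snd p) i) * w (fst p) j) * cnj (cnj (v (snd q) i) * w (fst q) j) *
          ell2_inner (U (snd p) (fst p)) (U (snd q) (fst q)))"
      by (simp only:) (intro ell2_norm_combination Uent)
    then show ?thesis unfolding case_prod_unfold by (metis Re_complex_of_real)
  qed
  have T_compact: "compact T"
    unfolding T_def by (intro compact_Times compact_unitary compact_weights)
  have cont_entry: "continuous_on T (\<lambda>t. fst t i j)" "continuous_on T (\<lambda>t. fst (snd t) i j)"
      "continuous_on T (\<lambda>t. fst (snd (snd t)) i)" "continuous_on T (\<lambda>t. snd (snd (snd t)) i)"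
      for i j
    by (rule continuous_on_product_then_coordinatewise [OF
          continuous_on_product_then_coordinatewise [OF continuous_on_fst [OF continuous_on_id]]]
        continuous_on_product_then_coordinatewise [OF
          continuous_on_product_then_coordinatewise [OF
            continuous_on_fst [OF continuous_on_snd [OF continuous_on_id]]]]
        continuous_on_product_then_coordinatewise [OF
          continuous_on_fst [OF continuous_on_snd [OF continuous_on_snd [OF continuous_on_id]]]]
        continuous_on_product_then_coordinatewise [OF
          continuous_on_snd [OF continuous_on_snd [OF continuous_on_snd [OF continuous_on_id]]]])+
  have T_nonneg: "0 \<le> fst (snd (snd t)) i" "0 \<le> snd (snd (snd t)) i" if "t \<in> T" for t i
    using that weights_nonneg by (auto simp: T_def)
  have cont: "continuous_on T (\<lambda>t. \<Phi> (fst t) (fst (snd t)) (fst (snd (snd t))) (snd (snd (snd t))))"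
    unfolding \<Phi>_def norm_compress case_prod_unfold
    by (intro continuous_intros continuous_on_powr' cont_entry) (use \<theta> T_nonneg in auto)
  define \<omega> where "\<omega> = (\<lambda>i::nat. if i = 0 then 1 else 0 :: real)"
  have "\<omega> \<in> weights n" using n by (auto simp: weights_def \<omega>_def)
  then have "T \<noteq> {}" using unitary_one by (auto simp: T_def)
  from continuous_attains_sup [OF T_compact this cont] obtain t where "t \<in> T"
    and t_max: "\<And>t'. t' \<in> T \<Longrightarrow> \<Phi> (fst t') (fst (snd t')) (fst (snd (snd t'))) (snd (snd (snd t')))
      \<le> \<Phi> (fst t) (fst (snd t)) (fst (snd (snd t))) (snd (snd (snd t)))"
    by blast
  obtain v w \<alpha> \<beta> where t: "t = (v, w, \<alpha>, \<beta>)" by (cases t)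
  have max_T: "\<Phi> v' w' \<alpha>' \<beta>' \<le> \<Phi> v w \<alpha> \<beta>" if "(v', w', \<alpha>', \<beta>') \<in> T" for v' w' \<alpha>' \<beta>'
    using t_max [OF that] by (simp add: t)
  from \<open>t \<in> T\<close> have v: "unitary n v" and w: "unitary n w"
    and \<alpha>: "\<alpha> \<in> weights n" and \<beta>: "\<beta> \<in> weights n"
    by (auto simp: T_def t)
  define M where "M = \<Phi> v w \<alpha> \<beta>"
  define V where "V = compress n v U w"
  have V: "V \<in> matrices n ell2"
    unfolding V_def by (intro compress_matrices csubspace_ell2 unitary_matrices v w U)
  have Vent: "V i j \<in> ell2" if "i < n" "j < n" for i j using V that by (simp add: matrices_iff)
  \<comment> \<open>Products of unitaries are unitary, so after compression to V the maximum over
    all bases sits at the identity on both sides.\<close>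
  have max: "(\<Sum>k<n. \<Sum>l<n. \<alpha>' k powr \<theta> * \<beta>' l powr (1 - \<theta>) *
      ((ell2_norm (compress n r V s k l))\<^sup>2 + \<epsilon>)) \<le> M"
    if "unitary n r" "unitary n s" "\<alpha>' \<in> weights n" "\<beta>' \<in> weights n" for r s \<alpha>' \<beta>'
    using max_T [of "matrix_mult n v r" "matrix_mult n w s" \<alpha>' \<beta>'] that v w
    by (simp add: T_def unitary_mult M_def \<Phi>_def V_def compress_compress)
  have M: "M = (\<Sum>k<n. \<Sum>l<n. \<alpha> k powr \<theta> * \<beta> l powr (1 - \<theta>) * ((ell2_norm (V k l))\<^sup>2 + \<epsilon>))"
    by (simp add: M_def \<Phi>_def V_def)
  \<comment> \<open>For one fixed density the perturbation adds the same positive constant to each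
    coefficient of the other; this constant is the shift in \<open>extremal_columns\<close>.\<close>
  have columns: "(\<Sum>k<n. \<Sum>l<n. a k * b l * (z k l + \<epsilon>)) =
      (\<Sum>l<n. b l * ((\<Sum>k<n. a k * z k l) + \<epsilon> * (\<Sum>k<n. a k)))" for a b :: "nat \<Rightarrow> real" and z
  proof -
    have "(\<Sum>k<n. \<Sum>l<n. a k * b l * (z k l + \<epsilon>)) = (\<Sum>l<n. \<Sum>k<n. a k * b l * (z k l + \<epsilon>))"
      by (rule sum.swap)
    also have "\<dots> = (\<Sum>l<n. b l * ((\<Sum>k<n. a k * z k l) + \<epsilon> * (\<Sum>k<n. a k)))"
      by (simp add: sum_distrib_left distrib_left sum.distrib mult_ac)
    finally show ?thesis .
  qed
  have rows: "(\<Sum>k<n. \<Sum>l<n. a k * b l * (z k l + \<epsilon>)) =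
      (\<Sum>k<n. a k * ((\<Sum>l<n. b l * z k l) + \<epsilon> * (\<Sum>l<n. b l)))" for a b :: "nat \<Rightarrow> real" and z
    by (simp add: sum_distrib_left distrib_left sum.distrib mult_ac)
  have s_pos: "0 < \<epsilon> * (\<Sum>k<n. \<alpha> k powr \<theta>)" "0 < \<epsilon> * (\<Sum>l<n. \<beta> l powr (1 - \<theta>))"
    using \<epsilon> weights_powr_sum_pos [OF \<alpha>] weights_powr_sum_pos [OF \<beta>] by simp_all

  have col_max: "(\<Sum>l<n. \<gamma> l powr (1 - \<theta>) *
      ((\<Sum>k<n. \<alpha> k powr \<theta> * (ell2_norm (\<Sum>j<n. r j l *\<^sub>C V k j))\<^sup>2) +
        \<epsilon> * (\<Sum>k<n. \<alpha> k powr \<theta>))) \<le> M"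
    if "unitary n r" "\<gamma> \<in> weights n" for r \<gamma>
    using max [OF unitary_one that(1) \<alpha> that(2)]
    unfolding columns compress_left_one [OF V] rmul_def .
  have col: "\<forall>l<n. 0 < \<beta> l"
    "(\<Sum>k<n. \<alpha> k powr \<theta> * (ell2_norm (\<Sum>l<n. d l *\<^sub>C V k l))\<^sup>2) \<le>
      M * (\<Sum>l<n. \<beta> l powr \<theta> * (cmod (d l))\<^sup>2)" for d
    by (rule extremal_columns [where x = V and c = "\<lambda>k. \<alpha> k powr \<theta>",
          OF \<theta> _ powr_ge_zero s_pos(1) \<beta> M [unfolded columns]]; (rule Vent col_max; assumption))+
  have star_norm: "ell2_norm (\<Sum>j<n. d j *\<^sub>C (\<lambda>m. cnj (V j k m))) =
      ell2_norm (\<Sum>j<n. cnj (d j) *\<^sub>C V j k)" for d k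
  proof -
    have "(\<Sum>j<n. d j *\<^sub>C (\<lambda>m. cnj (V j k m))) = (\<lambda>m. cnj ((\<Sum>j<n. cnj (d j) *\<^sub>C V j k) m))"
      by (simp add: fun_eq_iff sum_fun_apply scaleC_fun_def scaleC_complex_def)
    then show ?thesis by (simp only: ell2_norm_cnj)
  qed
  \<comment> \<open>Rows of V become columns of W, so \<theta> and 1 - \<theta> change places.
    Multiplication by \<open>matrix_star r\<close> from the left has conjugated coefficients;
    conjugating the vectors too restores plain coefficients without affecting norms.\<close>
  define W where "W l k = (\<lambda>m. cnj (V k l m))" for k l
  have Went: "W k l \<in> ell2" if "k < n" "l < n" for k l
    unfolding W_def using that by (intro ell2_cnj Vent)
  have \<theta>': "0 < 1 - \<theta>" "1 - \<theta> < 1" using \<theta> by simp_all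
  have M': "M = (\<Sum>k<n. \<alpha> k powr (1 - (1 - \<theta>)) * ((\<Sum>l<n. \<beta> l powr (1 - \<theta>) * (ell2_norm (W l k))\<^sup>2) +
      \<epsilon> * (\<Sum>l<n. \<beta> l powr (1 - \<theta>))))"
    using M unfolding rows by (simp add: W_def ell2_norm_cnj)
  have row_max: "(\<Sum>k<n. \<gamma> k powr (1 - (1 - \<theta>)) *
      ((\<Sum>l<n. \<beta> l powr (1 - \<theta>) * (ell2_norm (\<Sum>j<n. r j k *\<^sub>C W l j))\<^sup>2) +
        \<epsilon> * (\<Sum>l<n. \<beta> l powr (1 - \<theta>)))) \<le> M"
    if "unitary n r" "\<gamma> \<in> weights n" for r \<gamma>
    using max [OF that(1) unitary_one that(2) \<beta>]
    unfolding rows compress_right_one [OF csubspace_ell2 unitary_matrices [OF that(1)] V] lmul_def W_def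
      star_norm
    by (simp add: matrix_star_def star_complex_def)
  have row: "\<forall>k<n. 0 < \<alpha> k"
    "(\<Sum>l<n. \<beta> l powr (1 - \<theta>) * (ell2_norm (\<Sum>k<n. d k *\<^sub>C W l k))\<^sup>2) \<le>
      M * (\<Sum>k<n. \<alpha> k powr (1 - \<theta>) * (cmod (d k))\<^sup>2)" for d
    by (rule extremal_columns [where x = W and c = "\<lambda>l. \<beta> l powr (1 - \<theta>)",
          OF \<theta>' _ powr_ge_zero s_pos(2) \<alpha> M']; (rule Went row_max; assumption))+
  show thesis
  proof (rule that [OF v w])
    show "\<And>k. k < n \<Longrightarrow> 0 < \<alpha> k" using row(1) by blast
    show "\<And>l. l < n \<Longrightarrow> 0 < \<beta> l" using col(1) by blast
    show "0 \<le> M" unfolding M using \<epsilon> by (intro sum_nonneg mult_nonneg_nonneg add_nonneg_nonneg) auto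
    \<comment> \<open>The perturbation costs at most \<epsilon> n^2, because each of the n^2
      products of powers of weights is at most 1.\<close>
    have "M = (\<Sum>k<n. \<Sum>l<n. \<alpha> k powr \<theta> * \<beta> l powr (1 - \<theta>) * (ell2_norm (compress n v U w k l))\<^sup>2) +
        \<epsilon> * (\<Sum>k<n. \<Sum>l<n. \<alpha> k powr \<theta> * \<beta> l powr (1 - \<theta>))"
      by (simp add: M V_def distrib_left sum.distrib sum_distrib_left mult_ac)
    also have "\<dots> \<le> \<kappa> + \<epsilon> * (\<Sum>k<n. \<Sum>l<n. 1)"
    proof (intro add_mono bound v w \<alpha> \<beta> mult_left_mono sum_mono)
      fix k l
      have "\<alpha> k powr \<theta> \<le> 1" "\<beta> l powr (1 - \<theta>) \<le> 1"
        using \<theta> weights_nonneg [OF \<alpha>] weights_le_one [OF \<alpha>] weights_nonneg [OF \<beta>] weights_le_one [OF \<beta>]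
        by (auto intro: powr_le1)
      then show "\<alpha> k powr \<theta> * \<beta> l powr (1 - \<theta>) \<le> 1" by (intro mult_le_one) auto
    qed (use \<epsilon> in simp)
    finally show "M \<le> \<kappa> + \<epsilon> * (real n)\<^sup>2" by (simp add: power2_eq_square)
    fix d :: "nat \<Rightarrow> complex"
    show "(\<Sum>k<n. \<alpha> k powr \<theta> * (ell2_norm (\<Sum>l<n. d l *\<^sub>C compress n v U w k l))\<^sup>2) \<le>
        M * (\<Sum>l<n. \<beta> l powr \<theta> * (cmod (d l))\<^sup>2)"
      using col(2) [of d] by (simp only: V_def)
    show "(\<Sum>l<n. \<beta> l powr (1 - \<theta>) * (ell2_norm (\<Sum>k<n. d k *\<^sub>C compress n v U w k l))\<^sup>2) \<le>
        M * (\<Sum>k<n. \<alpha> k powr (1 - \<theta>) * (cmod (d k))\<^sup>2)"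
      using row(2) [of "\<lambda>k. cnj (d k)"] unfolding W_def star_norm V_def [symmetric] by simp
  qed
qed

subsection \<open>Norms of matrices over the row and column spaces\<close>

text \<open>The line through this vector contains the range of every row operator and serves as an
  isometric copy of the scalars in \<open>ell2\<close>.\<close>

definition first_unit :: "nat \<Rightarrow> complex" where
  "first_unit = (\<lambda>m. if m = 0 then 1 else 0)"

lemma first_unit: "first_unit \<in> ell2" "ell2_norm first_unit = 1"
proof -
  have "(\<lambda>i. (cmod (first_unit i))\<^sup>2) sums (\<Sum>i\<in>{0}. (cmod (first_unit i))\<^sup>2)"
    by (intro sums_finite) (auto simp: first_unit_def)
  then have sums: "(\<lambda>i. (cmod (first_unit i))\<^sup>2) sums 1" by (simp add: first_unit_def)
  then show "first_unit \<in> ell2" by (auto simp: ell2_def sums_iff)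
  show "ell2_norm first_unit = 1" using sums by (simp add: ell2_norm_def sums_iff)
qed

text \<open>Parseval's identity with vector coefficients: in the expanded squares, the mixed terms
  cancel by orthonormality of the columns of v.\<close>

lemma sum_norm_isometry:
  fixes v :: "nat \<Rightarrow> nat \<Rightarrow> complex"
  assumes v: "\<And>k l. k < n \<Longrightarrow> l < n \<Longrightarrow> (\<Sum>i<n. v i k * cnj (v i l)) = (if k = l then 1 else 0)"
    and x: "\<And>k. k < n \<Longrightarrow> x k \<in> ell2"
  shows "(\<Sum>i<n. (ell2_norm (\<Sum>k<n. v i k *\<^sub>C x k))\<^sup>2) = (\<Sum>k<n. (ell2_norm (x k))\<^sup>2)"
proof -
  have "complex_of_real (\<Sum>i<n. (ell2_norm (\<Sum>k<n. v i k *\<^sub>C x k))\<^sup>2) =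
      (\<Sum>i<n. \<Sum>k<n. \<Sum>l<n. v i k * cnj (v i l) * ell2_inner (x k) (x l))"
    unfolding of_real_sum using x by (intro sum.cong refl ell2_norm_combination) auto
  also have "\<dots> = (\<Sum>k<n. \<Sum>i<n. \<Sum>l<n. v i k * cnj (v i l) * ell2_inner (x k) (x l))"
    by (rule sum.swap)
  also have "\<dots> = (\<Sum>k<n. \<Sum>l<n. \<Sum>i<n. v i k * cnj (v i l) * ell2_inner (x k) (x l))"
    by (intro sum.cong refl sum.swap)
  also have "\<dots> = (\<Sum>k<n. \<Sum>l<n. if k = l then ell2_inner (x k) (x k) else 0)"
    using v by (intro sum.cong refl) (auto simp: sum_distrib_right [symmetric])
  also have "\<dots> = complex_of_real (\<Sum>k<n. (ell2_norm (x k))\<^sup>2)"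
    by (simp add: ell2_inner_self x)
  finally show ?thesis by (simp only: of_real_eq_iff)
qed

lemma sum_cmod_isometry:
  fixes v :: "nat \<Rightarrow> nat \<Rightarrow> complex"
  assumes "\<And>k l. k < n \<Longrightarrow> l < n \<Longrightarrow> (\<Sum>i<n. v i k * cnj (v i l)) = (if k = l then 1 else 0)"
  shows "(\<Sum>i<n. (cmod (\<Sum>k<n. v i k * c k))\<^sup>2) = (\<Sum>k<n. (cmod (c k))\<^sup>2)"
proof -
  have "(\<Sum>k<n. v i k *\<^sub>C c k *\<^sub>C first_unit) = (\<Sum>k<n. v i k * c k) *\<^sub>C first_unit" for i
    by (simp add: scaleC_scaleC scaleC_sum_left)
  then show ?thesis
    using sum_norm_isometry [of n v "\<lambda>k. c k *\<^sub>C first_unit", OF assms]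
    by (simp add: ell2_scaleC first_unit ell2_norm_scaleC)
qed

text \<open>A crude common majorant of the column, row and sum norms. Limits of finite combinations
  can be taken in it and transferred to all three.\<close>

definition entry_norm :: "nat \<Rightarrow> (nat \<Rightarrow> complex) matrix \<Rightarrow> real" where
  "entry_norm n X = (\<Sum>i<n. \<Sum>j<n. ell2_norm (X i j))"

lemma entry_norm_nonneg: "X \<in> matrices n ell2 \<Longrightarrow> 0 \<le> entry_norm n X"
  unfolding entry_norm_def by (intro sum_nonneg ell2_norm_nonneg) (simp add: matrices_iff)

lemma csubspace_ell2_matrices: "csubspace (matrices n ell2)"
  by (rule csubspace_matrices [OF csubspace_ell2])

lemma combination_matrices:
  "(\<And>p. p \<in> P \<Longrightarrow> G p \<in> matrices n ell2) \<Longrightarrow> (\<Sum>p\<in>P. c p *\<^sub>C G p) \<in> matrices n ell2"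
  by (rule csubspace_sum [OF csubspace_ell2_matrices])
    (use csubspace_ell2_matrices in \<open>auto simp: csubspace_def\<close>)

lemma entry_norm_combination_le:
  assumes G: "\<And>p. p \<in> P \<Longrightarrow> G p \<in> matrices n ell2"
  shows "entry_norm n (\<Sum>p\<in>P. c p *\<^sub>C G p) \<le> (\<Sum>p\<in>P. cmod (c p) * entry_norm n (G p))"
proof -
  have entry: "(\<Sum>p\<in>P. c p *\<^sub>C G p) i j = (\<Sum>p\<in>P. c p *\<^sub>C G p i j)" for i j
    by (simp add: sum_fun_apply) (simp add: scaleC_fun_def)
  have Gij: "G p i j \<in> ell2" if "p \<in> P" "i < n" "j < n" for p i j
    using G [OF that(1)] that by (simp add: matrices_iff)
  have "entry_norm n (\<Sum>p\<in>P. c p *\<^sub>C G p) \<le>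
      (\<Sum>i<n. \<Sum>j<n. \<Sum>p\<in>P. cmod (c p) * ell2_norm (G p i j))"
    unfolding entry_norm_def entry
  proof (intro sum_mono)
    fix i j assume ij: "i \<in> {..<n}" "j \<in> {..<n}"
    have "ell2_norm (\<Sum>p\<in>P. c p *\<^sub>C G p i j) \<le> (\<Sum>p\<in>P. ell2_norm (c p *\<^sub>C G p i j))"
      using ij by (intro ell2_norm_sum_le ell2_scaleC Gij) auto
    also have "\<dots> = (\<Sum>p\<in>P. cmod (c p) * ell2_norm (G p i j))"
      using ij by (intro sum.cong refl ell2_norm_scaleC Gij) auto
    finally show "ell2_norm (\<Sum>p\<in>P. c p *\<^sub>C G p i j) \<le> \<dots>" .
  qed
  also have "\<dots> = (\<Sum>i<n. \<Sum>p\<in>P. \<Sum>j<n. cmod (c p) * ell2_norm (G p i j))"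
    by (intro sum.cong refl sum.swap)
  also have "\<dots> = (\<Sum>p\<in>P. \<Sum>i<n. \<Sum>j<n. cmod (c p) * ell2_norm (G p i j))"
    by (rule sum.swap)
  finally show ?thesis by (simp only: entry_norm_def sum_distrib_left)
qed

text \<open>A real supremum is informative only for a nonempty bounded set. The zero vector supplies
  an element, which also gives nonnegativity.\<close>

lemma operator_matrix_norm_bounds:
  assumes zero: "\<And>i j. T i j 0 = 0"
    and le: "\<And>h. (\<And>j. j < n \<Longrightarrow> h j \<in> ell2) \<Longrightarrow> (\<Sum>j<n. (ell2_norm (h j))\<^sup>2) \<le> 1 \<Longrightarrow>
      (\<Sum>i<n. (ell2_norm (\<Sum>j<n. T i j (h j)))\<^sup>2) \<le> B\<^sup>2" and B: "0 \<le> B"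
  shows "0 \<le> operator_matrix_norm n T" and "operator_matrix_norm n T \<le> B"
proof -
  let ?S = "{sqrt (\<Sum>i<n. (ell2_norm (\<Sum>j<n. T i j (h j)))\<^sup>2) | h.
            (\<forall>j<n. h j \<in> ell2) \<and> (\<Sum>j<n. (ell2_norm (h j))\<^sup>2) \<le> 1}"
  have "sqrt (\<Sum>i<n. (ell2_norm (\<Sum>j<n. T i j ((\<lambda>_. 0) j)))\<^sup>2) \<in> ?S"
    using ell2_zero by (intro CollectI exI [of _ "\<lambda>_. 0"]) simp
  then have mem: "0 \<in> ?S" by (simp add: zero)
  have upper: "s \<le> B" if "s \<in> ?S" for s
  proof -
    from that obtain h where h: "\<forall>j<n. h j \<in> ell2" "(\<Sum>j<n. (ell2_norm (h j))\<^sup>2) \<le> 1"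
      and s: "s = sqrt (\<Sum>i<n. (ell2_norm (\<Sum>j<n. T i j (h j)))\<^sup>2)"
      by blast
    have "s \<le> sqrt (B\<^sup>2)" unfolding s using h by (intro real_sqrt_le_mono le) auto
    then show ?thesis using B by simp
  qed
  show "0 \<le> operator_matrix_norm n T"
    unfolding operator_matrix_norm_def using mem upper by (intro cSup_upper bdd_aboveI) auto
  show "operator_matrix_norm n T \<le> B"
    unfolding operator_matrix_norm_def using mem upper by (intro cSup_least) auto
qed

text \<open>A column operator sees only the coordinate 0 of its argument and multiplies x by it. So
  the norm is tested on scalars c, the 0-th coordinates of the vectors h.\<close>

lemma column_norm_bounds:
  assumes X: "X \<in> matrices n ell2" and B: "0 \<le> B"
    and le: "\<And>c. (\<Sum>i<n. (ell2_norm (\<Sum>j<n. c j *\<^sub>C X i j))\<^sup>2) \<le> B\<^sup>2 * (\<Sum>j<n. (cmod (c j))\<^sup>2)"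
  shows "0 \<le> column_norm n X" and "column_norm n X \<le> B"
proof -
  have col: "column_operator x h = h 0 *\<^sub>C x" for x h
    by (simp add: column_operator_eq scaleC_fun_def scaleC_complex_def mult.commute)
  have zero: "column_operator (X i j) 0 = 0" for i j by (simp add: col)
  have "(\<Sum>i<n. (ell2_norm (\<Sum>j<n. column_operator (X i j) (h j)))\<^sup>2) \<le> B\<^sup>2"
    if h: "\<And>j. j < n \<Longrightarrow> h j \<in> ell2" "(\<Sum>j<n. (ell2_norm (h j))\<^sup>2) \<le> 1" for h
  proof -
    have "(cmod (x 0))\<^sup>2 \<le> (ell2_norm x)\<^sup>2" if "x \<in> ell2" for x
      using sum_le_suminf [of "\<lambda>k. (cmod (x k))\<^sup>2" "{0}"] that
      by (simp add: ell2_norm_sq) (simp add: ell2_def)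
    then have "(\<Sum>j<n. (cmod (h j 0))\<^sup>2) \<le> (\<Sum>j<n. (ell2_norm (h j))\<^sup>2)"
      using h(1) by (intro sum_mono) auto
    then have "B\<^sup>2 * (\<Sum>j<n. (cmod (h j 0))\<^sup>2) \<le> B\<^sup>2 * 1"
      using h(2) by (intro mult_left_mono) auto
    then show ?thesis using le [of "\<lambda>j. h j 0"] by (simp add: col)
  qed
  from operator_matrix_norm_bounds [of "\<lambda>i j. column_operator (X i j)", OF zero this B]
  show "0 \<le> column_norm n X" "column_norm n X \<le> B" unfolding column_norm_def by blast+
qed

text \<open>A row operator is a functional times \<open>first_unit\<close>, so the matrix maps
  \<open>ell2^n\<close> to scalars. The hypothesis bounds the transposed map, and duality carries
  the bound over.\<close>

lemma row_norm_bounds: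
  assumes X: "X \<in> matrices n ell2" and B: "0 \<le> B"
    and le: "\<And>c. (\<Sum>j<n. (ell2_norm (\<Sum>i<n. c i *\<^sub>C X i j))\<^sup>2) \<le> B\<^sup>2 * (\<Sum>i<n. (cmod (c i))\<^sup>2)"
  shows "0 \<le> row_norm n X" and "row_norm n X \<le> B"
proof -
  have row: "row_operator x h = ell2_inner x (\<lambda>k. cnj (h k)) *\<^sub>C first_unit" for x h
    by (auto simp: row_operator_eq ell2_inner_def first_unit_def scaleC_fun_def scaleC_complex_def
        fun_eq_iff)
  have zero: "row_operator (X i j) 0 = 0" for i j
    by (simp add: row ell2_inner_def)
  have "(\<Sum>i<n. (ell2_norm (\<Sum>j<n. row_operator (X i j) (h j)))\<^sup>2) \<le> B\<^sup>2"
    if h: "\<And>j. j < n \<Longrightarrow> h j \<in> ell2" "(\<Sum>j<n. (ell2_norm (h j))\<^sup>2) \<le> 1" for h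
  proof -
    define h' where "h' j = (\<lambda>k. cnj (h j k))" for j
    have h': "h' j \<in> ell2" "ell2_norm (h' j) = ell2_norm (h j)" if "j < n" for j
      using h(1) [OF that] by (simp_all add: h'_def ell2_cnj ell2_norm_cnj)
    define r where "r i = (\<Sum>j<n. ell2_inner (X i j) (h' j))" for i
    define R where "R = (\<Sum>i<n. (cmod (r i))\<^sup>2)"
    have R: "0 \<le> R" by (simp add: R_def sum_nonneg)
    have Xij: "X i j \<in> ell2" if "i < n" "j < n" for i j using X that by (simp add: matrices_iff)
    \<comment> \<open>Testing the hypothesis with the conjugates of the values r i themselves gives
      R \<le> B sqrt R, by Cauchy-Schwarz against h.\<close>
    define z where "z j = (\<Sum>i<n. cnj (r i) *\<^sub>C X i j)" for j
    have z: "z j \<in> ell2" if "j < n" for j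
      unfolding z_def using that by (intro ell2_combination Xij) auto
    have "complex_of_real R = (\<Sum>i<n. cnj (r i) * r i)"
      unfolding R_def of_real_sum complex_norm_square by (simp add: mult.commute)
    also have "\<dots> = (\<Sum>i<n. \<Sum>j<n. cnj (r i) * ell2_inner (X i j) (h' j))"
      by (subst (2) r_def) (simp only: sum_distrib_left)
    also have "\<dots> = (\<Sum>j<n. \<Sum>i<n. cnj (r i) * ell2_inner (X i j) (h' j))"
      by (rule sum.swap)
    also have "\<dots> = (\<Sum>j<n. ell2_inner (z j) (h' j))"
      unfolding z_def using Xij h'(1)
      by (intro sum.cong refl ell2_inner_sum_left [symmetric]) auto
    finally have "R = cmod (\<Sum>j<n. ell2_inner (z j) (h' j))"
      using R by (metis norm_of_real abs_of_nonneg)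
    also have "\<dots> \<le> (\<Sum>j<n. cmod (ell2_inner (z j) (h' j)))" by (rule norm_sum)
    also have "\<dots> \<le> (\<Sum>j<n. ell2_norm (z j) * ell2_norm (h j))"
      using ell2_cauchy_schwarz(2) [OF z h'(1)] h'(2) by (intro sum_mono) force
    also have "\<dots> \<le> (\<Sum>j<n. \<bar>ell2_norm (z j)\<bar> * \<bar>ell2_norm (h j)\<bar>)"
      by (intro sum_mono) (simp add: abs_mult [symmetric])
    also have "\<dots> \<le> L2_set (\<lambda>j. ell2_norm (z j)) {..<n} * L2_set (\<lambda>j. ell2_norm (h j)) {..<n}"
      by (rule L2_set_mult_ineq)
    also have "\<dots> \<le> (B * sqrt R) * 1"
    proof (intro mult_mono)
      have "(\<Sum>j<n. (ell2_norm (z j))\<^sup>2) \<le> B\<^sup>2 * R"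
        unfolding z_def using le [of "\<lambda>i. cnj (r i)"] by (simp add: R_def)
      then have "L2_set (\<lambda>j. ell2_norm (z j)) {..<n} \<le> sqrt (B\<^sup>2 * R)"
        unfolding L2_set_def by (rule real_sqrt_le_mono)
      then show "L2_set (\<lambda>j. ell2_norm (z j)) {..<n} \<le> B * sqrt R"
        using B by (simp add: real_sqrt_mult)
      show "L2_set (\<lambda>j. ell2_norm (h j)) {..<n} \<le> 1"
        unfolding L2_set_def using h(2) by simp
    qed (use B R in \<open>auto intro: L2_set_nonneg\<close>)
    finally have "sqrt R * sqrt R \<le> B * sqrt R" using R by simp
    then have "sqrt R \<le> B"
      using R B by (cases "R = 0") (auto intro: mult_right_le_imp_le simp del: real_sqrt_mult_self)
    then have "R \<le> B\<^sup>2" by (rule sqrt_le_D)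
    moreover have "(\<Sum>j<n. row_operator (X i j) (h j)) = r i *\<^sub>C first_unit" for i
      by (simp add: row r_def h'_def scaleC_sum_left)
    ultimately show ?thesis by (simp add: ell2_norm_scaleC first_unit R_def)
  qed
  from operator_matrix_norm_bounds [of "\<lambda>i j. row_operator (X i j)", OF zero this B]
  show "0 \<le> row_norm n X" "row_norm n X \<le> B" unfolding row_norm_def by blast+
qed

text \<open>Each |c_j| is at most the Euclidean norm of c, and a sum of squares is at most the
  square of the sum. The generous constant is enough for boundedness and continuity.\<close>

lemma combination_le_entry_norm:
  fixes n :: nat
  assumes x: "\<And>i j. i < n \<Longrightarrow> j < n \<Longrightarrow> x i j \<in> ell2"
  shows "(\<Sum>i<n. (ell2_norm (\<Sum>j<n. c j *\<^sub>C x i j))\<^sup>2) \<le>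
    (\<Sum>i<n. \<Sum>j<n. ell2_norm (x i j))\<^sup>2 * (\<Sum>j<n. (cmod (c j))\<^sup>2)"
proof -
  define C where "C = sqrt (\<Sum>j<n. (cmod (c j))\<^sup>2)"
  have C: "cmod (c j) \<le> C" if "j < n" for j
    unfolding C_def using that member_le_sum [of j "{..<n}" "\<lambda>j. (cmod (c j))\<^sup>2"]
    by (intro real_le_rsqrt) auto
  have C0: "0 \<le> C" by (simp add: C_def sum_nonneg)
  define s where "s i = (\<Sum>j<n. ell2_norm (x i j))" for i
  have s: "0 \<le> s i" if "i < n" for i
    unfolding s_def using that by (intro sum_nonneg ell2_norm_nonneg x) auto
  have "(\<Sum>i<n. (ell2_norm (\<Sum>j<n. c j *\<^sub>C x i j))\<^sup>2) \<le> (\<Sum>i<n. (C * s i)\<^sup>2)"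
  proof (intro sum_mono power_mono)
    fix i assume i: "i \<in> {..<n}"
    have "ell2_norm (\<Sum>j<n. c j *\<^sub>C x i j) \<le> (\<Sum>j<n. ell2_norm (c j *\<^sub>C x i j))"
      using i by (intro ell2_norm_sum_le ell2_scaleC x) auto
    also have "\<dots> \<le> (\<Sum>j<n. C * ell2_norm (x i j))"
      using i x by (intro sum_mono) (simp add: ell2_norm_scaleC mult_right_mono C ell2_norm_nonneg)
    finally show "ell2_norm (\<Sum>j<n. c j *\<^sub>C x i j) \<le> C * s i"
      by (simp add: s_def sum_distrib_left)
    show "0 \<le> ell2_norm (\<Sum>j<n. c j *\<^sub>C x i j)"
      using i by (intro ell2_norm_nonneg ell2_combination x) auto
  qed
  also have "\<dots> = C\<^sup>2 * (\<Sum>i<n. s i * s i)"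
    by (simp add: sum_distrib_left power2_eq_square mult_ac)
  also have "\<dots> \<le> C\<^sup>2 * (\<Sum>i<n. s i * (\<Sum>k<n. s k))"
    using s by (intro mult_left_mono sum_mono member_le_sum) auto
  also have "\<dots> = (\<Sum>i<n. s i)\<^sup>2 * C\<^sup>2"
    by (simp add: sum_distrib_right [symmetric] power2_eq_square mult_ac)
  also have "C\<^sup>2 = (\<Sum>j<n. (cmod (c j))\<^sup>2)" by (simp add: C_def sum_nonneg)
  finally show ?thesis by (simp only: s_def)
qed

lemma column_norm_le_entry_norm:
  assumes X: "X \<in> matrices n ell2"
  shows "0 \<le> column_norm n X" "column_norm n X \<le> entry_norm n X"
  using column_norm_bounds [OF X entry_norm_nonneg [OF X]] combination_le_entry_norm [of n X] X
  by (auto simp: entry_norm_def matrices_iff)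

lemma row_norm_le_entry_norm:
  assumes X: "X \<in> matrices n ell2"
  shows "0 \<le> row_norm n X" "row_norm n X \<le> entry_norm n X"
proof -
  have "(\<Sum>i<n. \<Sum>j<n. ell2_norm (X j i)) = entry_norm n X"
    unfolding entry_norm_def by (rule sum.swap)
  then show "0 \<le> row_norm n X" "row_norm n X \<le> entry_norm n X"
    using row_norm_bounds [OF X entry_norm_nonneg [OF X]] combination_le_entry_norm [of n "\<lambda>i j. X j i"] X
    by (auto simp: matrices_iff)
qed

abbreviation CR_sum_norm :: "nat \<Rightarrow> (nat \<Rightarrow> complex) matrix \<Rightarrow> real" where
  "CR_sum_norm n \<equiv> sum_norm (matrices n ell2) (column_norm n) (matrices n ell2) (row_norm n)"

lemma sum_norm_le_entry_norm:
  assumes X: "X \<in> matrices n ell2"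
  shows "0 \<le> CR_sum_norm n X" "CR_sum_norm n X \<le> entry_norm n X"
proof -
  let ?S = "{column_norm n a + row_norm n b | a b.
    a \<in> matrices n ell2 \<and> b \<in> matrices n ell2 \<and> X = a + b}"
  have zero: "(0 :: (nat \<Rightarrow> complex) matrix) \<in> matrices n ell2"
    using csubspace_ell2_matrices by (simp add: csubspace_def)
  have "row_norm n 0 = 0"
    using row_norm_le_entry_norm [OF zero] by (simp add: entry_norm_def)
  \<comment> \<open>The decomposition X = X + 0 makes the set nonempty and bounds the sum norm by
    the column norm.\<close>
  then have mem: "column_norm n X \<in> ?S"
    using X zero by (intro CollectI exI [of _ X] exI [of _ 0]) simp
  have lower: "0 \<le> s" if "s \<in> ?S" for s
    using that column_norm_le_entry_norm(1) row_norm_le_entry_norm(1) by fastforce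
  show "0 \<le> CR_sum_norm n X"
    unfolding sum_norm_def using mem lower by (intro cInf_greatest) auto
  have "CR_sum_norm n X \<le> column_norm n X"
    unfolding sum_norm_def using mem lower by (intro cInf_lower bdd_belowI) auto
  also have "\<dots> \<le> entry_norm n X" by (rule column_norm_le_entry_norm(2) [OF X])
  finally show "CR_sum_norm n X \<le> entry_norm n X" .
qed

lemma sum_space_self:
  assumes "csubspace V"
  shows "sum_space V V = V"
proof
  show "sum_space V V \<subseteq> V" using assms by (auto simp: sum_space_def csubspace_def)
  show "V \<subseteq> sum_space V V"
  proof
    fix x assume "x \<in> V"
    then have "x = x + 0 \<and> x \<in> V \<and> 0 \<in> V" using assms by (simp add: csubspace_def)
    then show "x \<in> sum_space V V" unfolding sum_space_def by blast
  qed
qed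


subsection \<open>Exponential sums as functions on the strip\<close>

text \<open>Differences of such sums are again combinations of the G i, with coefficients tending to
  0. Only domination by \<open>entry_norm\<close> enters, so p may be the column, the row or the sum
  norm.\<close>

lemma norm_continuous_on_combination:
  fixes e :: "'p \<Rightarrow> 's::topological_space \<Rightarrow> complex"
  assumes p: "\<And>X. X \<in> matrices n ell2 \<Longrightarrow> 0 \<le> p X \<and> p X \<le> entry_norm n X"
    and G: "\<And>i. i \<in> P \<Longrightarrow> G i \<in> matrices n ell2"
    and e: "\<And>i. i \<in> P \<Longrightarrow> continuous_on S (e i)"
  shows "norm_continuous_on p S (\<lambda>s. \<Sum>i\<in>P. e i s *\<^sub>C G i)"
  unfolding norm_continuous_on_def
proof
  fix z assume z: "z \<in> S"
  have diff: "(\<Sum>i\<in>P. e i w *\<^sub>C G i) - (\<Sum>i\<in>P. e i z *\<^sub>C G i) = (\<Sum>i\<in>P. (e i w - e i z) *\<^sub>C G i)" for w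
    by (simp only: scaleC_diff_left sum_subtractf)
  have bound: "0 \<le> p (\<Sum>i\<in>P. (e i w - e i z) *\<^sub>C G i) \<and>
      p (\<Sum>i\<in>P. (e i w - e i z) *\<^sub>C G i) \<le> (\<Sum>i\<in>P. cmod (e i w - e i z) * entry_norm n (G i))" for w
    using p [OF combination_matrices [of P G n "\<lambda>i. e i w - e i z", OF G]]
      entry_norm_combination_le [of P G n "\<lambda>i. e i w - e i z", OF G] by fastforce
  have "((\<lambda>w. \<Sum>i\<in>P. cmod (e i w - e i z) * entry_norm n (G i)) \<longlongrightarrow>
      (\<Sum>i\<in>P. cmod (e i z - e i z) * entry_norm n (G i))) (at z within S)"
    using e z by (intro tendsto_intros) (auto simp: continuous_on)
  then have lim: "((\<lambda>w. \<Sum>i\<in>P. cmod (e i w - e i z) * entry_norm n (G i)) \<longlongrightarrow> 0) (at z within S)"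
    by simp
  show "((\<lambda>w. p ((\<Sum>i\<in>P. e i w *\<^sub>C G i) - (\<Sum>i\<in>P. e i z *\<^sub>C G i))) \<longlongrightarrow> 0) (at z within S)"
    unfolding diff
    by (rule tendsto_sandwich [OF _ _ tendsto_const lim]) (use bound in \<open>auto intro: always_eventually\<close>)
qed

lemma norm_holomorphic_on_combination:
  assumes p: "\<And>X. X \<in> matrices n ell2 \<Longrightarrow> 0 \<le> p X \<and> p X \<le> entry_norm n X"
    and G: "\<And>i. i \<in> P \<Longrightarrow> G i \<in> matrices n ell2"
    and e: "\<And>i z. i \<in> P \<Longrightarrow> z \<in> S \<Longrightarrow> (e i has_field_derivative e' i z) (at z within S)"
  shows "norm_holomorphic_on (matrices n ell2) p S (\<lambda>z. \<Sum>i\<in>P. e i z *\<^sub>C G i)"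
  unfolding norm_holomorphic_on_def
proof
  fix z assume z: "z \<in> S"
  define D where "D = (\<Sum>i\<in>P. e' i z *\<^sub>C G i)"
  define c where "c i w = inverse (w - z) * (e i w - e i z) - e' i z" for i w
  have diff: "inverse (w - z) *\<^sub>C ((\<Sum>i\<in>P. e i w *\<^sub>C G i) - (\<Sum>i\<in>P. e i z *\<^sub>C G i)) - D =
      (\<Sum>i\<in>P. c i w *\<^sub>C G i)" for w
    unfolding D_def c_def
    by (simp only: scaleC_diff_left sum_subtractf [symmetric] scaleC_sum_right scaleC_scaleC [symmetric]
        scaleC_diff_right)
  have bound: "0 \<le> p (\<Sum>i\<in>P. c i w *\<^sub>C G i) \<and>
      p (\<Sum>i\<in>P. c i w *\<^sub>C G i) \<le> (\<Sum>i\<in>P. cmod (c i w) * entry_norm n (G i))" for w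
    using p [OF combination_matrices [of P G n "\<lambda>i. c i w", OF G]]
      entry_norm_combination_le [of P G n "\<lambda>i. c i w", OF G] by fastforce
  have c: "(c i \<longlongrightarrow> 0) (at z within S)" if "i \<in> P" for i
  proof -
    have "((\<lambda>w. (e i w - e i z) / (w - z)) \<longlongrightarrow> e' i z) (at z within S)"
      using e [OF that z] by (simp add: has_field_derivative_iff)
    then have "((\<lambda>w. (e i w - e i z) / (w - z) - e' i z) \<longlongrightarrow> e' i z - e' i z) (at z within S)"
      by (intro tendsto_intros)
    then show ?thesis by (simp add: c_def [abs_def] divide_inverse mult.commute)
  qed
  have "((\<lambda>w. \<Sum>i\<in>P. cmod (c i w) * entry_norm n (G i)) \<longlongrightarrow>
      (\<Sum>i\<in>P. cmod 0 * entry_norm n (G i))) (at z within S)"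
    using c by (intro tendsto_intros)
  then have lim: "((\<lambda>w. \<Sum>i\<in>P. cmod (c i w) * entry_norm n (G i)) \<longlongrightarrow> 0) (at z within S)"
    by simp
  have "((\<lambda>w. p (inverse (w - z) *\<^sub>C ((\<Sum>i\<in>P. e i w *\<^sub>C G i) - (\<Sum>i\<in>P. e i z *\<^sub>C G i)) - D)) \<longlongrightarrow> 0)
      (at z within S)"
    unfolding diff
    by (rule tendsto_sandwich [OF _ _ tendsto_const lim]) (use bound in \<open>auto intro: always_eventually\<close>)
  moreover have "D \<in> matrices n ell2" unfolding D_def by (intro combination_matrices G)
  ultimately show "\<exists>D\<in>matrices n ell2. ((\<lambda>w. p (inverse (w - z) *\<^sub>C
      ((\<Sum>i\<in>P. e i w *\<^sub>C G i) - (\<Sum>i\<in>P. e i z *\<^sub>C G i)) - D)) \<longlongrightarrow> 0) (at z within S)"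
    by blast
qed

text \<open>In eigenbases, complex powers of densities are diagonal with exponential entries, so the
  function to be tested is a finite sum of this kind. On the strip the real parts of the exponents
  are bounded, and so are the coefficients.\<close>

lemma exponential_sum_calderon:
  fixes \<mu> :: "'p \<Rightarrow> real" and r :: real
  assumes G: "\<And>p. p \<in> P \<Longrightarrow> G p \<in> matrices n ell2"
  shows "(\<lambda>z. \<Sum>p\<in>P. exp ((z - of_real r) * of_real (\<mu> p)) *\<^sub>C G p) \<in>
    calderon_functions (matrices n ell2) (column_norm n) (matrices n ell2) (row_norm n)"
proof -
  define e where "e p z = exp ((z - of_real r) * complex_of_real (\<mu> p))" for p z
  define F where "F z = (\<Sum>p\<in>P. e p z *\<^sub>C G p)" for z
  have F_mem: "F z \<in> matrices n ell2" for z unfolding F_def by (intro combination_matrices G)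
  define B where "B = (\<Sum>p\<in>P. exp ((1 + \<bar>r\<bar>) * \<bar>\<mu> p\<bar>) * entry_norm n (G p))"
  have F_le: "entry_norm n (F z) \<le> B" if "0 \<le> Re z" "Re z \<le> 1" for z
  proof -
    have "cmod (e p z) \<le> exp ((1 + \<bar>r\<bar>) * \<bar>\<mu> p\<bar>)" for p
    proof -
      have "(Re z - r) * \<mu> p \<le> \<bar>Re z - r\<bar> * \<bar>\<mu> p\<bar>" by (simp add: abs_mult [symmetric])
      also have "\<dots> \<le> (1 + \<bar>r\<bar>) * \<bar>\<mu> p\<bar>" using that by (intro mult_right_mono) auto
      finally show ?thesis by (simp add: e_def)
    qed
    then have "(\<Sum>p\<in>P. cmod (e p z) * entry_norm n (G p)) \<le> B"
      unfolding B_def by (intro sum_mono mult_right_mono entry_norm_nonneg G)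
    then show ?thesis unfolding F_def using entry_norm_combination_le [of P G n "\<lambda>p. e p z", OF G] by fastforce
  qed
  have cont: "norm_continuous_on p S (\<lambda>s. F (\<phi> s))"
    if "\<And>X. X \<in> matrices n ell2 \<Longrightarrow> 0 \<le> p X \<and> p X \<le> entry_norm n X" "continuous_on S \<phi>"
    for p and S :: "'s::topological_space set" and \<phi>
    unfolding F_def e_def
    by (rule norm_continuous_on_combination [OF that(1) G]) (use that(2) in \<open>auto intro!: continuous_intros\<close>)
  have line: "continuous_on UNIV (Complex a)" for a
  proof -
    have "Complex a = (\<lambda>t. of_real a + \<i> * of_real t)" by (simp add: fun_eq_iff complex_eq_iff)
    then show ?thesis by (simp only:) (intro continuous_intros)
  qed
  have "F \<in> calderon_functions (matrices n ell2) (column_norm n) (matrices n ell2) (row_norm n)"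
    unfolding calderon_functions_def sum_space_self [OF csubspace_ell2_matrices]
  proof (intro CollectI conjI ballI allI F_mem)
    show "\<exists>B. \<forall>z\<in>{z. 0 \<le> Re z \<and> Re z \<le> 1}. CR_sum_norm n (F z) \<le> B"
      using order_trans [OF sum_norm_le_entry_norm(2) [OF F_mem] F_le] by blast
    show "norm_continuous_on (CR_sum_norm n) {z. 0 \<le> Re z \<and> Re z \<le> 1} F"
      using cont [of "CR_sum_norm n" "{z. 0 \<le> Re z \<and> Re z \<le> 1}" "\<lambda>z. z"] sum_norm_le_entry_norm
      by simp
    show "norm_holomorphic_on (matrices n ell2) (CR_sum_norm n) {z. 0 < Re z \<and> Re z < 1} F"
      unfolding F_def
      by (rule norm_holomorphic_on_combination [where e' = "\<lambda>p z. of_real (\<mu> p) * e p z"])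
        (auto simp: sum_norm_le_entry_norm G e_def intro!: derivative_eq_intros)
    show "\<exists>B. \<forall>t. column_norm n (F (Complex 0 t)) \<le> B"
      by (intro exI [of _ B] allI order_trans [OF column_norm_le_entry_norm(2) [OF F_mem] F_le]) simp_all
    show "\<exists>B. \<forall>t. row_norm n (F (Complex 1 t)) \<le> B"
      by (intro exI [of _ B] allI order_trans [OF row_norm_le_entry_norm(2) [OF F_mem] F_le]) simp_all
    show "norm_continuous_on (column_norm n) UNIV (\<lambda>t. F (Complex 0 t))"
      using column_norm_le_entry_norm line by (intro cont) auto
    show "norm_continuous_on (row_norm n) UNIV (\<lambda>t. F (Complex 1 t))"
      using row_norm_le_entry_norm line by (intro cont) auto
  qed
  then show ?thesis by (simp add: F_def [abs_def] e_def)
qed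

text \<open>One admissible function bounds the infimum, provided the set of competing values is
  bounded below. It is bounded by 0: every competitor has a bounded column norm on the left edge,
  whose supremum dominates its nonnegative value at height 0.\<close>

lemma CR_norm_le:
  assumes F: "F \<in> calderon_functions (matrices n ell2) (column_norm n) (matrices n ell2) (row_norm n)"
    and "F (of_real \<theta>) = X"
    and "\<And>t. column_norm n (F (Complex 0 t)) \<le> B" "\<And>t. row_norm n (F (Complex 1 t)) \<le> B"
  shows "CR_norm \<theta> n X \<le> B"
proof -
  let ?C = "calderon_functions (matrices n ell2) (column_norm n) (matrices n ell2) (row_norm n)"
  let ?S = "{calderon_norm (column_norm n) (row_norm n) F | F. F \<in> ?C \<and> F (of_real \<theta>) = X}"
  have "bdd_below ?S"
  proof (rule bdd_belowI [of _ 0])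
    fix s assume "s \<in> ?S"
    then obtain H where H: "H \<in> ?C" and s: "s = calderon_norm (column_norm n) (row_norm n) H"
      by blast
    from H obtain B' where B': "\<And>t. column_norm n (H (Complex 0 t)) \<le> B'"
      and mem: "H (Complex 0 0) \<in> matrices n ell2"
      unfolding calderon_functions_def by blast
    have "0 \<le> column_norm n (H (Complex 0 0))" by (rule column_norm_le_entry_norm(1) [OF mem])
    also have "\<dots> \<le> (SUP t. column_norm n (H (Complex 0 t)))"
      using B' by (intro cSUP_upper bdd_aboveI2 [of _ _ B']) auto
    finally show "0 \<le> s" by (simp add: s calderon_norm_def)
  qed
  then have "CR_norm \<theta> n X \<le> calderon_norm (column_norm n) (row_norm n) F"
    unfolding CR_norm_def interpolation_norm_def using assms(1,2) by (intro cInf_lower) auto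
  also have "\<dots> \<le> B"
    unfolding calderon_norm_def using assms(3,4) by (auto intro: cSUP_least)
  finally show ?thesis .
qed

text \<open>For the extremal densities \<open>a = v \<alpha> v\<^sup>*\<close> and \<open>b = w \<beta> w\<^sup>*\<close> the function
  \<open>F(z) = a\<^bsup>(\<theta>-z)/2\<^esup> U b\<^bsup>(z-\<theta>)/2\<^esup>\<close> is bounded by \<open>\<surd>M\<close> in the column norm on the
  line \<open>Re z = 0\<close> and in the row norm on the line \<open>Re z = 1\<close>.\<close>

lemma CR_norm_le_extremal:
  fixes U :: "(nat \<Rightarrow> complex) matrix"
  assumes \<theta>: "0 < \<theta>" "\<theta> < 1" and U: "U \<in> matrices n ell2"
    and v: "unitary n v" and w: "unitary n w"
    and \<alpha>: "\<And>k. k < n \<Longrightarrow> 0 < \<alpha> k" and \<beta>: "\<And>l. l < n \<Longrightarrow> 0 < \<beta> l" and M: "0 \<le> M"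
    and col: "\<And>d. (\<Sum>k<n. \<alpha> k powr \<theta> * (ell2_norm (\<Sum>l<n. d l *\<^sub>C compress n v U w k l))\<^sup>2) \<le>
      M * (\<Sum>l<n. \<beta> l powr \<theta> * (cmod (d l))\<^sup>2)"
    and row: "\<And>d. (\<Sum>l<n. \<beta> l powr (1 - \<theta>) * (ell2_norm (\<Sum>k<n. d k *\<^sub>C compress n v U w k l))\<^sup>2) \<le>
      M * (\<Sum>k<n. \<alpha> k powr (1 - \<theta>) * (cmod (d k))\<^sup>2)"
  shows "CR_norm \<theta> n U \<le> sqrt M"
proof -
  define V where "V = compress n v U w"
  note vM = unitary_matrices [OF v] and wM = unitary_matrices [OF w]
  have V: "V \<in> matrices n ell2"
    unfolding V_def by (intro compress_matrices csubspace_ell2 vM wM U)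
  have Vkl: "V k l \<in> ell2" if "k < n" "l < n" for k l using V that by (simp add: matrices_iff)
  define P where "P = {..<n} \<times> {..<n}"
  \<comment> \<open>Chosen so that exp ((z - \<theta>) \<mu>) is the product of
    \<alpha>^((\<theta>-z)/2) and \<beta>^((z-\<theta>)/2), the factor by which F multiplies the
    entry (k,l) in the eigenbases.\<close>
  define \<mu> where "\<mu> p = (ln (\<beta> (snd p)) - ln (\<alpha> (fst p))) / 2" for p :: "nat \<times> nat"
  \<comment> \<open>The entry (k,l) of V transported back to the original coordinates; at z =
    \<theta> all factors are 1 and these pieces add up to U.\<close>
  define G where "G p = (\<lambda>i j. (v i (fst p) * cnj (w j (snd p))) *\<^sub>C V (fst p) (snd p))"
    for p :: "nat \<times> nat"
  have G: "G p \<in> matrices n ell2" if "p \<in> P" for p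
    using that matrices_outside [OF vM] matrices_outside [OF wM]
    by (auto simp: matrices_iff G_def P_def ell2_scaleC Vkl)
  define F where "F z = (\<Sum>p\<in>P. exp ((z - of_real \<theta>) * of_real (\<mu> p)) *\<^sub>C G p)" for z
  have F_mem: "F z \<in> matrices n ell2" for z unfolding F_def by (intro combination_matrices G)
  define a where "a z k = exp ((z - of_real \<theta>) * of_real (- ln (\<alpha> k) / 2))" for z :: complex and k
  define b where "b z l = exp ((z - of_real \<theta>) * of_real (ln (\<beta> l) / 2))" for z :: complex and l
  have exp_ab: "exp ((z - of_real \<theta>) * of_real (\<mu> (k, l))) = a z k * b z l" for z k l
    unfolding a_def b_def \<mu>_def exp_add [symmetric]
    by (simp add: diff_divide_distrib algebra_simps)
  have F_entry: "F z i j = (\<Sum>k<n. \<Sum>l<n. (a z k * b z l * (v i k * cnj (w j l))) *\<^sub>C V k l)" for z i j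
  proof -
    have "F z i j = (\<Sum>p\<in>P. exp ((z - of_real \<theta>) * of_real (\<mu> p)) *\<^sub>C G p i j)"
      by (simp add: F_def sum_fun_apply) (simp add: scaleC_fun_def)
    also have "\<dots> = (\<Sum>(k, l)\<in>P. (a z k * b z l * (v i k * cnj (w j l))) *\<^sub>C V k l)"
      by (intro sum.cong refl) (auto simp: exp_ab G_def scaleC_scaleC)
    finally show ?thesis unfolding P_def sum.cartesian_product .
  qed
  have F_\<theta>: "F (of_real \<theta>) = U"
  proof (rule matrix_eqI [OF F_mem U])
    fix i j assume "i < n" "j < n"
    have "U = rmul n (lmul n v V) (matrix_star w)"
      using lmul_unitary_cancel(1) [OF v U] rmul_unitary_cancel(1) [OF w U]
      by (simp add: V_def compress_def lmul_rmul)
    then have "U i j = (\<Sum>l<n. \<Sum>k<n. (v i k * cnj (w j l)) *\<^sub>C V k l)"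
      by (simp add: rmul_def lmul_def matrix_star_def star_complex_def scaleC_sum_right scaleC_scaleC
          mult.commute)
    also have "\<dots> = (\<Sum>k<n. \<Sum>l<n. (v i k * cnj (w j l)) *\<^sub>C V k l)" by (rule sum.swap)
    finally show "F (of_real \<theta>) i j = U i j" by (simp add: F_entry a_def b_def)
  qed
  \<comment> \<open>The moduli depend on Re z only. On the left edge a yields the weight
    \<alpha>^\<theta> of \<open>col\<close> while b cancels \<beta>^\<theta>; on the right edge b
    yields \<beta>^(1-\<theta>) and a cancels \<alpha>^(1-\<theta>).\<close>
  have norm_a: "(cmod (a z k))\<^sup>2 = \<alpha> k powr (\<theta> - Re z)" if "k < n" for z k
    using \<alpha> [OF that] by (simp add: a_def exp_double [symmetric] powr_def field_simps)
  have norm_b: "(cmod (b z l))\<^sup>2 = \<beta> l powr (Re z - \<theta>)" if "l < n" for z l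
    using \<beta> [OF that] by (simp add: b_def exp_double [symmetric] powr_def field_simps)
  have v_iso: "(\<Sum>i<n. v i k * cnj (v i l)) = (if k = l then 1 else 0)"
      "(\<Sum>i<n. v k i * cnj (v l i)) = (if k = l then 1 else 0)" if "k < n" "l < n" for k l
    using unitary_columns [OF v that(2,1)] unitary_columns [OF v that]
    by (auto simp: mult.commute)
  have w_iso: "(\<Sum>i<n. cnj (w i k) * cnj (cnj (w i l))) = (if k = l then 1 else 0)"
      "(\<Sum>i<n. cnj (w k i) * cnj (cnj (w l i))) = (if k = l then 1 else 0)" if "k < n" "l < n" for k l
    using unitary_columns [OF w that(2,1)] unitary_columns [OF w that]
    by (auto simp: mult.commute)
  have column: "column_norm n (F (Complex 0 t)) \<le> sqrt M" for t
  proof (rule column_norm_bounds(2) [OF F_mem])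
    fix c
    let ?z = "Complex 0 t"
    \<comment> \<open>The coordinates of c in the basis of columns of w. The remaining factor v on
      the left is an isometry and drops out of the norm.\<close>
    define c' where "c' l = (\<Sum>j<n. cnj (w j l) * c j)" for l
    have "(\<Sum>j<n. c j *\<^sub>C F ?z i j) =
        (\<Sum>k<n. v i k *\<^sub>C (a ?z k *\<^sub>C (\<Sum>l<n. (b ?z l * c' l) *\<^sub>C V k l)))" for i
    proof -
      have "(\<Sum>j<n. c j *\<^sub>C F ?z i j) =
          (\<Sum>j<n. \<Sum>k<n. \<Sum>l<n. (c j * (a ?z k * b ?z l * (v i k * cnj (w j l)))) *\<^sub>C V k l)"
        by (simp add: F_entry scaleC_sum_right scaleC_scaleC)
      also have "\<dots> = (\<Sum>k<n. \<Sum>j<n. \<Sum>l<n. (c j * (a ?z k * b ?z l * (v i k * cnj (w j l)))) *\<^sub>C V k l)"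
        by (rule sum.swap)
      also have "\<dots> = (\<Sum>k<n. \<Sum>l<n. \<Sum>j<n. (c j * (a ?z k * b ?z l * (v i k * cnj (w j l)))) *\<^sub>C V k l)"
        by (intro sum.cong refl sum.swap)
      also have "\<dots> = (\<Sum>k<n. v i k *\<^sub>C (a ?z k *\<^sub>C (\<Sum>l<n. (b ?z l * c' l) *\<^sub>C V k l)))"
        unfolding c'_def scaleC_sum_right scaleC_scaleC scaleC_sum_left [symmetric] sum_distrib_left
        by (simp add: mult_ac)
      finally show ?thesis .
    qed
    then have "(\<Sum>i<n. (ell2_norm (\<Sum>j<n. c j *\<^sub>C F ?z i j))\<^sup>2) =
        (\<Sum>k<n. (ell2_norm (a ?z k *\<^sub>C (\<Sum>l<n. (b ?z l * c' l) *\<^sub>C V k l)))\<^sup>2)"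
      using v_iso(1) by (simp only:) (intro sum_norm_isometry ell2_scaleC ell2_combination Vkl; simp)
    also have "\<dots> = (\<Sum>k<n. \<alpha> k powr \<theta> * (ell2_norm (\<Sum>l<n. (b ?z l * c' l) *\<^sub>C V k l))\<^sup>2)"
    proof (intro sum.cong refl)
      fix k assume k: "k \<in> {..<n}"
      have "(\<Sum>l<n. (b ?z l * c' l) *\<^sub>C V k l) \<in> ell2"
        using k by (intro ell2_combination Vkl) auto
      then show "(ell2_norm (a ?z k *\<^sub>C (\<Sum>l<n. (b ?z l * c' l) *\<^sub>C V k l)))\<^sup>2 =
          \<alpha> k powr \<theta> * (ell2_norm (\<Sum>l<n. (b ?z l * c' l) *\<^sub>C V k l))\<^sup>2"
        using norm_a [of k ?z] k by (simp add: ell2_norm_scaleC power_mult_distrib)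
    qed
    \<comment> \<open>The extremal inequality at d = b c', whose weight \<beta>^\<theta> is
      cancelled by the modulus of b.\<close>
    also have "\<dots> \<le> M * (\<Sum>l<n. \<beta> l powr \<theta> * (cmod (b ?z l * c' l))\<^sup>2)"
      unfolding V_def by (rule col)
    also have "(\<Sum>l<n. \<beta> l powr \<theta> * (cmod (b ?z l * c' l))\<^sup>2) = (\<Sum>l<n. (cmod (c' l))\<^sup>2)"
    proof (intro sum.cong refl)
      fix l assume "l \<in> {..<n}"
      then have "\<beta> l powr \<theta> * (cmod (b ?z l))\<^sup>2 = 1"
        using norm_b [of l ?z] \<beta> [of l] by (simp add: powr_add [symmetric])
      then show "\<beta> l powr \<theta> * (cmod (b ?z l * c' l))\<^sup>2 = (cmod (c' l))\<^sup>2"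
        by (simp add: norm_mult power_mult_distrib mult.assoc [symmetric])
    qed
    also have "\<dots> = (\<Sum>j<n. (cmod (c j))\<^sup>2)"
      unfolding c'_def by (rule sum_cmod_isometry [of n "\<lambda>l j. cnj (w j l)"]) (rule w_iso(2))
    finally show "(\<Sum>i<n. (ell2_norm (\<Sum>j<n. c j *\<^sub>C F ?z i j))\<^sup>2) \<le>
        (sqrt M)\<^sup>2 * (\<Sum>j<n. (cmod (c j))\<^sup>2)"
      using M by simp
  qed (use M in simp)
  have row': "row_norm n (F (Complex 1 t)) \<le> sqrt M" for t
  proof (rule row_norm_bounds(2) [OF F_mem])
    fix c
    let ?z = "Complex 1 t"
    \<comment> \<open>The row estimate sums over the left index, so v enters through its transpose,
      without conjugation, and w now plays the role of the outer isometry.\<close>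
    define c' where "c' k = (\<Sum>i<n. v i k * c i)" for k
    have "(\<Sum>i<n. c i *\<^sub>C F ?z i j) =
        (\<Sum>l<n. cnj (w j l) *\<^sub>C (b ?z l *\<^sub>C (\<Sum>k<n. (a ?z k * c' k) *\<^sub>C V k l)))" for j
    proof -
      have "(\<Sum>i<n. c i *\<^sub>C F ?z i j) =
          (\<Sum>i<n. \<Sum>k<n. \<Sum>l<n. (c i * (a ?z k * b ?z l * (v i k * cnj (w j l)))) *\<^sub>C V k l)"
        by (simp add: F_entry scaleC_sum_right scaleC_scaleC)
      also have "\<dots> = (\<Sum>i<n. \<Sum>l<n. \<Sum>k<n. (c i * (a ?z k * b ?z l * (v i k * cnj (w j l)))) *\<^sub>C V k l)"
        by (intro sum.cong refl sum.swap)
      also have "\<dots> = (\<Sum>l<n. \<Sum>i<n. \<Sum>k<n. (c i * (a ?z k * b ?z l * (v i k * cnj (w j l)))) *\<^sub>C V k l)"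
        by (rule sum.swap)
      also have "\<dots> = (\<Sum>l<n. \<Sum>k<n. \<Sum>i<n. (c i * (a ?z k * b ?z l * (v i k * cnj (w j l)))) *\<^sub>C V k l)"
        by (intro sum.cong refl sum.swap)
      also have "\<dots> = (\<Sum>l<n. cnj (w j l) *\<^sub>C (b ?z l *\<^sub>C (\<Sum>k<n. (a ?z k * c' k) *\<^sub>C V k l)))"
        unfolding c'_def scaleC_sum_right scaleC_scaleC scaleC_sum_left [symmetric] sum_distrib_left
        by (simp add: mult_ac)
      finally show ?thesis .
    qed
    then have "(\<Sum>j<n. (ell2_norm (\<Sum>i<n. c i *\<^sub>C F ?z i j))\<^sup>2) =
        (\<Sum>l<n. (ell2_norm (b ?z l *\<^sub>C (\<Sum>k<n. (a ?z k * c' k) *\<^sub>C V k l)))\<^sup>2)"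
      using w_iso(1) by (simp only:) (intro sum_norm_isometry ell2_scaleC ell2_combination Vkl; simp)
    also have "\<dots> = (\<Sum>l<n. \<beta> l powr (1 - \<theta>) * (ell2_norm (\<Sum>k<n. (a ?z k * c' k) *\<^sub>C V k l))\<^sup>2)"
    proof (intro sum.cong refl)
      fix l assume l: "l \<in> {..<n}"
      have "(\<Sum>k<n. (a ?z k * c' k) *\<^sub>C V k l) \<in> ell2"
        using l by (intro ell2_combination Vkl) auto
      then show "(ell2_norm (b ?z l *\<^sub>C (\<Sum>k<n. (a ?z k * c' k) *\<^sub>C V k l)))\<^sup>2 =
          \<beta> l powr (1 - \<theta>) * (ell2_norm (\<Sum>k<n. (a ?z k * c' k) *\<^sub>C V k l))\<^sup>2"
        using norm_b [of l ?z] l by (simp add: ell2_norm_scaleC power_mult_distrib)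
    qed
    also have "\<dots> \<le> M * (\<Sum>k<n. \<alpha> k powr (1 - \<theta>) * (cmod (a ?z k * c' k))\<^sup>2)"
      unfolding V_def by (rule row)
    also have "(\<Sum>k<n. \<alpha> k powr (1 - \<theta>) * (cmod (a ?z k * c' k))\<^sup>2) = (\<Sum>k<n. (cmod (c' k))\<^sup>2)"
    proof (intro sum.cong refl)
      fix k assume "k \<in> {..<n}"
      then have "\<alpha> k powr (1 - \<theta>) * (cmod (a ?z k))\<^sup>2 = 1"
        using norm_a [of k ?z] \<alpha> [of k] by (simp add: powr_add [symmetric])
      then show "\<alpha> k powr (1 - \<theta>) * (cmod (a ?z k * c' k))\<^sup>2 = (cmod (c' k))\<^sup>2"
        by (simp add: norm_mult power_mult_distrib mult.assoc [symmetric])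
    qed
    also have "\<dots> = (\<Sum>i<n. (cmod (c i))\<^sup>2)"
      unfolding c'_def by (rule sum_cmod_isometry [of n "\<lambda>k i. v i k"]) (rule v_iso(2))
    finally show "(\<Sum>j<n. (ell2_norm (\<Sum>i<n. c i *\<^sub>C F ?z i j))\<^sup>2) \<le>
        (sqrt M)\<^sup>2 * (\<Sum>i<n. (cmod (c i))\<^sup>2)"
      using M by simp
  qed (use M in simp)
  show ?thesis
  proof (rule CR_norm_le [OF _ F_\<theta> column row'])
    show "F \<in> calderon_functions (matrices n ell2) (column_norm n) (matrices n ell2) (row_norm n)"
      using exponential_sum_calderon [of P G n \<theta> \<mu>, OF G] by (simp add: F_def [abs_def])
  qed
qed

lemma CR_norm_le_weighted:
  fixes U :: "(nat \<Rightarrow> complex) matrix"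
  assumes \<theta>: "0 < \<theta>" "\<theta> < 1" and n: "1 \<le> n" and U: "U \<in> matrices n ell2" and K: "0 \<le> K"
    and bound: "\<And>v w \<alpha> \<beta>. unitary n v \<Longrightarrow> unitary n w \<Longrightarrow> \<alpha> \<in> weights n \<Longrightarrow> \<beta> \<in> weights n \<Longrightarrow>
      (\<Sum>k<n. \<Sum>l<n. \<alpha> k powr \<theta> * \<beta> l powr (1 - \<theta>) * (ell2_norm (compress n v U w k l))\<^sup>2) \<le> K\<^sup>2"
  shows "CR_norm \<theta> n U \<le> K"
proof (rule dense_ge)
  fix B assume B: "K < B"
  \<comment> \<open>This \<epsilon> makes K^2 + \<epsilon> n^2 equal to B^2, so the extremal value M
    is at most B^2 for an arbitrary B > K.\<close>
  define \<epsilon> where "\<epsilon> = (B\<^sup>2 - K\<^sup>2) / (real n)\<^sup>2"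
  have "K\<^sup>2 < B\<^sup>2" using B K by (simp add: power_strict_mono)
  then have \<epsilon>: "0 < \<epsilon>" using n by (simp add: \<epsilon>_def)
  obtain v w \<alpha> \<beta> M where v: "unitary n v" and w: "unitary n w"
    and pos: "\<And>k. k < n \<Longrightarrow> 0 < \<alpha> k" "\<And>l. l < n \<Longrightarrow> 0 < \<beta> l"
    and M: "0 \<le> M" "M \<le> K\<^sup>2 + \<epsilon> * (real n)\<^sup>2"
    and col: "\<And>d. (\<Sum>k<n. \<alpha> k powr \<theta> * (ell2_norm (\<Sum>l<n. d l *\<^sub>C compress n v U w k l))\<^sup>2) \<le>
      M * (\<Sum>l<n. \<beta> l powr \<theta> * (cmod (d l))\<^sup>2)"
    and row: "\<And>d. (\<Sum>l<n. \<beta> l powr (1 - \<theta>) * (ell2_norm (\<Sum>k<n. d k *\<^sub>C compress n v U w k l))\<^sup>2) \<le>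
      M * (\<Sum>k<n. \<alpha> k powr (1 - \<theta>) * (cmod (d k))\<^sup>2)"
    using extremal_densities [OF \<theta> n U \<epsilon> bound] by blast
  have "CR_norm \<theta> n U \<le> sqrt M"
    by (rule CR_norm_le_extremal [OF \<theta> U v w _ _ M(1) col row]) (rule pos; assumption)+
  also have "M \<le> B\<^sup>2" using M(2) n by (simp add: \<epsilon>_def)
  then have "sqrt M \<le> B" using B K by (intro real_le_lsqrt) auto
  finally show "CR_norm \<theta> n U \<le> B" .
qed


subsection \<open>Maps bounded by a pair of states\<close>

lemma clinear_on_zero:
  assumes "csubspace E" "clinear_on E u"
  shows "u 0 = 0"
proof -
  have "u (0 *\<^sub>C 0) = 0 *\<^sub>C u 0" using assms unfolding clinear_on_def csubspace_def by blast
  then show ?thesis by simp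
qed

lemma clinear_on_sum:
  assumes E: "csubspace E" and u: "clinear_on E u" and "\<And>i. i \<in> I \<Longrightarrow> x i \<in> E"
  shows "u (\<Sum>i\<in>I. c i *\<^sub>C x i) = (\<Sum>i\<in>I. c i *\<^sub>C u (x i))"
  using assms(3)
proof (induction I rule: infinite_finite_induct)
  case (insert i I)
  have "c i *\<^sub>C x i \<in> E" "(\<Sum>i\<in>I. c i *\<^sub>C x i) \<in> E"
    using E insert.prems by (auto simp: csubspace_def intro!: csubspace_sum [OF E])
  then have "u (c i *\<^sub>C x i + (\<Sum>i\<in>I. c i *\<^sub>C x i)) = c i *\<^sub>C u (x i) + u (\<Sum>i\<in>I. c i *\<^sub>C x i)"
    using u insert.prems by (simp add: clinear_on_def)
  also have "u (\<Sum>i\<in>I. c i *\<^sub>C x i) = (\<Sum>i\<in>I. c i *\<^sub>C u (x i))"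
    using insert by simp
  finally show ?case by (simp only: sum.insert [OF insert.hyps])
qed (simp_all add: clinear_on_zero [OF E u])

lemma compress_clinear_on:
  assumes "csubspace E" "clinear_on E u" "X \<in> matrices n E"
  shows "compress n v (\<lambda>i j. u (X i j)) w k l = u (compress n v X w k l)"
proof -
  have entry: "compress n v Y w k l =
      (\<Sum>p\<in>{..<n}\<times>{..<n}. (cnj (v (snd p) k) * w (fst p) l) *\<^sub>C Y (snd p) (fst p))"
    for Y :: "'v::complex_vector matrix"
    unfolding compress_eq sum.cartesian_product by (simp add: case_prod_unfold)
  show ?thesis
    unfolding entry
    by (rule clinear_on_sum [OF assms(1,2), symmetric]) (use assms(3) in \<open>auto simp: matrices_iff\<close>)
qed

context cstar_matrices
begin

lemma N_compress_unitary:
  assumes "unitary n v" "unitary n w" "X \<in> M"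
  shows "N (compress n v X w) = N X"
proof -
  have "lmul n (matrix_star v) X \<in> M"
    using assms by (intro matrices_lmul csubspace_UNIV unitary_matrices unitary_star)
  then show ?thesis
    unfolding compress_def using assms by (simp add: N_rmul_unitary N_lmul_unitary unitary_star)
qed

text \<open>Since Y is in the unit ball, the values of f on \<open>Y_kl^* Y_kl\<close> sum to at
  most 1 along each column, and those of g on \<open>Y_kl Y_kl^*\<close> along each row. Young's
  inequality separates the product into two sums to which these bounds apply, and the weights then
  sum to 1.\<close>

lemma weighted_state_bound:
  assumes \<theta>: "0 < \<theta>" "\<theta> < 1" and f: "state f" and g: "state g"
    and Y: "Y \<in> M" "N Y \<le> 1" and \<alpha>: "\<alpha> \<in> weights n" and \<beta>: "\<beta> \<in> weights n"
  shows "(\<Sum>k<n. \<Sum>l<n. \<alpha> k powr \<theta> * \<beta> l powr (1 - \<theta>) *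
    (Re (f (star (Y k l) * Y k l)) powr (1 - \<theta>) * Re (g (Y k l * star (Y k l))) powr \<theta>)) \<le> 1"
proof -
  define p where "p k l = Re (f (star (Y k l) * Y k l))" for k l
  define q where "q k l = Re (g (Y k l * star (Y k l)))" for k l
  have p: "0 \<le> p k l" and q: "0 \<le> q k l" for k l
    using state_nonneg [OF f, of "Y k l"] state_nonneg [OF g, of "star (Y k l)"]
    by (simp_all add: p_def q_def star_star)
  have sq: "(N Y)\<^sup>2 \<le> 1" using Y N_nonneg by (simp add: power_le_one)
  have p_sum: "(\<Sum>k<n. p k l) \<le> 1" if "l < n" for l
  proof -
    have "(\<Sum>k<n. p k l) = Re (f (\<Sum>k<n. star (Y k l) * Y k l))"
      by (simp add: p_def state_sum [OF f])
    also have "\<dots> \<le> norm (\<Sum>k<n. star (Y k l) * Y k l)"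
      using state_le_norm [OF f] complex_Re_le_cmod order_trans by blast
    also have "\<dots> \<le> 1" using norm_column_le [OF Y(1) that] sq by linarith
    finally show ?thesis .
  qed
  have q_sum: "(\<Sum>l<n. q k l) \<le> 1" if "k < n" for k
  proof -
    have "(\<Sum>l<n. q k l) = Re (g (\<Sum>l<n. Y k l * star (Y k l)))"
      by (simp add: q_def state_sum [OF g])
    also have "\<dots> \<le> norm (\<Sum>l<n. Y k l * star (Y k l))"
      using state_le_norm [OF g] complex_Re_le_cmod order_trans by blast
    also have "\<dots> \<le> 1" using norm_row_le [OF Y(1) that] sq by linarith
    finally show ?thesis .
  qed
  have "(\<Sum>k<n. \<Sum>l<n. \<alpha> k powr \<theta> * \<beta> l powr (1 - \<theta>) * (p k l powr (1 - \<theta>) * q k l powr \<theta>))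
      \<le> (\<Sum>k<n. \<Sum>l<n. (1 - \<theta>) * (\<beta> l * p k l) + \<theta> * (\<alpha> k * q k l))"
  proof (intro sum_mono)
    fix k l
    have \<beta>p: "0 \<le> \<beta> l * p k l" and \<alpha>q: "0 \<le> \<alpha> k * q k l"
      using p q weights_nonneg [OF \<alpha>] weights_nonneg [OF \<beta>] by simp_all
    \<comment> \<open>The exponents match \<beta> l with p, which is summed over k, and \<alpha> k
      with q, which is summed over l.\<close>
    have "\<alpha> k powr \<theta> * \<beta> l powr (1 - \<theta>) * (p k l powr (1 - \<theta>) * q k l powr \<theta>) =
        (\<beta> l * p k l) powr (1 - \<theta>) * (\<alpha> k * q k l) powr \<theta>"
      by (simp add: powr_mult mult_ac)
    also have "\<dots> \<le> (1 - \<theta>) * (\<beta> l * p k l) + \<theta> * (\<alpha> k * q k l)"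
    proof -
      have "0 \<le> \<theta> * (1 - \<theta>) * (sqrt (\<beta> l * p k l) - sqrt (\<alpha> k * q k l))\<^sup>2"
        using \<theta> by (intro mult_nonneg_nonneg) auto
      then show ?thesis using young_gap [OF \<theta> \<beta>p \<alpha>q] by linarith
    qed
    finally show "\<alpha> k powr \<theta> * \<beta> l powr (1 - \<theta>) * (p k l powr (1 - \<theta>) * q k l powr \<theta>)
        \<le> (1 - \<theta>) * (\<beta> l * p k l) + \<theta> * (\<alpha> k * q k l)" .
  qed
  also have "\<dots> = (1 - \<theta>) * (\<Sum>l<n. \<beta> l * (\<Sum>k<n. p k l)) + \<theta> * (\<Sum>k<n. \<alpha> k * (\<Sum>l<n. q k l))"
    unfolding sum.distrib sum_distrib_left by (intro arg_cong2 [where f = "(+)"] refl sum.swap)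
  also have "\<dots> \<le> (1 - \<theta>) * (\<Sum>l<n. \<beta> l * 1) + \<theta> * (\<Sum>k<n. \<alpha> k * 1)"
    using \<theta> p_sum q_sum weights_nonneg [OF \<alpha>] weights_nonneg [OF \<beta>]
    by (intro add_mono mult_left_mono sum_mono) auto
  also have "\<dots> = 1" using \<alpha> \<beta> by (simp add: weights_def)
  finally show ?thesis by (simp only: p_def q_def)
qed

end

theorem proposition3:
  fixes \<theta> K :: real
    and E :: "'a::cstar_algebra set"
    and N :: "nat \<Rightarrow> 'a matrix \<Rightarrow> real"
    and u :: "'a \<Rightarrow> (nat \<Rightarrow> complex)"
    and f g :: "'a \<Rightarrow> complex"
  assumes "0 < \<theta>" and "\<theta> < 1"
    and "csubspace E" and "closed E"
    and "\<And>n. 1 \<le> n \<Longrightarrow> cstar_matrix_norm n (N n)"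
    and "clinear_on E u" and "\<And>a. a \<in> E \<Longrightarrow> u a \<in> ell2"
    and "state f" and "state g"
    and "0 \<le> K"
    and "\<And>a. a \<in> E \<Longrightarrow>
           ell2_norm (u a) \<le> K * Re (f (star a * a)) powr ((1 - \<theta>) / 2)
                               * Re (g (a * star a)) powr (\<theta> / 2)"
  shows "completely_bounded E N (CR_norm \<theta>) u \<and> cb_norm E N (CR_norm \<theta>) u \<le> ereal K"
proof -
  note \<theta> = assms(1,2) and E = assms(3) and lin = assms(6) and ell2 = assms(7)
    and f = assms(8) and g = assms(9) and K = assms(10) and bound = assms(11)
  have "CR_norm \<theta> n (\<lambda>i j. u (X i j)) \<le> K"
    if n: "1 \<le> n" and X: "X \<in> matrices n E" "N n X \<le> 1" for n X
  proof (rule CR_norm_le_weighted [OF \<theta> n _ K])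
    interpret cstar_matrices n "N n" by unfold_locales (rule assms(5) [OF n])
    show "(\<lambda>i j. u (X i j)) \<in> matrices n ell2"
      using X(1) ell2 clinear_on_zero [OF E lin] by (auto simp: matrices_iff)
    fix v w \<alpha> \<beta>
    assume v: "unitary n v" and w: "unitary n w" and \<alpha>: "\<alpha> \<in> weights n" and \<beta>: "\<beta> \<in> weights n"
    \<comment> \<open>By linearity, compressing the matrix of values of u amounts to applying u to
      the entries of the compressed matrix Y. Unitary invariance keeps Y in the unit ball, and
      scalar combinations keep its entries in E, where the hypothesis on u applies.\<close>
    define Y where "Y = compress n v X w"
    have XM: "X \<in> matrices n UNIV" using X(1) by (rule matrices_mono) simp
    have Y: "Y \<in> matrices n E"
      unfolding Y_def by (intro compress_matrices E unitary_matrices v w X)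
    have YM: "Y \<in> matrices n UNIV" using Y by (rule matrices_mono) simp
    have Y_le: "N n Y \<le> 1" unfolding Y_def N_compress_unitary [OF v w XM] by (rule X(2))
    let ?p = "\<lambda>k l. Re (f (star (Y k l) * Y k l))" and ?q = "\<lambda>k l. Re (g (Y k l * star (Y k l)))"
    have "(\<Sum>k<n. \<Sum>l<n. \<alpha> k powr \<theta> * \<beta> l powr (1 - \<theta>) *
        (ell2_norm (compress n v (\<lambda>i j. u (X i j)) w k l))\<^sup>2) \<le>
      (\<Sum>k<n. \<Sum>l<n. \<alpha> k powr \<theta> * \<beta> l powr (1 - \<theta>) *
        (K\<^sup>2 * (?p k l powr (1 - \<theta>) * ?q k l powr \<theta>)))"
      unfolding compress_clinear_on [OF E lin X(1)] Y_def [symmetric]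
    proof (intro sum_mono mult_left_mono)
      fix k l assume "k \<in> {..<n}" "l \<in> {..<n}"
      then have mem: "Y k l \<in> E" using Y by (simp add: matrices_iff)
      have half: "(x powr (t / 2))\<^sup>2 = x powr t" for x t :: real
        by (simp add: power2_eq_square powr_add [symmetric])
      have "(ell2_norm (u (Y k l)))\<^sup>2 \<le> (K * ?p k l powr ((1 - \<theta>) / 2) * ?q k l powr (\<theta> / 2))\<^sup>2"
        by (intro power_mono bound [OF mem] ell2_norm_nonneg ell2 [OF mem])
      also have "\<dots> = K\<^sup>2 * (?p k l powr (1 - \<theta>) * ?q k l powr \<theta>)"
        by (simp only: power_mult_distrib half mult.assoc)
      finally show "(ell2_norm (u (Y k l)))\<^sup>2 \<le> K\<^sup>2 * (?p k l powr (1 - \<theta>) * ?q k l powr \<theta>)" .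
    qed simp
    also have "\<dots> = K\<^sup>2 * (\<Sum>k<n. \<Sum>l<n. \<alpha> k powr \<theta> * \<beta> l powr (1 - \<theta>) *
        (?p k l powr (1 - \<theta>) * ?q k l powr \<theta>))"
      by (simp add: sum_distrib_left mult_ac)
    also have "\<dots> \<le> K\<^sup>2 * 1"
      by (intro mult_left_mono weighted_state_bound [OF \<theta> f g YM Y_le \<alpha> \<beta>]) simp
    finally show "(\<Sum>k<n. \<Sum>l<n. \<alpha> k powr \<theta> * \<beta> l powr (1 - \<theta>) *
        (ell2_norm (compress n v (\<lambda>i j. u (X i j)) w k l))\<^sup>2) \<le> K\<^sup>2" by simp
  qed
  then have cb: "cb_norm E N (CR_norm \<theta>) u \<le> ereal K"
    unfolding cb_norm_def by (intro SUP_least) auto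
  moreover have "cb_norm E N (CR_norm \<theta>) u < \<infinity>"
    using cb by (rule order.strict_trans1) simp
  ultimately show ?thesis by (simp add: completely_bounded_def)
qed

end
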